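(* Let $G$ be a diffeological group and $BG$ its diffeological Milnor classifying space. Then for each $k>0$ we have $\pi_k(BG)\cong\pi_{k-1}(G)$, where $\pi_k$ denotes diffeological homotopy groups.
   Context: Diffeology. A diffeology on a set $X$ is a collection of maps $p\colon U\to X$ ("plots"), $U$ open in some $\mathbb{R}^n$, $n\ge 0$, that contains constant maps, is closed under precomposition with smooth maps between open subsets of Euclidean spaces, and contains every map that is locally a plot. A map is smooth if its composition with every plot is a plot. Subsets carry the subset diffeology, products the product diffeology (maps all of whose components are plots), quotients the quotient diffeology (maps that locally lift to plots); $[0,1]\subseteq\mathbb{R}$ has the subset diffeology; spaces of smooth maps carry the functional diffeology. A diffeological group is a group with a diffeology for which multiplication and inversion are smooth. Diffeological homotopy groups. $\pi_0(X)$ is the set of smooth path components of $X$; for $k\geq1$, $\pi_k(X,x)=\pi_0(\Omega^k(X,x))$, where $\Omega(X,x)$ is the space of smooth paths $\mathbb{R}\to X$ sending $0$ and $1$ to $x$, with the functional diffeology, and $\Omega^{k}(X,x)=\Omega(\Omega^{k-1}(X,x),\text{constant loop})$. Base points are suppressed: $G$ is based at its identity (so that $\pi_0(G)$ is a group, with multiplication induced from $G$) and $BG$ at the image of a point of $EG$. Milnor construction. Let $S_G\subseteq[0,1]^{\mathbb{N}}\times G^{\mathbb{N}}$ be the set of $(t_i,g_i)_{i\in\mathbb{N}}$ with only finitely many $t_i\ne 0$ and $\sum_i t_i=1$, with the subset diffeology of the product diffeology. Define $(t_i,g_i)\sim(t_i',g_i')$ iff $t_i=t_i'$ for all $i$ and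 $g_i=g_i'$ whenever $t_i=t'_i\neq0$. $EG:=S_G/\!\sim$ with the quotient diffeology, with elements $(t_ig_i)$; $G$ acts on $EG$ by $h\cdot(t_ig_i)=(t_ig_ih^{-1})$, and $BG:=EG/G$ with the quotient diffeology. *)

theory Defs
  imports "HOL-Analysis.Analysis" "HOL-Algebra.Group"
begin

section \<open>Smooth maps between open subsets of Euclidean spaces\<close>

text \<open>
  The dimension of the domain of a plot is not fixed, so \<open>\<real>\<^sup>n\<close> is the library's
  \<^const>\<open>Euclidean_space\<close> \<open>n\<close>: the sequences \<open>nat \<Rightarrow> real\<close> vanishing from index \<open>n\<close> on,
  with the product topology.
\<close>

definition partial_deriv :: "nat \<Rightarrow> ((nat \<Rightarrow> real) \<Rightarrow> real) \<Rightarrow> (nat \<Rightarrow> real) \<Rightarrow> real" where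
  "partial_deriv i f x = deriv (\<lambda>s. f (x(i := s))) (x i)"

primrec Ck_on :: "nat \<Rightarrow> nat \<Rightarrow> (nat \<Rightarrow> real) set \<Rightarrow> ((nat \<Rightarrow> real) \<Rightarrow> real) \<Rightarrow> bool" where
  "Ck_on 0 n U f \<longleftrightarrow> continuous_map (subtopology (Euclidean_space n) U) euclideanreal f"
| "Ck_on (Suc k) n U f \<longleftrightarrow>
     continuous_map (subtopology (Euclidean_space n) U) euclideanreal f \<and>
     (\<forall>i<n. (\<forall>x\<in>U. (\<lambda>s. f (x(i := s))) field_differentiable (at (x i))) \<and>
            Ck_on k n U (partial_deriv i f))"

definition smooth_fun :: "nat \<Rightarrow> (nat \<Rightarrow> real) set \<Rightarrow> ((nat \<Rightarrow> real) \<Rightarrow> real) \<Rightarrow> bool" where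
  "smooth_fun n U f \<longleftrightarrow> (\<forall>k. Ck_on k n U f)"

definition euclidean_smooth ::
  "nat \<Rightarrow> (nat \<Rightarrow> real) set \<Rightarrow> nat \<Rightarrow> (nat \<Rightarrow> real) set \<Rightarrow> ((nat \<Rightarrow> real) \<Rightarrow> nat \<Rightarrow> real) \<Rightarrow> bool" where
  "euclidean_smooth m V n U f \<longleftrightarrow> f \<in> V \<rightarrow> U \<and> (\<forall>j<n. smooth_fun m V (\<lambda>v. f v j))"


section \<open>Diffeological spaces\<close>

text \<open>
  \<open>plot X n U p\<close> says that \<open>p\<close> restricted to the open set \<open>U \<subseteq> \<real>\<^sup>n\<close> is a plot of \<open>X\<close>.
  As functions are total, the axiom \<open>plot_cong\<close> states that the values outside \<open>U\<close> are irrelevant.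
\<close>

record 'a dspace =
  points :: "'a set"
  plot :: "nat \<Rightarrow> (nat \<Rightarrow> real) set \<Rightarrow> ((nat \<Rightarrow> real) \<Rightarrow> 'a) \<Rightarrow> bool"

locale diffeology =
  fixes X :: "'a dspace"
  assumes plot_domain: "plot X n U p \<Longrightarrow> openin (Euclidean_space n) U"
    and plot_range: "plot X n U p \<Longrightarrow> p \<in> U \<rightarrow> points X"
    and plot_cong: "\<lbrakk>plot X n U p; \<And>u. u \<in> U \<Longrightarrow> p u = q u\<rbrakk> \<Longrightarrow> plot X n U q"
    and plot_const: "\<lbrakk>openin (Euclidean_space n) U; x \<in> points X\<rbrakk> \<Longrightarrow> plot X n U (\<lambda>_. x)"
    and plot_comp: "\<lbrakk>plot X n U p; openin (Euclidean_space m) V; euclidean_smooth m V n U f\<rbrakk>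
                     \<Longrightarrow> plot X m V (p \<circ> f)"
    and plot_local: "\<lbrakk>openin (Euclidean_space n) U; p \<in> U \<rightarrow> points X;
                      \<And>u. u \<in> U \<Longrightarrow> \<exists>V. openin (Euclidean_space n) V \<and> u \<in> V \<and> V \<subseteq> U \<and> plot X n V p\<rbrakk>
                     \<Longrightarrow> plot X n U p"

definition dsmooth :: "'a dspace \<Rightarrow> 'b dspace \<Rightarrow> ('a \<Rightarrow> 'b) \<Rightarrow> bool" where
  "dsmooth X Y f \<longleftrightarrow> f \<in> points X \<rightarrow> points Y \<and> (\<forall>n U p. plot X n U p \<longrightarrow> plot Y n U (f \<circ> p))"

definition euclidean_dspace :: "nat \<Rightarrow> (nat \<Rightarrow> real) set \<Rightarrow> (nat \<Rightarrow> real) dspace" where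
  "euclidean_dspace n U =
     \<lparr>points = U, plot = \<lambda>m V f. openin (Euclidean_space m) V \<and> euclidean_smooth m V n U f\<rparr>"

definition real_dspace :: "real dspace" where
  "real_dspace = \<lparr>points = UNIV, plot = \<lambda>n U f. openin (Euclidean_space n) U \<and> smooth_fun n U f\<rparr>"

definition sub_dspace :: "'a dspace \<Rightarrow> 'a set \<Rightarrow> 'a dspace" where
  "sub_dspace X A = \<lparr>points = points X \<inter> A, plot = \<lambda>n U p. plot X n U p \<and> p \<in> U \<rightarrow> A\<rparr>"

definition prod_dspace :: "'a dspace \<Rightarrow> 'b dspace \<Rightarrow> ('a \<times> 'b) dspace" where
  "prod_dspace X Y =
     \<lparr>points = points X \<times> points Y, plot = \<lambda>n U p. plot X n U (fst \<circ> p) \<and> plot Y n U (snd \<circ> p)\<rparr>"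

definition seq_dspace :: "'a dspace \<Rightarrow> (nat \<Rightarrow> 'a) dspace" where
  "seq_dspace X = \<lparr>points = UNIV \<rightarrow> points X, plot = \<lambda>n U p. \<forall>i. plot X n U (\<lambda>u. p u i)\<rparr>"

definition quotient_dspace :: "'a dspace \<Rightarrow> ('a \<times> 'a) set \<Rightarrow> 'a set dspace" where
  "quotient_dspace X r =
     \<lparr>points = points X // r,
      plot = \<lambda>n U p. openin (Euclidean_space n) U \<and>
        (\<forall>u\<in>U. \<exists>V q. openin (Euclidean_space n) V \<and> u \<in> V \<and> V \<subseteq> U \<and>
                 plot X n V q \<and> (\<forall>v\<in>V. p v = r `` {q v}))\<rparr>"

text \<open>
  The functional diffeology: \<open>P\<close> is a plot if \<open>(u, x) \<mapsto> P u x\<close> is smooth on \<open>U \<times> X\<close>.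
  Elements are normalised to be \<^const>\<open>undefined\<close> outside \<open>points X\<close>; this is vacuous for \<open>X = \<real>\<close>.
\<close>

definition fun_dspace :: "'a dspace \<Rightarrow> 'b dspace \<Rightarrow> ('a \<Rightarrow> 'b) dspace" where
  "fun_dspace X Y =
     \<lparr>points = {f \<in> extensional (points X). dsmooth X Y f},
      plot = \<lambda>n U P. openin (Euclidean_space n) U \<and>
        P \<in> U \<rightarrow> {f \<in> extensional (points X). dsmooth X Y f} \<and>
        dsmooth (prod_dspace (euclidean_dspace n U) X) Y (\<lambda>(u, x). P u x)\<rparr>"

text \<open>Transport of the diffeology along an injective map.\<close>

definition image_dspace :: "('a \<Rightarrow> 'b) \<Rightarrow> 'a dspace \<Rightarrow> 'b dspace" where
  "image_dspace f X =
     \<lparr>points = f ` points X, plot = \<lambda>n U p. \<exists>q. plot X n U q \<and> (\<forall>u\<in>U. p u = f (q u))\<rparr>"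


section \<open>Diffeological groups\<close>

locale diffeological_group = group G + diffeology X
  for G :: "('a, 'b) monoid_scheme" (structure) and X :: "'a dspace" +
  assumes points_eq_carrier: "points X = carrier G"
    and smooth_mult: "dsmooth (prod_dspace X X) X (\<lambda>(a, b). a \<otimes> b)"
    and smooth_inv: "dsmooth X X (\<lambda>a. inv a)"


section \<open>Homotopy groups\<close>

definition path_rel :: "'a dspace \<Rightarrow> ('a \<times> 'a) set" where
  "path_rel X = {(x, y). x \<in> points X \<and> y \<in> points X \<and>
                         (\<exists>\<gamma>. dsmooth real_dspace X \<gamma> \<and> \<gamma> 0 = x \<and> \<gamma> 1 = y)}"

definition pi0 :: "'a dspace \<Rightarrow> 'a set set" where
  "pi0 X = points X // path_rel X"

definition loop_dspace :: "'a dspace \<Rightarrow> 'a \<Rightarrow> (real \<Rightarrow> 'a) dspace" where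
  "loop_dspace X x = sub_dspace (fun_dspace real_dspace X) {\<gamma>. \<gamma> 0 = x \<and> \<gamma> 1 = x}"

text \<open>
  The elements of the \<open>k\<close>-fold iterated loop space would have the \<open>k\<close>-dependent type
  \<open>real \<Rightarrow> \<dots> \<Rightarrow> real \<Rightarrow> 'a\<close>. The following type contains a copy of all of these types:
  \<open>Loop\<close> identifies a path of iterated loops with an iterated loop of the next level.
\<close>

datatype 'a iterated_loop = Point 'a | Loop "real \<Rightarrow> 'a iterated_loop"

primrec const_iterated_loop :: "nat \<Rightarrow> 'a \<Rightarrow> 'a iterated_loop" where
  "const_iterated_loop 0 x = Point x"
| "const_iterated_loop (Suc k) x = Loop (\<lambda>_. const_iterated_loop k x)"

primrec iterated_loop_dspace :: "nat \<Rightarrow> 'a dspace \<Rightarrow> 'a \<Rightarrow> 'a iterated_loop dspace" where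
  "iterated_loop_dspace 0 X x = image_dspace Point X"
| "iterated_loop_dspace (Suc k) X x =
     image_dspace Loop (loop_dspace (iterated_loop_dspace k X x) (const_iterated_loop k x))"

text \<open>
  The concatenation of two smooth loops need not be smooth. As usual in diffeology, loops are first
  made stationary near their ends by precomposing with a smooth function that is \<open>0\<close> on
  \<open>(-\<infinity>, 1/4]\<close> and \<open>1\<close> on \<open>[3/4, \<infinity>)\<close>. The homotopy class of the result does not depend on the
  choice of that function.
\<close>

definition flat_exp :: "real \<Rightarrow> real" where
  "flat_exp s = (if s \<le> 0 then 0 else exp (- 1 / s))"

definition smash :: "real \<Rightarrow> real" where
  "smash t = flat_exp (t - 1/4) / (flat_exp (t - 1/4) + flat_exp (3/4 - t))"

definition loop_concat :: "(real \<Rightarrow> 'a) \<Rightarrow> (real \<Rightarrow> 'a) \<Rightarrow> real \<Rightarrow> 'a" where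
  "loop_concat \<gamma> \<delta> t = (if t \<le> 1/2 then \<gamma> (smash (2 * t)) else \<delta> (smash (2 * t - 1)))"

text \<open>
  The group \<open>\<pi>\<^sub>k(X, x) = \<pi>\<^sub>0(\<Omega>\<^sup>k(X, x))\<close> for \<open>k \<ge> 1\<close>, where all points of \<open>\<Omega>\<^sup>k(X, x)\<close> have the
  form \<open>Loop \<gamma>\<close>; multiplication is concatenation in the outermost loop coordinate. The union over
  all representatives \<open>\<gamma>\<close>, \<open>\<delta>\<close> is a union of equal classes. (For \<open>k = 0\<close> only the carrier is
  meaningful.)
\<close>

definition homotopy_group :: "nat \<Rightarrow> 'a dspace \<Rightarrow> 'a \<Rightarrow> 'a iterated_loop set monoid" where
  "homotopy_group k X x =
     \<lparr>carrier = pi0 (iterated_loop_dspace k X x),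
      mult = \<lambda>A B. \<Union>{path_rel (iterated_loop_dspace k X x) `` {Loop (loop_concat \<gamma> \<delta>)} |
                        \<gamma> \<delta>. Loop \<gamma> \<in> A \<and> Loop \<delta> \<in> B},
      one = path_rel (iterated_loop_dspace k X x) `` {const_iterated_loop k x}\<rparr>"

text \<open>
  The group structure on \<open>\<pi>\<^sub>0(G)\<close> induced from \<open>G\<close>. For uniformity of types, \<open>\<pi>\<^sub>0(G)\<close> is
  \<open>\<pi>\<^sub>0(\<Omega>\<^sup>0 G)\<close>, where \<open>\<Omega>\<^sup>0 G\<close> is the copy of \<open>G\<close> under \<open>Point\<close>.
\<close>

definition pi0_group :: "('a, 'b) monoid_scheme \<Rightarrow> 'a dspace \<Rightarrow> 'a iterated_loop set monoid" where
  "pi0_group G X =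
     \<lparr>carrier = pi0 (image_dspace Point X),
      mult = \<lambda>A B. \<Union>{path_rel (image_dspace Point X) `` {Point (a \<otimes>\<^bsub>G\<^esub> b)} |
                        a b. Point a \<in> A \<and> Point b \<in> B},
      one = path_rel (image_dspace Point X) `` {Point \<one>\<^bsub>G\<^esub>}\<rparr>"

definition homotopy_group_of_dgroup ::
  "nat \<Rightarrow> ('a, 'b) monoid_scheme \<Rightarrow> 'a dspace \<Rightarrow> 'a iterated_loop set monoid" where
  "homotopy_group_of_dgroup k G X =
     (if k = 0 then pi0_group G X else homotopy_group k X \<one>\<^bsub>G\<^esub>)"


section \<open>The Milnor construction\<close>

type_synonym 'a milnor_seq = "(nat \<Rightarrow> real) \<times> (nat \<Rightarrow> 'a)"

definition milnor_S :: "'a dspace \<Rightarrow> 'a milnor_seq dspace" where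
  "milnor_S X =
     sub_dspace (prod_dspace (seq_dspace (sub_dspace real_dspace {0..1})) (seq_dspace X))
       {(t, g). finite {i. t i \<noteq> 0} \<and> (\<Sum>i | t i \<noteq> 0. t i) = 1}"

definition milnor_rel :: "'a dspace \<Rightarrow> ('a milnor_seq \<times> 'a milnor_seq) set" where
  "milnor_rel X = {((t, g), (t', g')).
     (t, g) \<in> points (milnor_S X) \<and> (t', g') \<in> points (milnor_S X) \<and>
     (\<forall>i. t i = t' i) \<and> (\<forall>i. t i \<noteq> 0 \<longrightarrow> g i = g' i)}"

definition milnor_E :: "'a dspace \<Rightarrow> 'a milnor_seq set dspace" where
  "milnor_E X = quotient_dspace (milnor_S X) (milnor_rel X)"

definition milnor_action ::
  "('a, 'b) monoid_scheme \<Rightarrow> 'a dspace \<Rightarrow> 'a \<Rightarrow> 'a milnor_seq set \<Rightarrow> 'a milnor_seq set" where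
  "milnor_action G X h c =
     milnor_rel X `` ((\<lambda>(t, g). (t, \<lambda>i. g i \<otimes>\<^bsub>G\<^esub> inv\<^bsub>G\<^esub> h)) ` c)"

definition orbit_rel ::
  "('a, 'b) monoid_scheme \<Rightarrow> 'a dspace \<Rightarrow> ('a milnor_seq set \<times> 'a milnor_seq set) set" where
  "orbit_rel G X = {(c, d). c \<in> points (milnor_E X) \<and> d \<in> points (milnor_E X) \<and>
                            (\<exists>h\<in>carrier G. d = milnor_action G X h c)}"

definition milnor_B :: "('a, 'b) monoid_scheme \<Rightarrow> 'a dspace \<Rightarrow> 'a milnor_seq set set dspace" where
  "milnor_B G X = quotient_dspace (milnor_E X) (orbit_rel G X)"

end

theory Submission
  imports Defs
begin

text \<open>
  A \<open>k\<close>-fold iterated loop is a smooth map on \<open>\<real>\<^sup>k\<close> that is constant on the faces of the unit cube,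
  and the path relation on iterated loops is homotopy of such maps. The isomorphism is the
  connecting map of \<open>EG \<rightarrow> BG\<close>: a cube in \<open>BG\<close> lifts to a cube in \<open>EG\<close> that is constant on all
  faces but one, and on the last face the lift moves the base point by a cube in \<open>G\<close>.
  Lifts exist locally and are glued along faces of small cubes. Injectivity does not use a contraction
  of \<open>EG\<close>, because the usual shift of infinitely many join coordinates need not be smooth for the
  quotient diffeology. Instead, over a compact cube finitely many weights already have a positive sum, so a lift
  can be deformed, without changing its group components, to one that misses some vertex
  of the infinite join, and is then coned off there.
\<close>

subsection \<open>Smooth functions\<close>

text \<open>Two properties of EG \<rightarrow> BG carry the argument. A plot of BG lifts locally to
  S_G because BG is an iterated quotient of S_G. Two lifts of one plot differ by a map to the group,
  and this map is smooth: near a point where the weight with index i is positive it is a quotient of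
  the two i-th group components. The weights of a plot of S_G are smooth one by one, so infinitely
  many of them may be somewhere nonzero in every neighbourhood of a point. Compactness therefore
  yields only a positive partial sum, and the other weights have to be scaled away. A group
  component is under control only where its weight does not vanish, so maps to EG are handled up to
  the relation \<open>same\<close>. Smooth gluing needs collars. The function \<open>smash\<close>
  of the loop concatenation supplies them, with thresholds 1/4 and 3/4: applied to every coordinate
  of a cube, it keeps the homotopy class, makes the cube constant on collars of the faces, and turns
  a lift over a neighbourhood of the unit cube into one over the whole space. The cutoff
  \<open>bump\<close> is tuned to the same thresholds.\<close>

lemma Euclidean_space_top_of_set: "Euclidean_space n = top_of_set {x. \<forall>i\<ge>n. x i = 0}"
  by (simp add: Euclidean_space_def euclidean_product_topology)

lemma openin_Euclidean_space_box:
  "openin (Euclidean_space n) {v \<in> topspace (Euclidean_space n). \<forall>i<n. \<bar>v i - u i\<bar> < e i}"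
proof -
  have "open (\<Inter>i\<in>{..<n}. {v::nat\<Rightarrow>real. \<bar>v i - u i\<bar> < e i})"
  proof (rule open_INT)
    show "\<forall>i\<in>{..<n}. open {v::nat\<Rightarrow>real. \<bar>v i - u i\<bar> < e i}"
      by (intro ballI open_Collect_less continuous_on_rabs continuous_on_diff continuous_on_const
          continuous_on_product_coordinates)
  qed simp
  moreover have "{v \<in> topspace (Euclidean_space n). \<forall>i<n. \<bar>v i - u i\<bar> < e i} =
     topspace (Euclidean_space n) \<inter> (\<Inter>i\<in>{..<n}. {v. \<bar>v i - u i\<bar> < e i})" by auto
  ultimately show ?thesis
    by (auto simp: Euclidean_space_top_of_set openin_open)
qed

text \<open>All coordinates from \<open>n\<close> on vanish, so a basic neighbourhood of the product
  topology restricts only finitely many free coordinates, and one radius serves them all.\<close>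

lemma openin_Euclidean_space_iff:
  "openin (Euclidean_space n) U \<longleftrightarrow> U \<subseteq> topspace (Euclidean_space n) \<and>
    (\<forall>u\<in>U. \<exists>e>0. \<forall>v\<in>topspace (Euclidean_space n). (\<forall>i<n. \<bar>v i - u i\<bar> < e) \<longrightarrow> v \<in> U)"
  (is "?L \<longleftrightarrow> ?R")
proof
  assume L: ?L
  then obtain T where T: "openin (powertop_real UNIV) T" "U = T \<inter> {x. \<forall>i\<ge>n. x i = 0}"
    by (auto simp: Euclidean_space_def openin_subtopology)
  have "\<exists>e>0. \<forall>v\<in>topspace (Euclidean_space n). (\<forall>i<n. \<bar>v i - u i\<bar> < e) \<longrightarrow> v \<in> U" if u: "u \<in> U" for u
  proof -
    obtain W where W: "\<And>i. open (W i)" "u \<in> Pi\<^sub>E UNIV W" "Pi\<^sub>E UNIV W \<subseteq> T"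
    proof -
      have "u \<in> T" using u T(2) by auto
      then show thesis using T(1) that unfolding openin_product_topology_alt
        by (metis UNIV_I open_openin topspace_euclidean)
    qed
    have "\<exists>e>0. \<forall>r. \<bar>r - u i\<bar> < e \<longrightarrow> r \<in> W i" for i
    proof -
      have "u i \<in> W i" using W(2) by auto
      with W(1)[of i] obtain e where "e > 0" "\<forall>y. dist y (u i) < e \<longrightarrow> y \<in> W i" by (meson open_dist)
      then show ?thesis by (auto simp: dist_real_def)
    qed
    then obtain e where e: "\<And>i. e i > 0" "\<And>i r. \<bar>r - u i\<bar> < e i \<Longrightarrow> r \<in> W i" by metis
    \<comment> \<open>The extra element 1 keeps the minimum defined when
      \<open>n = 0\<close>.\<close>
    define d where "d = Min (insert 1 (e ` {..<n}))"
    have d: "d > 0" "\<And>i. i < n \<Longrightarrow> d \<le> e i" using e by (auto simp: d_def)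
    have "v \<in> U" if v: "v \<in> topspace (Euclidean_space n)" "\<forall>i<n. \<bar>v i - u i\<bar> < d" for v
    proof -
      have "v i \<in> W i" for i
      proof (cases "i < n")
        case True then show ?thesis using v d(2)[of i] e(2)[of "v i" i] by force
      next
        case False
        then have "v i = u i" using v u T(2) by (auto simp: topspace_Euclidean_space)
        then show ?thesis using W(2) by auto
      qed
      then have "v \<in> T" using W(3) by auto
      then show ?thesis using v T(2) by (simp add: topspace_Euclidean_space)
    qed
    then show ?thesis using d(1) by blast
  qed
  then show ?R using L openin_subset by blast
next
  assume R: ?R
  show ?L
  proof (subst openin_subopen, intro ballI)
    fix u assume u: "u \<in> U"
    then obtain e where e: "e > 0" "\<And>v. v\<in>topspace (Euclidean_space n) \<Longrightarrow> (\<forall>i<n. \<bar>v i - u i\<bar> < e) \<Longrightarrow> v \<in> U"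
      using R by blast
    show "\<exists>T. openin (Euclidean_space n) T \<and> u \<in> T \<and> T \<subseteq> U"
    proof (intro exI conjI)
      show "openin (Euclidean_space n) {v \<in> topspace (Euclidean_space n). \<forall>i<n. \<bar>v i - u i\<bar> < e}"
        by (rule openin_Euclidean_space_box)
    qed (use e u R in auto)
  qed
qed

lemma openin_Euclidean_spaceD:
  assumes "openin (Euclidean_space n) U" "u \<in> U"
  obtains e where "e > 0" "\<And>v. v \<in> topspace (Euclidean_space n) \<Longrightarrow> (\<And>i. i < n \<Longrightarrow> \<bar>v i - u i\<bar> < e) \<Longrightarrow> v \<in> U"
  using assms openin_Euclidean_space_iff by meson

lemma openin_Euclidean_space_Int_coordinate:
  assumes "openin (Euclidean_space n) U" "open S"
  shows "openin (Euclidean_space n) {u \<in> U. u i \<in> S}"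
proof (unfold openin_Euclidean_space_iff, intro conjI ballI)
  show "{u \<in> U. u i \<in> S} \<subseteq> topspace (Euclidean_space n)" using openin_subset[OF assms(1)] by blast
  fix u assume u: "u \<in> {u \<in> U. u i \<in> S}"
  obtain d where d: "d > 0" "\<And>v. v \<in> topspace (Euclidean_space n) \<Longrightarrow> (\<And>i. i < n \<Longrightarrow> \<bar>v i - u i\<bar> < d) \<Longrightarrow> v \<in> U"
    using openin_Euclidean_spaceD[OF assms(1)] u by (metis (mono_tags) mem_Collect_eq)
  obtain e where e: "e > 0" "\<And>y. dist y (u i) < e \<Longrightarrow> y \<in> S"
    using u assms(2) unfolding open_dist by blast
  show "\<exists>e>0. \<forall>v\<in>topspace (Euclidean_space n). (\<forall>i<n. \<bar>v i - u i\<bar> < e) \<longrightarrow> v \<in> {u \<in> U. u i \<in> S}"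
  proof (intro exI conjI ballI impI)
    show "min d e > 0" using d e by simp
    fix v assume v: "v \<in> topspace (Euclidean_space n)" "\<forall>i<n. \<bar>v i - u i\<bar> < min d e"
    have "v i = u i" if "i \<ge> n"
      using v(1) u openin_subset[OF assms(1)] that by (auto simp: topspace_Euclidean_space)
    then have "v i \<in> S" using v(2) e by (cases "i < n") (auto simp: dist_real_def)
    then show "v \<in> {u \<in> U. u i \<in> S}" using d v by auto
  qed
qed

lemma Ck_on_continuous:
  assumes "U \<subseteq> topspace (Euclidean_space n)"
  shows "continuous_map (subtopology (Euclidean_space n) U) euclideanreal f \<longleftrightarrow> continuous_on U f"
proof -
  have "subtopology (Euclidean_space n) U = top_of_set U"
    using assms by (simp add: Euclidean_space_top_of_set subtopology_subtopology topspace_Euclidean_space inf_absorb2)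
  then show ?thesis by simp
qed

text \<open>The right-hand side also puts the whole small box into \<open>U\<close>; the mean value
  argument for curves needs both facts at once.\<close>

lemma continuous_on_box_eps:
  fixes f :: "(nat \<Rightarrow> real) \<Rightarrow> real"
  assumes U: "openin (Euclidean_space n) U"
  shows "continuous_on U f \<longleftrightarrow>
    (\<forall>u\<in>U. \<forall>e>0. \<exists>d>0. \<forall>v\<in>topspace (Euclidean_space n). (\<forall>i<n. \<bar>v i - u i\<bar> < d) \<longrightarrow> v \<in> U \<and> \<bar>f v - f u\<bar> < e)"
  (is "?L \<longleftrightarrow> ?R")
proof
  assume L: ?L
  show ?R
  proof (intro ballI allI impI)
    fix u and e :: real assume u: "u \<in> U" and e: "e > 0"
    have "openin (top_of_set U) (U \<inter> f -` ball (f u) e)"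
      using L by (simp add: continuous_openin_preimage_gen)
    moreover have "subtopology (Euclidean_space n) U = top_of_set U"
      using openin_subset[OF U] by (simp add: Euclidean_space_top_of_set subtopology_subtopology topspace_Euclidean_space inf_absorb2)
    ultimately have "openin (Euclidean_space n) (U \<inter> f -` ball (f u) e)"
      using U openin_open_subtopology by metis
    then obtain d where "d>0" "\<And>v. v\<in>topspace (Euclidean_space n) \<Longrightarrow> (\<And>i. i < n \<Longrightarrow> \<bar>v i - u i\<bar> < d) \<Longrightarrow> v \<in> U \<inter> f -` ball (f u) e"
      using u e by (auto elim!: openin_Euclidean_spaceD[where u=u])
    then show "\<exists>d>0. \<forall>v\<in>topspace (Euclidean_space n). (\<forall>i<n. \<bar>v i - u i\<bar> < d) \<longrightarrow> v \<in> U \<and> \<bar>f v - f u\<bar> < e"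
      by (auto simp: dist_real_def abs_minus_commute)
  qed
next
  assume R: ?R
  have "openin (top_of_set U) (U \<inter> f -` T)" if T: "open T" for T
  proof -
    have "openin (Euclidean_space n) (U \<inter> f -` T)"
      unfolding openin_Euclidean_space_iff
    proof (intro conjI ballI)
      show "U \<inter> f -` T \<subseteq> topspace (Euclidean_space n)" using openin_subset[OF U] by auto
      fix u assume u: "u \<in> U \<inter> f -` T"
      then obtain e where e: "e > 0" "\<And>y. \<bar>y - f u\<bar> < e \<Longrightarrow> y \<in> T"
        using T by (auto simp: open_dist dist_real_def)
      with R u obtain d where "d > 0" "\<forall>v\<in>topspace (Euclidean_space n). (\<forall>i<n. \<bar>v i - u i\<bar> < d) \<longrightarrow> v \<in> U \<and> \<bar>f v - f u\<bar> < e"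
        by blast
      then show "\<exists>d>0. \<forall>v\<in>topspace (Euclidean_space n). (\<forall>i<n. \<bar>v i - u i\<bar> < d) \<longrightarrow> v \<in> U \<inter> f -` T"
        using e by auto
    qed
    moreover have "subtopology (Euclidean_space n) U = top_of_set U"
      using openin_subset[OF U] by (simp add: Euclidean_space_top_of_set subtopology_subtopology topspace_Euclidean_space inf_absorb2)
    ultimately show ?thesis using U openin_open_subtopology by (metis inf_le1)
  qed
  then have "\<exists>A. open A \<and> A \<inter> U = f -` T \<inter> U" if "open T" for T
    using that unfolding openin_open by (metis Int_commute)
  then show ?L unfolding continuous_on_open_invariant by blast
qed

section \<open>The chain rule from continuous partial derivatives\<close>

lemma mvt_segment:
  fixes f :: "real \<Rightarrow> real"
  assumes "a \<noteq> b" "\<And>x. min a b \<le> x \<Longrightarrow> x \<le> max a b \<Longrightarrow> (f has_field_derivative f' x) (at x)"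
  obtains z where "min a b \<le> z" "z \<le> max a b" "f b - f a = (b - a) * f' z"
proof (cases "a < b")
  case True
  then obtain z where "a < z" "z < b" "f b - f a = (b - a) * f' z" using MVT2[of a b f f'] assms by auto
  then show ?thesis using that[of z] by auto
next
  case False
  then have "b < a" using assms by auto
  then obtain z where "b < z" "z < a" "f a - f b = (a - b) * f' z" using MVT2[of b a f f'] assms by auto
  then show ?thesis using that[of z] by (auto simp: algebra_simps)
qed

text \<open>The increment of \<open>f\<close> along \<open>c\<close> is telescoped over intermediate
  points that change one coordinate at a time. The mean value theorem turns each summand into a
  partial derivative at a nearby point, which converges because the partial derivatives are
  continuous.\<close>

lemma has_field_derivative_curve:
  fixes f :: "(nat \<Rightarrow> real) \<Rightarrow> real" and c :: "real \<Rightarrow> nat \<Rightarrow> real"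
  assumes U: "openin (Euclidean_space n) U"
    and df: "\<And>j x. j < n \<Longrightarrow> x \<in> U \<Longrightarrow> ((\<lambda>s. f (x(j := s))) has_field_derivative f' j x) (at (x j))"
    and cont: "\<And>j. j < n \<Longrightarrow> continuous_on U (f' j)"
    and c0: "c s0 \<in> U" and cz: "\<And>s i. i \<ge> n \<Longrightarrow> c s i = 0"
    and dc: "\<And>j. j < n \<Longrightarrow> ((\<lambda>s. c s j) has_field_derivative c' j) (at s0)"
  shows "((\<lambda>s. f (c s)) has_field_derivative (\<Sum>j<n. f' j (c s0) * c' j)) (at s0)"
proof -
  define y where "y = c s0"
  \<comment> \<open>The first \<open>j\<close> coordinates have their new values, the others still
    their old ones: \<open>p 0 s\<close> is \<open>c s0\<close> and \<open>p n s\<close> is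
    \<open>c s\<close>.\<close>
  define p where "p j s = (\<lambda>i. if i < j then c s i else y i)" for j s
  have pz: "p j s i = 0" if "i \<ge> n" for i j s using cz that by (auto simp: p_def y_def)
  have step: "((\<lambda>s. f (p (Suc j) s) - f (p j s)) has_field_derivative f' j y * c' j) (at s0)" if j: "j < n" for j
  proof -
    define D where "D s = f (p (Suc j) s) - f (p j s)" for s
    \<comment> \<open>The difference quotient in coordinate \<open>j\<close>. The value chosen for a
      vanishing denominator makes \<open>D s = q s * (c s j - y j)\<close> hold in all cases and
      does not disturb the limit of \<open>q\<close>.\<close>
    define q where "q s = (if c s j = y j then f' j y else D s / (c s j - y j))" for s
    have Dq: "D s = q s * (c s j - y j)" for s
    proof (cases "c s j = y j")
      case True
      then have "p (Suc j) s = p j s" by (auto simp: p_def fun_eq_iff less_Suc_eq)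
      then show ?thesis using True by (simp add: D_def)
    qed (auto simp: q_def)
    have "(q \<longlongrightarrow> f' j y) (at s0)"
    proof (rule tendstoI)
      fix e :: real assume e: "e > 0"
      obtain d where d: "d > 0" "\<And>v. v\<in>topspace (Euclidean_space n) \<Longrightarrow> (\<And>i. i < n \<Longrightarrow> \<bar>v i - y i\<bar> < d) \<Longrightarrow> v \<in> U \<and> \<bar>f' j v - f' j y\<bar> < e"
        using cont[OF j] c0 e unfolding continuous_on_box_eps[OF U] y_def by metis
      have "\<forall>\<^sub>F s in at s0. \<forall>i\<in>{..<n}. \<bar>c s i - y i\<bar> < d"
      proof (rule eventually_ball_finite)
        show "\<forall>i\<in>{..<n}. \<forall>\<^sub>F s in at s0. \<bar>c s i - y i\<bar> < d"
        proof
          fix i assume "i \<in> {..<n}"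
          then have "isCont (\<lambda>s. c s i) s0" using dc DERIV_isCont by blast
          then have "((\<lambda>s. c s i) \<longlongrightarrow> y i) (at s0)" by (simp add: isCont_def y_def)
          then show "\<forall>\<^sub>F s in at s0. \<bar>c s i - y i\<bar> < d" using d(1) by (auto dest!: tendstoD simp: dist_real_def)
        qed
      qed simp
      then show "\<forall>\<^sub>F s in at s0. dist (q s) (f' j y) < e"
      proof (rule eventually_mono)
        fix s assume s: "\<forall>i\<in>{..<n}. \<bar>c s i - y i\<bar> < d"
        show "dist (q s) (f' j y) < e"
        proof (cases "c s j = y j")
          case True then show ?thesis using e by (simp add: q_def)
        next
          case False
          have inU: "(p j s)(j := t) \<in> U \<and> \<bar>f' j ((p j s)(j := t)) - f' j y\<bar> < e"
            if "min (y j) (c s j) \<le> t" "t \<le> max (y j) (c s j)" for t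
          proof (rule d(2))
            show "(p j s)(j := t) \<in> topspace (Euclidean_space n)"
              using pz j by (auto simp: topspace_Euclidean_space)
            fix i assume i: "i < n"
            have "\<bar>t - y j\<bar> < d" using that s j by (cases "c s j \<le> y j") force+
            then show "\<bar>((p j s)(j := t)) i - y i\<bar> < d" using s i d(1) by (auto simp: p_def)
          qed
          have "((\<lambda>t. f ((p j s)(j := t))) has_field_derivative f' j ((p j s)(j := t))) (at t)"
            if "min (y j) (c s j) \<le> t" "t \<le> max (y j) (c s j)" for t
            using df[OF j, of "(p j s)(j := t)"] inU[OF that] by simp
          with False obtain z where z: "min (y j) (c s j) \<le> z" "z \<le> max (y j) (c s j)"
            "f ((p j s)(j := c s j)) - f ((p j s)(j := y j)) = (c s j - y j) * f' j ((p j s)(j := z))"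
            using mvt_segment[of "y j" "c s j" "\<lambda>t. f ((p j s)(j := t))" "\<lambda>t. f' j ((p j s)(j := t))"] by metis
          moreover have "(p j s)(j := c s j) = p (Suc j) s" "(p j s)(j := y j) = p j s"
            by (auto simp: p_def fun_eq_iff less_Suc_eq)
          ultimately have "q s = f' j ((p j s)(j := z))" using False by (simp add: q_def D_def)
          then show ?thesis using inU[OF z(1,2)] by (simp add: dist_real_def)
        qed
      qed
    qed
    moreover have "((\<lambda>s. (c s j - y j) / (s - s0)) \<longlongrightarrow> c' j) (at s0)"
      using dc[OF j] by (simp add: has_field_derivative_iff y_def)
    ultimately have "((\<lambda>s. q s * ((c s j - y j) / (s - s0))) \<longlongrightarrow> f' j y * c' j) (at s0)"
      by (rule tendsto_mult)
    moreover have "D s0 = 0" by (simp add: Dq y_def)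
    ultimately have "(D has_field_derivative f' j y * c' j) (at s0)"
      unfolding has_field_derivative_iff by (simp only: diff_zero Dq times_divide_eq_right)
    then show ?thesis by (simp add: D_def[abs_def])
  qed
  have "j \<le> n \<Longrightarrow> ((\<lambda>s. f (p j s)) has_field_derivative (\<Sum>i<j. f' i y * c' i)) (at s0)" for j
  proof (induction j)
    case 0
    have "p 0 s = y" for s by (simp add: p_def)
    then show ?case by simp
  next
    case (Suc j)
    from DERIV_add[OF Suc.IH step[of j]] Suc.prems show ?case by (simp add: algebra_simps)
  qed
  from this[of n] have "((\<lambda>s. f (p n s)) has_field_derivative (\<Sum>i<n. f' i y * c' i)) (at s0)" by simp
  moreover have "p n s = c s" for s using cz by (auto simp: p_def y_def fun_eq_iff)
  ultimately show ?thesis by (simp add: y_def)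
qed

abbreviation Rn :: "nat \<Rightarrow> (nat \<Rightarrow> real) set" where
  "Rn n \<equiv> topspace (Euclidean_space n)"

lemma Rn_iff: "x \<in> Rn n \<longleftrightarrow> (\<forall>i\<ge>n. x i = 0)"
  by (simp add: topspace_Euclidean_space)

lemma eventually_fun_upd_openin:
  assumes "openin (Euclidean_space n) U" "x \<in> U" "i < n"
  shows "\<forall>\<^sub>F s in nhds (x i). x(i := s) \<in> U"
proof -
  obtain d where d: "d > 0" "\<And>v. v \<in> Rn n \<Longrightarrow> (\<And>i. i < n \<Longrightarrow> \<bar>v i - x i\<bar> < d) \<Longrightarrow> v \<in> U"
    using openin_Euclidean_spaceD[OF assms(1,2)] by metis
  have "x \<in> Rn n" using assms openin_subset by blast
  show ?thesis unfolding eventually_nhds_metric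
    by (intro exI[of _ d] conjI d allI impI) (use d(1) \<open>x \<in> Rn n\<close> assms(3) in \<open>auto simp: dist_real_def Rn_iff\<close>)
qed

section \<open>Calculus of functions of class C^k on an open set\<close>

context
  fixes n :: nat and U :: "(nat \<Rightarrow> real) set"
  assumes U: "openin (Euclidean_space n) U"
begin

lemma Ck_on_0_iff: "Ck_on 0 n U f \<longleftrightarrow> continuous_on U f"
  using Ck_on_continuous openin_subset[OF U] by simp

lemma Ck_on_imp_continuous: "Ck_on k n U f \<Longrightarrow> continuous_on U f"
  using Ck_on_continuous openin_subset[OF U] by (cases k) auto

lemma Ck_on_Suc_derivative:
  assumes "Ck_on (Suc k) n U f" "i < n" "x \<in> U"
  shows "((\<lambda>s. f (x(i := s))) has_field_derivative partial_deriv i f x) (at (x i))"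
  using assms unfolding Ck_on.simps partial_deriv_def
  by (metis DERIV_deriv_iff_field_differentiable)

text \<open>A partial derivative at \<open>x\<close> only sees the points \<open>x(i := s)\<close>
  with \<open>s\<close> near \<open>x i\<close>, and these lie in the open set
  \<open>U\<close>.\<close>

lemma Ck_on_cong_imp:
  assumes "Ck_on k n U f" "\<And>x. x \<in> U \<Longrightarrow> f x = g x"
  shows "Ck_on k n U g"
  using assms
proof (induction k arbitrary: f g)
  case 0
  then show ?case by (simp only: Ck_on_0_iff) (metis continuous_on_cong)
next
  case (Suc k)
  have "continuous_on U g" using Ck_on_imp_continuous[OF Suc.prems(1)] Suc.prems(2) by (metis continuous_on_cong)
  moreover have g: "((\<lambda>s. g (x(i := s))) has_field_derivative partial_deriv i f x) (at (x i))"
    if "i < n" "x \<in> U" for i x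
  proof -
    have "\<forall>\<^sub>F s in nhds (x i). f (x(i := s)) = g (x(i := s))"
      using eventually_fun_upd_openin[OF U that(2,1)] by (rule eventually_mono) (rule Suc.prems(2))
    from DERIV_cong_ev[OF refl this refl] show ?thesis
      using Ck_on_Suc_derivative[OF Suc.prems(1) that] by blast
  qed
  moreover have "Ck_on k n U (partial_deriv i g)" if "i < n" for i
  proof (rule Suc.IH[of "partial_deriv i f"])
    show "Ck_on k n U (partial_deriv i f)" using Suc.prems that by simp
    show "partial_deriv i f x = partial_deriv i g x" if "x \<in> U" for x
      using DERIV_imp_deriv[OF g[OF \<open>i < n\<close> that]] by (simp add: partial_deriv_def)
  qed
  ultimately show ?case
    using Ck_on_continuous openin_subset[OF U] by (auto simp: field_differentiable_def)
qed

lemma Ck_on_SucI: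
  assumes "continuous_on U f"
    and d: "\<And>i x. i < n \<Longrightarrow> x \<in> U \<Longrightarrow> ((\<lambda>s. f (x(i := s))) has_field_derivative f' i x) (at (x i))"
    and "\<And>i. i < n \<Longrightarrow> Ck_on k n U (f' i)"
  shows "Ck_on (Suc k) n U f"
proof -
  have "Ck_on k n U (partial_deriv i f)" if "i < n" for i
    by (rule Ck_on_cong_imp[OF assms(3)[OF that]])
       (metis d that partial_deriv_def DERIV_imp_deriv)
  then show ?thesis
    using assms Ck_on_continuous openin_subset[OF U] by (auto simp: field_differentiable_def)
qed

lemma Ck_on_Suc_mono: "Ck_on (Suc k) n U f \<Longrightarrow> Ck_on k n U f"
proof (induction k arbitrary: f)
  case 0 then show ?case by simp
next
  case (Suc k)
  show ?case
    by (rule Ck_on_SucI[where f'="\<lambda>i. partial_deriv i f"])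
       (use Suc Ck_on_imp_continuous Ck_on_Suc_derivative in \<open>blast, blast, auto\<close>)
qed

lemma Ck_on_const: "Ck_on k n U (\<lambda>x. a)"
  by (induction k arbitrary: a)
     (use Ck_on_0_iff in \<open>auto intro!: Ck_on_SucI[where f'="\<lambda>_ _. 0"] simp del: Ck_on.simps\<close>)

lemma continuous_on_coordinate: "continuous_on A (\<lambda>x::nat \<Rightarrow> real. x j)"
  by (rule continuous_on_subset[OF continuous_on_product_coordinates subset_UNIV])

lemma Ck_on_coordinate: "Ck_on k n U (\<lambda>x. x j)"
proof (cases k)
  case 0 then show ?thesis by (simp only: Ck_on_0_iff continuous_on_coordinate)
next
  case (Suc m)
  show ?thesis unfolding Suc
    by (rule Ck_on_SucI[where f'="\<lambda>i x. if i = j then 1 else 0"])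
       (auto intro: continuous_on_coordinate Ck_on_const)
qed

lemma Ck_on_add: "Ck_on k n U f \<Longrightarrow> Ck_on k n U g \<Longrightarrow> Ck_on k n U (\<lambda>x. f x + g x)"
proof (induction k arbitrary: f g)
  case 0
  then show ?case by (simp only: Ck_on_0_iff continuous_on_add)
next
  case (Suc k)
  show ?case
  proof (rule Ck_on_SucI[where f'="\<lambda>i x. partial_deriv i f x + partial_deriv i g x"])
    show "continuous_on U (\<lambda>x. f x + g x)" using Suc.prems Ck_on_imp_continuous by (intro continuous_on_add) blast+
  next
    fix i x assume "i < n" "x \<in> U"
    then show "((\<lambda>s. f (x(i := s)) + g (x(i := s))) has_field_derivative partial_deriv i f x + partial_deriv i g x) (at (x i))"
      using Suc.prems by (intro DERIV_add Ck_on_Suc_derivative)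
  qed (use Suc in auto)
qed

lemma Ck_on_mult: "Ck_on k n U f \<Longrightarrow> Ck_on k n U g \<Longrightarrow> Ck_on k n U (\<lambda>x. f x * g x)"
proof (induction k arbitrary: f g)
  case 0
  then show ?case by (simp only: Ck_on_0_iff continuous_on_mult)
next
  case (Suc k)
  show ?case
  proof (rule Ck_on_SucI[where f'="\<lambda>i x. partial_deriv i f x * g x + partial_deriv i g x * f x"])
    show "continuous_on U (\<lambda>x. f x * g x)" using Suc.prems Ck_on_imp_continuous by (intro continuous_on_mult) blast+
  next
    fix i x assume ix: "i < n" "x \<in> U"
    show "((\<lambda>s. f (x(i := s)) * g (x(i := s))) has_field_derivative partial_deriv i f x * g x + partial_deriv i g x * f x) (at (x i))"
      using DERIV_mult[OF Ck_on_Suc_derivative[OF Suc.prems(1) ix] Ck_on_Suc_derivative[OF Suc.prems(2) ix]]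
      unfolding fun_upd_triv .
  next
    fix i assume "i < n"
    with Suc show "Ck_on k n U (\<lambda>x. partial_deriv i f x * g x + partial_deriv i g x * f x)"
      by (intro Ck_on_add Suc.IH) (use Suc.prems Ck_on_Suc_mono in auto)
  qed
qed

lemma Ck_on_sum: "finite A \<Longrightarrow> (\<And>a. a \<in> A \<Longrightarrow> Ck_on k n U (f a)) \<Longrightarrow> Ck_on k n U (\<lambda>x. \<Sum>a\<in>A. f a x)"
  by (induction A rule: finite_induct) (auto simp: Ck_on_const Ck_on_add simp del: Ck_on.simps)

text \<open>\<open>D\<close> is a whole sequence of successive derivatives. Treating all
  \<open>m\<close> at once closes the induction, since differentiating \<open>D m (f x)\<close>
  produces \<open>D (Suc m) (f x)\<close>.\<close>

lemma Ck_on_comp_real: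
  fixes D :: "nat \<Rightarrow> real \<Rightarrow> real"
  assumes D: "\<And>m y. y \<in> S \<Longrightarrow> (D m has_field_derivative D (Suc m) y) (at y)"
    and fS: "\<And>x. x \<in> U \<Longrightarrow> f x \<in> S"
  shows "Ck_on k n U f \<Longrightarrow> Ck_on k n U (\<lambda>x. D m (f x))"
proof (induction k arbitrary: m)
  have c: "continuous_on U (\<lambda>x. D m (f x))" if "continuous_on U f" for m
  proof -
    have "continuous_on S (D m)"
      by (intro continuous_at_imp_continuous_on ballI) (rule DERIV_isCont[OF D])
    then show ?thesis by (rule continuous_on_compose2[OF _ that]) (use fS in auto)
  qed
  {
    case 0
    then show ?case by (simp only: Ck_on_0_iff c)
  next
    case (Suc k)
    show ?case
    proof (rule Ck_on_SucI[where f'="\<lambda>i x. D (Suc m) (f x) * partial_deriv i f x"])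
      show "continuous_on U (\<lambda>x. D m (f x))" using c Suc.prems Ck_on_imp_continuous by blast
    next
      fix i x assume ix: "i < n" "x \<in> U"
      show "((\<lambda>s. D m (f (x(i := s)))) has_field_derivative D (Suc m) (f x) * partial_deriv i f x) (at (x i))"
        by (rule DERIV_chain2[OF _ Ck_on_Suc_derivative[OF Suc.prems(1) ix]]) (use D fS ix in simp)
    next
      fix i assume "i < n"
      with Suc show "Ck_on k n U (\<lambda>x. D (Suc m) (f x) * partial_deriv i f x)"
        by (intro Ck_on_mult Suc.IH) (use Suc.prems Ck_on_Suc_mono in auto)
    qed
  }
qed

lemma Ck_on_subset:
  assumes "openin (Euclidean_space n) W" "W \<subseteq> U"
  shows "Ck_on k n U f \<Longrightarrow> Ck_on k n W f"
  using assms
proof (induction k arbitrary: f)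
  case 0
  then show ?case by (metis Ck_on_0_iff Ck_on_continuous Ck_on.simps(1) continuous_on_subset openin_subset)
next
  case (Suc k)
  then show ?case
    using Ck_on_imp_continuous[OF Suc.prems(1)] Ck_on_continuous[OF openin_subset[OF assms(1)]]
    by (auto intro: continuous_on_subset)
qed

lemma Ck_on_local:
  assumes "\<And>u. u \<in> U \<Longrightarrow> \<exists>V. openin (Euclidean_space n) V \<and> u \<in> V \<and> Ck_on k n V f"
  shows "Ck_on k n U f"
proof -
  have base: "continuous_on U f" if 0: "\<And>u. u \<in> U \<Longrightarrow> \<exists>V. openin (Euclidean_space n) V \<and> u \<in> V \<and> Ck_on 0 n V f" for f
    unfolding continuous_on_box_eps[OF U]
  proof (intro ballI allI impI)
    fix u and e :: real assume "u \<in> U" "e > 0"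
    with 0 obtain V where V: "openin (Euclidean_space n) V" "u \<in> V" "Ck_on 0 n V f" by blast
    then have "continuous_on V f" using Ck_on_continuous[OF openin_subset[OF V(1)]] by simp
    then obtain d where d: "d>0" "\<forall>v\<in>Rn n. (\<forall>i<n. \<bar>v i - u i\<bar> < d) \<longrightarrow> v \<in> V \<and> \<bar>f v - f u\<bar> < e"
      using continuous_on_box_eps[OF V(1)] V(2) \<open>e > 0\<close> by blast
    obtain d' where d': "d' > 0" "\<And>v. v \<in> Rn n \<Longrightarrow> (\<And>i. i < n \<Longrightarrow> \<bar>v i - u i\<bar> < d') \<Longrightarrow> v \<in> U"
      using openin_Euclidean_spaceD[OF U \<open>u \<in> U\<close>] by metis
    show "\<exists>d>0. \<forall>v\<in>Rn n. (\<forall>i<n. \<bar>v i - u i\<bar> < d) \<longrightarrow> v \<in> U \<and> \<bar>f v - f u\<bar> < e"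
      by (intro exI[of _ "min d d'"]) (use d d' in auto)
  qed
  show ?thesis using assms
  proof (induction k arbitrary: f)
    case 0
    then show ?case by (simp only: Ck_on_0_iff base)
  next
    case (Suc k)
    have "continuous_on U f"
    proof -
      have "Ck_on 0 n V f" if "Ck_on (Suc k) n V f" for V using that by simp
      then show ?thesis using Suc.prems base by metis
    qed
    moreover have "(\<lambda>s. f (x(i := s))) field_differentiable at (x i)" if "i < n" "x \<in> U" for i x
      using Suc.prems[OF that(2)] that by auto
    moreover have "Ck_on k n U (partial_deriv i f)" if "i < n" for i
      using Suc.prems that by (intro Suc.IH) force
    ultimately show ?case using Ck_on_continuous openin_subset[OF U] by auto
  qed
qed

end

text \<open>The induction runs over all outer functions at once: by the chain rule the derivatives
  are sums of products in which \<open>partial_deriv j f\<close> is again composed with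
  \<open>g\<close>.\<close>

lemma Ck_on_compose:
  assumes V: "openin (Euclidean_space m) V" and U: "openin (Euclidean_space n) U"
    and gVU: "\<And>v. v \<in> V \<Longrightarrow> g v \<in> U"
  shows "(\<And>j. j < n \<Longrightarrow> Ck_on k m V (\<lambda>v. g v j)) \<Longrightarrow> Ck_on k n U f \<Longrightarrow> Ck_on k m V (\<lambda>v. f (g v))"
proof (induction k arbitrary: f)
  have c: "continuous_on V (\<lambda>v. f (g v))"
    if "\<And>j. j < n \<Longrightarrow> continuous_on V (\<lambda>v. g v j)" "continuous_on U f" for f
  proof -
    have "continuous_on V (\<lambda>v. g v j)" for j
    proof (cases "j < n")
      case False
      then have "g v j = 0" if "v \<in> V" for v
        using gVU[OF that] openin_subset[OF U] by (auto simp: Rn_iff)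
      then show ?thesis using continuous_on_cong[of V V "\<lambda>v. g v j" "\<lambda>_. 0"] by simp
    qed (use that in blast)
    then have "continuous_on V g" by (rule continuous_on_coordinatewise_then_product)
    with that(2) show ?thesis by (rule continuous_on_compose2) (use gVU in auto)
  qed
  {
    case 0
    then show ?case using c Ck_on_0_iff[OF V] Ck_on_0_iff[OF U] by blast
  next
    case (Suc k)
    show ?case
    proof (rule Ck_on_SucI[OF V, where f'="\<lambda>i v. \<Sum>j<n. partial_deriv j f (g v) * partial_deriv i (\<lambda>v. g v j) v"])
      show "continuous_on V (\<lambda>v. f (g v))"
        using c Suc.prems Ck_on_imp_continuous[OF V] Ck_on_imp_continuous[OF U] by blast
    next
      fix i v assume i: "i < m" and v: "v \<in> V"
      \<comment> \<open>Off \<open>V\<close> nothing is known about \<open>g\<close>. Cutting off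
        the coordinates from \<open>n\<close> on gives a curve in R^n for every parameter, which
        equals \<open>g (v(i := s))\<close> as long as \<open>v(i := s)\<close> stays in
        \<open>V\<close>.\<close>
      define c where "c s = (\<lambda>j. if j < n then g (v(i := s)) j else 0)" for s
      have c_eq: "c s = g (v(i := s))" if "v(i := s) \<in> V" for s
        using gVU[OF that] openin_subset[OF U] by (auto simp: c_def Rn_iff fun_eq_iff)
      have c0: "c (v i) = g v" using c_eq[of "v i"] v by simp
      have "((\<lambda>s. f (c s)) has_field_derivative (\<Sum>j<n. partial_deriv j f (c (v i)) * partial_deriv i (\<lambda>v. g v j) v)) (at (v i))"
      proof (rule has_field_derivative_curve[OF U])
        fix j x assume "j < n" "x \<in> U"
        then show "((\<lambda>s. f (x(j := s))) has_field_derivative partial_deriv j f x) (at (x j))"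
          by (rule Ck_on_Suc_derivative[OF U Suc.prems(2)])
      next
        fix j assume j: "j < n"
        show "continuous_on U (partial_deriv j f)"
          using Suc.prems(2) j Ck_on_imp_continuous[OF U] by auto
        have "((\<lambda>s. g (v(i := s)) j) has_field_derivative partial_deriv i (\<lambda>v. g v j) v) (at (v i))"
          by (rule Ck_on_Suc_derivative[OF V Suc.prems(1)[OF j] i v])
        then show "((\<lambda>s. c s j) has_field_derivative partial_deriv i (\<lambda>v. g v j) v) (at (v i))"
          using j by (simp add: c_def)
      next
        show "c (v i) \<in> U" using c0 gVU v by simp
      next
        fix s j assume "n \<le> j"
        then show "c s j = 0" by (simp add: c_def)
      qed
      moreover have "\<forall>\<^sub>F s in nhds (v i). f (c s) = f (g (v(i := s)))"
        using eventually_fun_upd_openin[OF V v i] by (rule eventually_mono) (simp add: c_eq)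
      ultimately show "((\<lambda>s. f (g (v(i := s)))) has_field_derivative (\<Sum>j<n. partial_deriv j f (g v) * partial_deriv i (\<lambda>v. g v j) v)) (at (v i))"
        using DERIV_cong_ev[OF refl _ refl, of "\<lambda>s. f (c s)" "\<lambda>s. f (g (v(i := s)))" "v i"] c0 by simp
    next
      fix i assume i: "i < m"
      show "Ck_on k m V (\<lambda>v. \<Sum>j<n. partial_deriv j f (g v) * partial_deriv i (\<lambda>v. g v j) v)"
      proof (rule Ck_on_sum[OF V])
        fix j assume j: "j \<in> {..<n}"
        have "Ck_on k m V (\<lambda>v. g v j')" if "j' < n" for j'
          using Suc.prems(1) Ck_on_Suc_mono[OF V] that by blast
        moreover have "Ck_on k n U (partial_deriv j f)" using Suc.prems(2) j by simp
        ultimately have "Ck_on k m V (\<lambda>v. partial_deriv j f (g v))" by (rule Suc.IH)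
        moreover have "Ck_on k m V (partial_deriv i (\<lambda>v. g v j))" using Suc.prems(1)[of j] i j by simp
        ultimately show "Ck_on k m V (\<lambda>v. partial_deriv j f (g v) * partial_deriv i (\<lambda>v. g v j) v)"
          by (rule Ck_on_mult[OF V])
      qed simp
    qed
  }
qed

lemma smooth_fun_cong:
  assumes "openin (Euclidean_space n) U" "\<And>x. x \<in> U \<Longrightarrow> f x = g x"
  shows "smooth_fun n U f \<longleftrightarrow> smooth_fun n U g"
  unfolding smooth_fun_def
  using Ck_on_cong_imp[OF assms(1), where f=f and g=g] Ck_on_cong_imp[OF assms(1), where f=g and g=f] assms(2) by auto

lemma smooth_fun_const: "openin (Euclidean_space n) U \<Longrightarrow> smooth_fun n U (\<lambda>x. a)"
  by (simp add: smooth_fun_def Ck_on_const)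

lemma smooth_fun_coordinate: "openin (Euclidean_space n) U \<Longrightarrow> smooth_fun n U (\<lambda>x. x j)"
  by (simp add: smooth_fun_def Ck_on_coordinate)

lemma smooth_fun_add:
  "openin (Euclidean_space n) U \<Longrightarrow> smooth_fun n U f \<Longrightarrow> smooth_fun n U g \<Longrightarrow> smooth_fun n U (\<lambda>x. f x + g x)"
  by (simp add: smooth_fun_def Ck_on_add)

lemma smooth_fun_mult:
  "openin (Euclidean_space n) U \<Longrightarrow> smooth_fun n U f \<Longrightarrow> smooth_fun n U g \<Longrightarrow> smooth_fun n U (\<lambda>x. f x * g x)"
  by (simp add: smooth_fun_def Ck_on_mult)

lemma smooth_fun_diff:
  assumes "openin (Euclidean_space n) U" "smooth_fun n U f" "smooth_fun n U g"
  shows "smooth_fun n U (\<lambda>x. f x - g x)"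
  using smooth_fun_add[OF assms(1,2) smooth_fun_mult[OF assms(1) smooth_fun_const[OF assms(1), of "-1"] assms(3)]] by simp

lemma smooth_fun_power:
  "openin (Euclidean_space n) U \<Longrightarrow> smooth_fun n U f \<Longrightarrow> smooth_fun n U (\<lambda>x. f x ^ k)"
  by (induction k) (auto intro: smooth_fun_const smooth_fun_mult)

lemma smooth_fun_sum:
  "openin (Euclidean_space n) U \<Longrightarrow> (\<And>a. a \<in> A \<Longrightarrow> smooth_fun n U (f a)) \<Longrightarrow> smooth_fun n U (\<lambda>x. \<Sum>a\<in>A. f a x)"
  by (induction A rule: infinite_finite_induct) (auto intro: smooth_fun_const smooth_fun_add)

lemma smooth_fun_prod:
  "openin (Euclidean_space n) U \<Longrightarrow> (\<And>a. a \<in> A \<Longrightarrow> smooth_fun n U (f a)) \<Longrightarrow> smooth_fun n U (\<lambda>x. \<Prod>a\<in>A. f a x)"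
  by (induction A rule: infinite_finite_induct) (auto intro: smooth_fun_const smooth_fun_mult)

lemma smooth_fun_subset:
  "openin (Euclidean_space n) U \<Longrightarrow> openin (Euclidean_space n) W \<Longrightarrow> W \<subseteq> U \<Longrightarrow> smooth_fun n U f \<Longrightarrow> smooth_fun n W f"
  using Ck_on_subset unfolding smooth_fun_def by blast

lemma smooth_fun_local:
  assumes "openin (Euclidean_space n) U"
    and "\<And>u. u \<in> U \<Longrightarrow> \<exists>V. openin (Euclidean_space n) V \<and> u \<in> V \<and> smooth_fun n V f"
  shows "smooth_fun n U f"
  unfolding smooth_fun_def
  by (intro allI Ck_on_local[OF assms(1)]) (use assms(2) in \<open>auto simp: smooth_fun_def\<close>)

lemma smooth_fun_compose:
  assumes "openin (Euclidean_space m) V" "openin (Euclidean_space n) U"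
    and "\<And>v. v \<in> V \<Longrightarrow> g v \<in> U" "\<And>j. j < n \<Longrightarrow> smooth_fun m V (\<lambda>v. g v j)" "smooth_fun n U f"
  shows "smooth_fun m V (\<lambda>v. f (g v))"
  using assms Ck_on_compose[OF assms(1,2), of g] unfolding smooth_fun_def by blast

lemma smooth_fun_comp_real:
  assumes "openin (Euclidean_space n) U"
    and "\<And>m y. y \<in> S \<Longrightarrow> (D m has_field_derivative D (Suc m) y) (at y)"
    and "\<And>x. x \<in> U \<Longrightarrow> f x \<in> S" "smooth_fun n U f"
  shows "smooth_fun n U (\<lambda>x. D m (f x))"
  using assms Ck_on_comp_real[OF assms(1), of S D f] unfolding smooth_fun_def by blast

lemma smooth_fun_divide:
  assumes U: "openin (Euclidean_space n) U" "smooth_fun n U f" "smooth_fun n U g" "\<And>x. x \<in> U \<Longrightarrow> g x \<noteq> 0"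
  shows "smooth_fun n U (\<lambda>x. f x / g x)"
proof -
  \<comment> \<open>The \<open>m\<close>-th derivative of \<open>1 / y\<close>.\<close>
  define D where "D m y = (-1) ^ m * fact m / y ^ Suc m" for m and y :: real
  have "(D m has_field_derivative D (Suc m) y) (at y)" if "y \<noteq> 0" for m y
  proof -
    have "((\<lambda>y. (-1) ^ m * fact m / y ^ Suc m) has_field_derivative
       ((- 1) ^ m * fact m * - (real (Suc m) * y ^ m)) / (y ^ Suc m * y ^ Suc m)) (at y)"
      using DERIV_divide[OF DERIV_const[of "(- 1) ^ m * fact m"] DERIV_pow[of "Suc m" y]] that by simp
    also have "((- 1) ^ m * fact m * - (real (Suc m) * y ^ m)) / (y ^ Suc m * y ^ Suc m) = D (Suc m) y"
      using that by (simp add: D_def field_simps)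
    finally show ?thesis by (simp add: D_def[abs_def])
  qed
  then have "smooth_fun n U (\<lambda>x. D 0 (g x))"
    using assms by (intro smooth_fun_comp_real[of n U "-{0}" D g 0]) auto
  then have "smooth_fun n U (\<lambda>x. f x * (1 / g x))"
    using assms by (intro smooth_fun_mult) (simp_all add: D_def)
  then show ?thesis by simp
qed

section \<open>The flat exponential and the smooth step \<open>smash\<close>\<close>

lemma tendsto_poly_div_exp: "((\<lambda>y::real. poly p y / exp y) \<longlongrightarrow> 0) at_top"
proof -
  have "((\<lambda>y::real. \<Sum>i\<le>degree p. coeff p i * (y ^ i / exp y)) \<longlongrightarrow> (\<Sum>i\<le>degree p. coeff p i * 0)) at_top"
    by (intro tendsto_intros tendsto_power_div_exp_0)
  then show ?thesis by (simp add: poly_altdef sum_divide_distrib)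
qed

text \<open>For positive \<open>s\<close> the \<open>m\<close>-th derivative of
  \<open>exp (- 1 / s)\<close> is P(X) \<open>exp (- 1 / s)\<close> with X = 1/s and P this
  polynomial. Differentiating once more replaces P by X^2 (P - P').\<close>

primrec flat_exp_poly :: "nat \<Rightarrow> real poly" where
  "flat_exp_poly 0 = 1"
| "flat_exp_poly (Suc m) = monom 1 2 * (flat_exp_poly m - pderiv (flat_exp_poly m))"

definition flat_exp_deriv :: "nat \<Rightarrow> real \<Rightarrow> real" where
  "flat_exp_deriv m s = (if s \<le> 0 then 0 else poly (flat_exp_poly m) (1 / s) / exp (1 / s))"

lemma flat_exp_deriv_0: "flat_exp_deriv 0 = flat_exp"
  by (auto simp: flat_exp_deriv_def flat_exp_def fun_eq_iff exp_minus inverse_eq_divide)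

text \<open>Only \<open>s = 0\<close> is delicate. Substituting y = 1/h in the difference quotient
  from the right leaves a polynomial in y divided by \<open>exp y\<close>, which tends to 0.\<close>

lemma DERIV_flat_exp_deriv: "(flat_exp_deriv m has_field_derivative flat_exp_deriv (Suc m) s) (at s)"
proof -
  let ?p = "flat_exp_poly m"
  consider "s < 0" | "s = 0" | "s > 0" by linarith
  then show ?thesis
  proof cases
    case 1
    have "\<forall>\<^sub>F y in nhds s. (\<lambda>_. 0) y = flat_exp_deriv m y"
      using eventually_nhds_in_open[of "{..<0}" s] 1
      by (auto elim!: eventually_mono simp: flat_exp_deriv_def)
    then have "(flat_exp_deriv m has_field_derivative 0) (at s)"
      by (rule DERIV_cong_ev[OF refl _ refl, THEN iffD1, OF _ DERIV_const])
    then show ?thesis using 1 by (simp add: flat_exp_deriv_def[of "Suc m"])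
  next
    case 3
    have "\<forall>\<^sub>F y in nhds s. poly ?p (1 / y) * exp (- (1 / y)) = flat_exp_deriv m y"
      using eventually_nhds_in_open[of "{0<..}" s] 3
      by (auto elim!: eventually_mono simp: flat_exp_deriv_def exp_minus field_simps)
    note cong = DERIV_cong_ev[OF refl this refl]
    have d: "((\<lambda>y. 1 / y) has_field_derivative - (1 / s\<^sup>2)) (at s)"
      using 3 by (auto intro!: derivative_eq_intros simp: power2_eq_square)
    have "((\<lambda>y. poly ?p (1 / y) * exp (- (1 / y))) has_field_derivative
        (poly (pderiv ?p) (1 / s) * - (1 / s\<^sup>2)) * exp (- (1 / s)) + (exp (- (1 / s)) * - (- (1 / s\<^sup>2))) * poly ?p (1 / s)) (at s)"
      by (intro DERIV_mult DERIV_chain2[OF poly_DERIV d] DERIV_chain2[OF DERIV_exp] DERIV_minus d)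
    moreover have "(poly (pderiv ?p) (1 / s) * - (1 / s\<^sup>2)) * exp (- (1 / s)) + (exp (- (1 / s)) * - (- (1 / s\<^sup>2))) * poly ?p (1 / s)
        = flat_exp_deriv (Suc m) s"
      using 3 by (simp add: flat_exp_deriv_def poly_monom exp_minus field_simps power2_eq_square)
    ultimately show ?thesis using cong by simp
  next
    case 2
    have l: "((\<lambda>h. flat_exp_deriv m h / h) \<longlongrightarrow> 0) (at_left 0)"
    proof -
      have "\<forall>\<^sub>F h in at_left 0. 0 = flat_exp_deriv m h / h"
        by (auto simp: eventually_at_filter flat_exp_deriv_def)
      then show ?thesis by (rule tendsto_cong[THEN iffD1]) simp
    qed
    have "((\<lambda>h. poly (monom 1 1 * ?p) (inverse h) / exp (inverse h)) \<longlongrightarrow> 0) (at_right 0)"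
      by (rule filterlim_compose[OF tendsto_poly_div_exp filterlim_inverse_at_top_right])
    moreover have "\<forall>\<^sub>F h in at_right 0. poly (monom 1 1 * ?p) (inverse h) / exp (inverse h) = flat_exp_deriv m h / h"
      by (auto simp: eventually_at_filter flat_exp_deriv_def poly_monom field_simps)
    ultimately have r: "((\<lambda>h. flat_exp_deriv m h / h) \<longlongrightarrow> 0) (at_right 0)"
      using tendsto_cong by force
    from l r have "((\<lambda>h. flat_exp_deriv m h / h) \<longlongrightarrow> 0) (at 0)"
      by (simp add: filterlim_split_at)
    then show ?thesis unfolding 2 by (simp add: has_field_derivative_iff flat_exp_deriv_def)
  qed
qed

lemma smooth_fun_flat_exp:
  "openin (Euclidean_space n) U \<Longrightarrow> smooth_fun n U f \<Longrightarrow> smooth_fun n U (\<lambda>x. flat_exp (f x))"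
  using smooth_fun_comp_real[of n U UNIV flat_exp_deriv f 0] DERIV_flat_exp_deriv by (simp add: flat_exp_deriv_0)

lemma flat_exp_nonneg: "flat_exp s \<ge> 0" and flat_exp_pos_iff: "flat_exp s > 0 \<longleftrightarrow> s > 0"
  and flat_exp_eq_0: "s \<le> 0 \<Longrightarrow> flat_exp s = 0"
  by (auto simp: flat_exp_def)

lemma smash_denominator_pos: "flat_exp (t - 1/4) + flat_exp (3/4 - t) > 0"
proof (cases "t > 1/4")
  case True
  then show ?thesis using flat_exp_pos_iff[of "t - 1/4"] flat_exp_nonneg[of "3/4 - t"] by linarith
next
  case False
  then show ?thesis using flat_exp_pos_iff[of "3/4 - t"] flat_exp_nonneg[of "t - 1/4"] by linarith
qed

lemma smooth_fun_smash:
  assumes U: "openin (Euclidean_space n) U" "smooth_fun n U f"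
  shows "smooth_fun n U (\<lambda>x. smash (f x))"
  unfolding smash_def
proof (rule smooth_fun_divide[OF U(1)])
  have 1: "smooth_fun n U (\<lambda>x. flat_exp (f x - 1/4))" "smooth_fun n U (\<lambda>x. flat_exp (3/4 - f x))"
    using U by (auto intro!: smooth_fun_flat_exp smooth_fun_diff smooth_fun_const)
  then show "smooth_fun n U (\<lambda>x. flat_exp (f x - 1/4))"
    "smooth_fun n U (\<lambda>x. flat_exp (f x - 1/4) + flat_exp (3/4 - f x))"
    using U(1) by (auto intro: smooth_fun_add)
  show "flat_exp (f x - 1/4) + flat_exp (3/4 - f x) \<noteq> 0" for x
    using smash_denominator_pos[of "f x"] by simp
qed

lemma smash_eq_0: "t \<le> 1/4 \<Longrightarrow> smash t = 0" and smash_eq_1: "t \<ge> 3/4 \<Longrightarrow> smash t = 1"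
  using smash_denominator_pos[of t] by (auto simp: smash_def flat_exp_eq_0)

lemma smash_nonneg: "smash t \<ge> 0" and smash_le_1: "smash t \<le> 1"
  using smash_denominator_pos[of t] flat_exp_nonneg[of "t - 1/4"] flat_exp_nonneg[of "3/4 - t"]
  by (auto simp: smash_def)

lemma smash_simps [simp]: "smash 0 = 0" "smash 1 = 1"
  by (auto simp: smash_eq_0 smash_eq_1)

lemma openin_Rn: "openin (Euclidean_space n) (Rn n)"
  by simp

lemma Rn_upd: "x \<in> Rn n \<Longrightarrow> i < n \<Longrightarrow> x(i := s) \<in> Rn n"
  by (auto simp: Rn_iff)

lemma smooth_fun_preimage_open:
  assumes "openin (Euclidean_space n) U" "smooth_fun n U f" "open S"
  shows "openin (Euclidean_space n) {u \<in> U. f u \<in> S}"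
proof -
  have "Ck_on 0 n U f" using assms(2) by (simp add: smooth_fun_def)
  then have "openin (subtopology (Euclidean_space n) U) {u \<in> topspace (subtopology (Euclidean_space n) U). f u \<in> S}"
    unfolding Ck_on.simps by (rule openin_continuous_map_preimage) (use assms in simp)
  moreover have "topspace (subtopology (Euclidean_space n) U) = U"
    using openin_subset[OF assms(1)] by auto
  ultimately show ?thesis using openin_open_subtopology[OF assms(1)] by metis
qed

lemma openin_smooth_preimage:
  assumes V: "openin (Euclidean_space m) V" and W: "openin (Euclidean_space n) W"
    and f: "\<And>v. v \<in> V \<Longrightarrow> f v \<in> Rn n" "\<And>j. j < n \<Longrightarrow> smooth_fun m V (\<lambda>v. f v j)"
  shows "openin (Euclidean_space m) {v \<in> V. f v \<in> W}"
proof (subst openin_subopen, intro ballI)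
  fix v assume v: "v \<in> {v \<in> V. f v \<in> W}"
  then obtain e where e: "e > 0" "\<And>w. w \<in> Rn n \<Longrightarrow> (\<And>i. i < n \<Longrightarrow> \<bar>w i - f v i\<bar> < e) \<Longrightarrow> w \<in> W"
    using openin_Euclidean_spaceD[OF W, of "f v"] by auto
  \<comment> \<open>The last factor \<open>V\<close> takes care of \<open>n = 0\<close>, where the
    intersection over the empty family is everything.\<close>
  define N where "N = (\<Inter>j\<in>{..<n}. {u \<in> V. f u j \<in> ball (f v j) e}) \<inter> V"
  have "openin (Euclidean_space m) N"
  proof (cases "n = 0")
    case True then show ?thesis using V by (simp add: N_def)
  next
    case False
    then have "openin (Euclidean_space m) (\<Inter>j\<in>{..<n}. {u \<in> V. f u j \<in> ball (f v j) e})"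
      by (intro openin_INT2 smooth_fun_preimage_open[OF V f(2)]) auto
    then show ?thesis using V by (simp add: N_def openin_Int)
  qed
  moreover have "N \<subseteq> {v \<in> V. f v \<in> W}"
    using e(2) f(1) by (auto simp: N_def dist_real_def abs_minus_commute)
  ultimately show "\<exists>T. openin (Euclidean_space m) T \<and> v \<in> T \<and> T \<subseteq> {v \<in> V. f v \<in> W}"
    using v e(1) by (intro exI[of _ N]) (auto simp: N_def)
qed

subsection \<open>Constructions of diffeologies\<close>

context diffeology begin

lemma plot_subst:
  assumes "plot X n U p" "openin (Euclidean_space m) V" "\<And>v. v \<in> V \<Longrightarrow> f v \<in> U"
    "\<And>j. j < n \<Longrightarrow> smooth_fun m V (\<lambda>v. f v j)"
  shows "plot X m V (\<lambda>v. p (f v))"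
  using plot_comp[OF assms(1,2), of f] assms(3,4) by (auto simp: euclidean_smooth_def o_def)

lemma plot_restrict: "plot X n U p \<Longrightarrow> openin (Euclidean_space n) V \<Longrightarrow> V \<subseteq> U \<Longrightarrow> plot X n V p"
  using plot_subst[of n U p n V "\<lambda>v. v"] by (auto intro: smooth_fun_coordinate)

lemma plot_point: "plot X n U p \<Longrightarrow> u \<in> U \<Longrightarrow> p u \<in> points X"
  using plot_range by blast

text \<open>Made for piecewise definitions: the local model \<open>q\<close> may change from point
  to point and has to agree with \<open>p\<close> only inside \<open>U\<close>.\<close>

lemma plot_localI:
  assumes "openin (Euclidean_space n) U"
    and "\<And>u. u \<in> U \<Longrightarrow> \<exists>V q. openin (Euclidean_space n) V \<and> u \<in> V \<and> plot X n V q \<and> (\<forall>v\<in>V\<inter>U. p v = q v)"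
  shows "plot X n U p"
proof (rule plot_local[OF assms(1)])
  show "p \<in> U \<rightarrow> points X"
    using assms(2) plot_point by (metis IntI Pi_I)
  fix u assume "u \<in> U"
  then obtain V q where V: "openin (Euclidean_space n) V" "u \<in> V" "plot X n V q" "\<forall>v\<in>V\<inter>U. p v = q v"
    using assms(2) by blast
  have "plot X n (V \<inter> U) q" using V(1,3) assms(1) by (intro plot_restrict[OF V(3)]) auto
  then have "plot X n (V \<inter> U) p" using V(4) by (metis plot_cong)
  then show "\<exists>V. openin (Euclidean_space n) V \<and> u \<in> V \<and> V \<subseteq> U \<and> plot X n V p"
    using V(1,2) \<open>u \<in> U\<close> assms(1) by (intro exI[of _ "V \<inter> U"]) auto
qed

end

lemma diffeology_real: "diffeology real_dspace"
proof
  fix n U p m V f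
  assume "plot real_dspace n U p" "openin (Euclidean_space m) V" "euclidean_smooth m V n U f"
  then show "plot real_dspace m V (p \<circ> f)"
    using smooth_fun_compose[of m V n U f p] by (auto simp: real_dspace_def euclidean_smooth_def o_def)
next
  fix n U and p q :: "(nat \<Rightarrow> real) \<Rightarrow> real"
  assume "plot real_dspace n U p" "\<And>u. u \<in> U \<Longrightarrow> p u = q u"
  then show "plot real_dspace n U q" using smooth_fun_cong[of n U p q] by (simp add: real_dspace_def)
next
  fix n U and p :: "(nat \<Rightarrow> real) \<Rightarrow> real"
  assume "openin (Euclidean_space n) U"
    "\<And>u. u \<in> U \<Longrightarrow> \<exists>V. openin (Euclidean_space n) V \<and> u \<in> V \<and> V \<subseteq> U \<and> plot real_dspace n V p"
  then show "plot real_dspace n U p" using smooth_fun_local[of n U p] by (fastforce simp: real_dspace_def)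
qed (auto simp: real_dspace_def smooth_fun_const)

lemma diffeology_sub:
  assumes "diffeology X" shows "diffeology (sub_dspace X A)"
proof -
  interpret diffeology X by fact
  show ?thesis
  proof
    fix n U and p q :: "(nat \<Rightarrow> real) \<Rightarrow> 'a"
    assume "plot (sub_dspace X A) n U p" "\<And>u. u \<in> U \<Longrightarrow> p u = q u"
    then show "plot (sub_dspace X A) n U q" using plot_cong[of n U p q] by (simp add: sub_dspace_def Pi_iff)
  next
    fix n U p m V f
    assume "plot (sub_dspace X A) n U p" "openin (Euclidean_space m) V" "euclidean_smooth m V n U f"
    then show "plot (sub_dspace X A) m V (p \<circ> f)"
      using plot_comp[of n U p m V f] by (auto simp: sub_dspace_def euclidean_smooth_def)
  next
    fix n U and p :: "(nat \<Rightarrow> real) \<Rightarrow> 'a"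
    assume a: "openin (Euclidean_space n) U" "p \<in> U \<rightarrow> points (sub_dspace X A)"
      "\<And>u. u \<in> U \<Longrightarrow> \<exists>V. openin (Euclidean_space n) V \<and> u \<in> V \<and> V \<subseteq> U \<and> plot (sub_dspace X A) n V p"
    have "plot X n U p" by (rule plot_local) (use a in \<open>auto simp: sub_dspace_def\<close>, meson)
    then show "plot (sub_dspace X A) n U p" using a(2) by (auto simp: sub_dspace_def)
  qed (use plot_domain plot_point plot_const in \<open>auto simp: sub_dspace_def\<close>)
qed

lemma diffeology_prod:
  assumes "diffeology X" "diffeology Y" shows "diffeology (prod_dspace X Y)"
proof -
  interpret X: diffeology X by fact
  interpret Y: diffeology Y by fact
  show ?thesis
  proof
    fix n U and p :: "(nat \<Rightarrow> real) \<Rightarrow> 'a \<times> 'b"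
    assume "plot (prod_dspace X Y) n U p"
    then show "p \<in> U \<rightarrow> points (prod_dspace X Y)"
      using X.plot_range[of n U "fst \<circ> p"] Y.plot_range[of n U "snd \<circ> p"]
      by (auto simp: prod_dspace_def Pi_iff mem_Times_iff)
  next
    fix n U and p q :: "(nat \<Rightarrow> real) \<Rightarrow> 'a \<times> 'b"
    assume "plot (prod_dspace X Y) n U p" "\<And>u. u \<in> U \<Longrightarrow> p u = q u"
    then show "plot (prod_dspace X Y) n U q"
      using X.plot_cong[of n U "fst \<circ> p" "fst \<circ> q"] Y.plot_cong[of n U "snd \<circ> p" "snd \<circ> q"]
      by (simp add: prod_dspace_def)
  next
    fix n U and p :: "(nat \<Rightarrow> real) \<Rightarrow> 'a \<times> 'b" and m V f
    assume "plot (prod_dspace X Y) n U p" "openin (Euclidean_space m) V" "euclidean_smooth m V n U f"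
    then show "plot (prod_dspace X Y) m V (p \<circ> f)"
      using X.plot_comp[of n U "fst \<circ> p"] Y.plot_comp[of n U "snd \<circ> p"]
      by (simp add: prod_dspace_def o_assoc)
  next
    fix n U and p :: "(nat \<Rightarrow> real) \<Rightarrow> 'a \<times> 'b"
    assume a: "openin (Euclidean_space n) U" "p \<in> U \<rightarrow> points (prod_dspace X Y)"
      "\<And>u. u \<in> U \<Longrightarrow> \<exists>V. openin (Euclidean_space n) V \<and> u \<in> V \<and> V \<subseteq> U \<and> plot (prod_dspace X Y) n V p"
    have "plot X n U (fst \<circ> p)"
      by (rule X.plot_local[OF a(1)]) (use a(2,3) in \<open>auto simp: prod_dspace_def Pi_iff mem_Times_iff\<close>, meson)
    moreover have "plot Y n U (snd \<circ> p)"
      by (rule Y.plot_local[OF a(1)]) (use a(2,3) in \<open>auto simp: prod_dspace_def Pi_iff mem_Times_iff\<close>, meson)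
    ultimately show "plot (prod_dspace X Y) n U p" by (simp add: prod_dspace_def)
  qed (use X.plot_domain X.plot_const Y.plot_const in \<open>auto simp: prod_dspace_def o_def\<close>)
qed

lemma diffeology_seq:
  assumes "diffeology X" shows "diffeology (seq_dspace X)"
proof -
  interpret diffeology X by fact
  show ?thesis
  proof
    fix n U and p :: "(nat \<Rightarrow> real) \<Rightarrow> nat \<Rightarrow> 'a"
    assume "plot (seq_dspace X) n U p"
    then show "p \<in> U \<rightarrow> points (seq_dspace X)" using plot_point by (fastforce simp: seq_dspace_def)
  next
    fix n U and p q :: "(nat \<Rightarrow> real) \<Rightarrow> nat \<Rightarrow> 'a"
    assume "plot (seq_dspace X) n U p" "\<And>u. u \<in> U \<Longrightarrow> p u = q u"
    then show "plot (seq_dspace X) n U q"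
      using plot_cong[of n U "\<lambda>u. p u _" "\<lambda>u. q u _"] by (simp add: seq_dspace_def)
  next
    fix n U and p :: "(nat \<Rightarrow> real) \<Rightarrow> nat \<Rightarrow> 'a" and m V f
    assume "plot (seq_dspace X) n U p" "openin (Euclidean_space m) V" "euclidean_smooth m V n U f"
    then show "plot (seq_dspace X) m V (p \<circ> f)"
      using plot_comp[of n U "\<lambda>u. p u _" m V f] by (simp add: seq_dspace_def o_def)
  next
    fix n U and p :: "(nat \<Rightarrow> real) \<Rightarrow> nat \<Rightarrow> 'a"
    assume a: "openin (Euclidean_space n) U" "p \<in> U \<rightarrow> points (seq_dspace X)"
      "\<And>u. u \<in> U \<Longrightarrow> \<exists>V. openin (Euclidean_space n) V \<and> u \<in> V \<and> V \<subseteq> U \<and> plot (seq_dspace X) n V p"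
    have "plot X n U (\<lambda>u. p u i)" for i
      by (rule plot_local[OF a(1)]) (use a(2,3) in \<open>auto simp: seq_dspace_def Pi_iff\<close>, meson)
    then show "plot (seq_dspace X) n U p" by (simp add: seq_dspace_def)
  qed (use plot_domain plot_const in \<open>auto simp: seq_dspace_def Pi_iff\<close>)
qed

lemma quotient_plotD:
  assumes "plot (quotient_dspace X r) n U p" "u \<in> U"
  obtains V q where "openin (Euclidean_space n) V" "u \<in> V" "V \<subseteq> U" "plot X n V q" "\<And>v. v \<in> V \<Longrightarrow> p v = r `` {q v}"
proof -
  have "\<forall>u\<in>U. \<exists>V q. openin (Euclidean_space n) V \<and> u \<in> V \<and> V \<subseteq> U \<and> plot X n V q \<and> (\<forall>v\<in>V. p v = r `` {q v})"
    using assms(1) by (simp add: quotient_dspace_def)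
  from bspec[OF this assms(2)] show thesis using that by metis
qed

text \<open>The axiom with content is closure under composition: a local lift is pulled back to the
  preimage of its domain, which is open because smooth maps are continuous.\<close>

lemma diffeology_quotient:
  assumes "diffeology X" shows "diffeology (quotient_dspace X r)"
proof -
  interpret diffeology X by fact
  show ?thesis
  proof
    fix n U p assume p: "plot (quotient_dspace X r) n U p"
    then show "openin (Euclidean_space n) U" by (simp add: quotient_dspace_def)
    show "p \<in> U \<rightarrow> points (quotient_dspace X r)"
    proof
      fix u assume "u \<in> U"
      then obtain V q where "u \<in> V" "plot X n V q" "\<And>v. v \<in> V \<Longrightarrow> p v = r `` {q v}"
        using quotient_plotD[OF p] by metis
      then show "p u \<in> points (quotient_dspace X r)"
        using plot_point by (auto simp: quotient_dspace_def intro: quotientI)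
    qed
  next
    fix n U p q assume p: "plot (quotient_dspace X r) n U p" and q: "\<And>u. u \<in> U \<Longrightarrow> p u = q u"
    have "\<exists>V h. openin (Euclidean_space n) V \<and> u \<in> V \<and> V \<subseteq> U \<and> plot X n V h \<and> (\<forall>v\<in>V. q v = r `` {h v})"
      if u: "u \<in> U" for u
    proof -
      obtain V h where "openin (Euclidean_space n) V" "u \<in> V" "V \<subseteq> U" "plot X n V h" "\<And>v. v \<in> V \<Longrightarrow> p v = r `` {h v}"
        using quotient_plotD[OF p u] by metis
      moreover from this have "\<forall>v\<in>V. q v = r `` {h v}" using q by (metis subsetD)
      ultimately show ?thesis by blast
    qed
    then show "plot (quotient_dspace X r) n U q" using p by (simp add: quotient_dspace_def)
  next
    fix n U and x :: "'a set" assume U: "openin (Euclidean_space n) U" "x \<in> points (quotient_dspace X r)"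
    then obtain a where "a \<in> points X" "x = r `` {a}" by (auto simp: quotient_dspace_def quotient_def)
    then show "plot (quotient_dspace X r) n U (\<lambda>_. x)"
      using U plot_const[OF U(1)] by (auto simp: quotient_dspace_def)
  next
    fix n U p m V f
    assume p: "plot (quotient_dspace X r) n U p" and V: "openin (Euclidean_space m) V"
      and f: "euclidean_smooth m V n U f"
    have "\<exists>W q. openin (Euclidean_space m) W \<and> v \<in> W \<and> W \<subseteq> V \<and> plot X m W q \<and> (\<forall>w\<in>W. (p \<circ> f) w = r `` {q w})"
      if v: "v \<in> V" for v
    proof -
      from f v have "f v \<in> U" by (auto simp: euclidean_smooth_def)
      then obtain W q where W: "openin (Euclidean_space n) W" "f v \<in> W" "W \<subseteq> U" "plot X n W q" "\<And>w. w \<in> W \<Longrightarrow> p w = r `` {q w}"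
        using quotient_plotD[OF p] by metis
      have U: "openin (Euclidean_space n) U" using p by (simp add: quotient_dspace_def)
      let ?W = "{v \<in> V. f v \<in> W}"
      have o: "openin (Euclidean_space m) ?W"
        using f openin_subset[OF U] by (intro openin_smooth_preimage[OF V W(1)]) (auto simp: euclidean_smooth_def)
      moreover have "plot X m ?W (\<lambda>w. q (f w))"
        using f by (intro plot_subst[OF W(4) o]) (auto simp: euclidean_smooth_def intro: smooth_fun_subset[OF V o])
      ultimately show ?thesis using W v by (intro exI[of _ ?W] exI[of _ "\<lambda>w. q (f w)"]) auto
    qed
    then show "plot (quotient_dspace X r) m V (p \<circ> f)" using V by (simp add: quotient_dspace_def)
  next
    fix n U p
    assume a: "openin (Euclidean_space n) U" "p \<in> U \<rightarrow> points (quotient_dspace X r)"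
      "\<And>u. u \<in> U \<Longrightarrow> \<exists>V. openin (Euclidean_space n) V \<and> u \<in> V \<and> V \<subseteq> U \<and> plot (quotient_dspace X r) n V p"
    have "\<exists>V q. openin (Euclidean_space n) V \<and> u \<in> V \<and> V \<subseteq> U \<and> plot X n V q \<and> (\<forall>v\<in>V. p v = r `` {q v})"
      if u: "u \<in> U" for u
    proof -
      obtain V where V: "u \<in> V" "V \<subseteq> U" "plot (quotient_dspace X r) n V p" using a(3)[OF u] by blast
      obtain W q where "openin (Euclidean_space n) W" "u \<in> W" "W \<subseteq> V" "plot X n W q" "\<And>v. v \<in> W \<Longrightarrow> p v = r `` {q v}"
        using quotient_plotD[OF V(3,1)] by metis
      then show ?thesis using V(2) by blast
    qed
    then show "plot (quotient_dspace X r) n U p" using a(1) by (simp add: quotient_dspace_def)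
  qed
qed

subsection \<open>Iterated loops as maps of cubes\<close>

definition trunc :: "nat \<Rightarrow> (nat \<Rightarrow> real) \<Rightarrow> nat \<Rightarrow> real" where
  "trunc n w = (\<lambda>i. if i < n then w i else 0)"

text \<open>The product of \<open>U\<close> with R^k, placed inside R^(n+k) because the domain of a
  plot is open in a single Euclidean space. \<open>trunc n\<close> is its first projection and
  \<open>app n\<close> the pairing.\<close>

definition cyl :: "nat \<Rightarrow> (nat \<Rightarrow> real) set \<Rightarrow> nat \<Rightarrow> (nat \<Rightarrow> real) set" where
  "cyl n U k = {w \<in> Rn (n + k). trunc n w \<in> U}"

definition app :: "nat \<Rightarrow> (nat \<Rightarrow> real) \<Rightarrow> (nat \<Rightarrow> real) \<Rightarrow> nat \<Rightarrow> real" where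
  "app n u v = (\<lambda>i. if i < n then u i else v (i - n))"

text \<open>Currying: coordinate 0 becomes the outermost loop parameter, which
  \<open>case_nat\<close> puts in front of the remaining coordinates.\<close>

primrec cube_loop :: "nat \<Rightarrow> ((nat \<Rightarrow> real) \<Rightarrow> 'a) \<Rightarrow> 'a iterated_loop" where
  "cube_loop 0 f = Point (f (\<lambda>_. 0))"
| "cube_loop (Suc k) f = Loop (\<lambda>s. cube_loop k (\<lambda>v. f (case_nat s v)))"

lemma case_nat_Rn: "v \<in> Rn k \<Longrightarrow> case_nat s v \<in> Rn (Suc k)"
  by (auto simp: Rn_iff split: nat.split)

lemma case_nat_eta: "case_nat (v 0) (\<lambda>i. v (Suc i)) = v"
  by (auto simp: fun_eq_iff split: nat.split)

lemma tail_Rn: "v \<in> Rn (Suc k) \<Longrightarrow> (\<lambda>i. v (Suc i)) \<in> Rn k"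
  by (auto simp: Rn_iff)

text \<open>Only values on R^k survive currying, since each \<open>Loop\<close> supplies one real
  coordinate and \<open>Point\<close> evaluates the rest at 0.\<close>

lemma cube_loop_eq_iff: "cube_loop k f = cube_loop k g \<longleftrightarrow> (\<forall>v\<in>Rn k. f v = g v)"
proof (induction k arbitrary: f g)
  case 0
  have "Rn 0 = {\<lambda>_. 0}" by (auto simp: Rn_iff)
  then show ?case by simp
next
  case (Suc k)
  have "cube_loop (Suc k) f = cube_loop (Suc k) g \<longleftrightarrow> (\<forall>s. \<forall>v\<in>Rn k. f (case_nat s v) = g (case_nat s v))"
    by (simp add: fun_eq_iff Suc.IH)
  also have "\<dots> \<longleftrightarrow> (\<forall>v\<in>Rn (Suc k). f v = g v)"
    by (metis case_nat_Rn case_nat_eta tail_Rn)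
  finally show ?case .
qed

lemma const_iterated_loop_eq: "const_iterated_loop k y = cube_loop k (\<lambda>_. y)"
  by (induction k) auto

lemma trunc_Rn: "trunc n w \<in> Rn n" by (auto simp: trunc_def Rn_iff)
lemma trunc_id: "w \<in> Rn n \<Longrightarrow> trunc n w = w" by (auto simp: trunc_def Rn_iff fun_eq_iff)

lemma trunc_upd: "u \<in> Rn n \<Longrightarrow> trunc n (u(n := s)) = u" by (auto simp: trunc_def Rn_iff fun_eq_iff)

lemma smooth_fun_trunc: "openin (Euclidean_space m) V \<Longrightarrow> smooth_fun m V (\<lambda>v. trunc n v j)"
  by (cases "j < n") (auto simp: trunc_def smooth_fun_const smooth_fun_coordinate)

lemma openin_cyl: "openin (Euclidean_space n) U \<Longrightarrow> openin (Euclidean_space (n + k)) (cyl n U k)"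
  unfolding cyl_def
  by (rule openin_smooth_preimage[OF openin_Rn]) (auto simp: trunc_Rn smooth_fun_trunc[OF openin_Rn])

lemma app_Rn: "u \<in> Rn n \<Longrightarrow> v \<in> Rn k \<Longrightarrow> app n u v \<in> Rn (n + k)"
  by (auto simp: app_def Rn_iff)

lemma trunc_app: "u \<in> Rn n \<Longrightarrow> trunc n (app n u v) = u"
  by (auto simp: app_def trunc_def Rn_iff fun_eq_iff)

lemma app_cyl: "U \<subseteq> Rn n \<Longrightarrow> u \<in> U \<Longrightarrow> v \<in> Rn k \<Longrightarrow> app n u v \<in> cyl n U k"
  by (auto simp: cyl_def trunc_app app_Rn subset_iff)

lemma app_cyl_cases:
  assumes "w \<in> cyl n U k" obtains u v where "u \<in> U" "v \<in> Rn k" "w = app n u v"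
proof
  show "trunc n w \<in> U" using assms by (simp add: cyl_def)
  show "(\<lambda>i. w (n + i)) \<in> Rn k" using assms by (auto simp: cyl_def Rn_iff)
  show "w = app n (trunc n w) (\<lambda>i. w (n + i))" by (auto simp: app_def trunc_def fun_eq_iff)
qed

lemma app_offset [simp]: "app n u v (n + i) = v i" by (simp add: app_def)

text \<open>Regrouping (U \<times> R) \<times> R^k as U \<times> R^(k+1): one more parameter is
  traded for one more loop coordinate. \<open>app_Suc\<close> does the same for points.\<close>

lemma cyl_cyl: "cyl (Suc n) (cyl n U (Suc 0)) k = cyl n U (Suc k)"
proof -
  have "trunc n (trunc (Suc n) w) = trunc n w" "trunc (Suc n) w \<in> Rn (Suc n)" for w
    by (auto simp: trunc_def fun_eq_iff Rn_iff)
  then show ?thesis by (auto simp: cyl_def)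
qed

lemma app_Suc: "app (Suc n) (u(n := s)) v = app n u (case_nat s v)"
proof
  fix i show "app (Suc n) (u(n := s)) v i = app n u (case_nat s v) i"
  proof (cases "i > n")
    case True
    then obtain j where "i = Suc (n + j)" using less_imp_Suc_add by blast
    then show ?thesis using app_offset[of n u "case_nat s v" "Suc j"] app_offset[of "Suc n" _ v j] by simp
  qed (auto simp: app_def)
qed

section \<open>Plots of iterated loop spaces as families of cubes\<close>

definition cubes :: "nat \<Rightarrow> 'a dspace \<Rightarrow> 'a \<Rightarrow> ((nat \<Rightarrow> real) \<Rightarrow> 'a) set" where
  "cubes k Y y = {f. plot Y k (Rn k) f \<and> (\<forall>w\<in>Rn k. (\<exists>i<k. w i \<in> {0,1}) \<longrightarrow> f w = y)}"

definition loop_family :: "nat \<Rightarrow> (nat \<Rightarrow> real) set \<Rightarrow> nat \<Rightarrow> 'a dspace \<Rightarrow> 'a \<Rightarrow> ((nat \<Rightarrow> real) \<Rightarrow> 'a) \<Rightarrow> bool" where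
  "loop_family n U k Y y F \<longleftrightarrow> plot Y (n + k) (cyl n U k) F \<and>
     (\<forall>w\<in>cyl n U k. (\<exists>i<k. w (n + i) \<in> {0,1}) \<longrightarrow> F w = y)"

text \<open>The axioms that the exponential law below draws on. For an iterated loop space they are
  read off from the description of its plots by \<open>loop_family\<close>.\<close>

definition plot_stable :: "'a dspace \<Rightarrow> bool" where
  "plot_stable Z \<longleftrightarrow>
    (\<forall>n U p q. plot Z n U p \<longrightarrow> (\<forall>u\<in>U. p u = q u) \<longrightarrow> plot Z n U q) \<and>
    (\<forall>n U p. plot Z n U p \<longrightarrow> p \<in> U \<rightarrow> points Z) \<and>
    (\<forall>n U p m V f. plot Z n U p \<longrightarrow> openin (Euclidean_space m) V \<longrightarrow> euclidean_smooth m V n U f \<longrightarrow> plot Z m V (p \<circ> f))"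

lemma plot_stable_cong: "plot_stable Z \<Longrightarrow> plot Z n U p \<Longrightarrow> (\<And>u. u \<in> U \<Longrightarrow> p u = q u) \<Longrightarrow> plot Z n U q"
  by (simp add: plot_stable_def)

lemma plot_stable_range: "plot_stable Z \<Longrightarrow> plot Z n U p \<Longrightarrow> p \<in> U \<rightarrow> points Z"
  by (simp add: plot_stable_def)

lemma plot_stable_comp:
  "plot_stable Z \<Longrightarrow> plot Z n U p \<Longrightarrow> openin (Euclidean_space m) V \<Longrightarrow> euclidean_smooth m V n U f \<Longrightarrow> plot Z m V (p \<circ> f)"
  by (simp add: plot_stable_def)

text \<open>The exponential law. The map \<open>w \<mapsto> (trunc n w, w n)\<close> is a plot of
  the product, and every plot \<open>p\<close> of the product is this one composed with the smooth
  map \<open>v \<mapsto> (fst (p v))(n := snd (p v))\<close> into the cylinder.\<close>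

lemma dsmooth_uncurry:
  assumes Z: "plot_stable Z"
    and U: "openin (Euclidean_space n) U"
  shows "dsmooth (prod_dspace (euclidean_dspace n U) real_dspace) Z (\<lambda>(u, s). Q u s) \<longleftrightarrow>
    plot Z (Suc n) (cyl n U (Suc 0)) (\<lambda>w. Q (trunc n w) (w n))" (is "?L \<longleftrightarrow> ?R")
proof
  have o: "openin (Euclidean_space (Suc n)) (cyl n U (Suc 0))" using openin_cyl[OF U, of "Suc 0"] by simp
  assume ?L
  moreover have "plot (prod_dspace (euclidean_dspace n U) real_dspace) (Suc n) (cyl n U (Suc 0)) (\<lambda>w. (trunc n w, w n))"
    using o by (auto simp: prod_dspace_def euclidean_dspace_def real_dspace_def o_def euclidean_smooth_def
        smooth_fun_trunc smooth_fun_coordinate cyl_def)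
  ultimately have "plot Z (Suc n) (cyl n U (Suc 0)) ((\<lambda>(u, s). Q u s) \<circ> (\<lambda>w. (trunc n w, w n)))"
    by (simp only: dsmooth_def)
  then show ?R by (simp add: o_def)
next
  assume R: ?R
  have in_cyl: "u(n := s) \<in> cyl n U (Suc 0)" "trunc n (u(n := s)) = u" if "u \<in> U" for u s
    using that openin_subset[OF U] trunc_upd[of u n s] by (auto simp: cyl_def) (auto simp: Rn_iff subset_iff)
  show ?L unfolding dsmooth_def
  proof (intro conjI allI impI)
    show "(\<lambda>(u, s). Q u s) \<in> points (prod_dspace (euclidean_dspace n U) real_dspace) \<rightarrow> points Z"
      using plot_stable_range[OF Z R] in_cyl by (fastforce simp: prod_dspace_def euclidean_dspace_def Pi_iff)
  next
    fix m V p assume p: "plot (prod_dspace (euclidean_dspace n U) real_dspace) m V p"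
    define f where "f v = (fst (p v))(n := snd (p v))" for v
    have V: "openin (Euclidean_space m) V" and p1: "fst \<circ> p \<in> V \<rightarrow> U"
      and p2: "\<And>j. j < n \<Longrightarrow> smooth_fun m V (\<lambda>v. fst (p v) j)" "smooth_fun m V (\<lambda>v. snd (p v))"
      using p by (auto simp: prod_dspace_def euclidean_dspace_def real_dspace_def euclidean_smooth_def o_def)
    have "euclidean_smooth m V (Suc n) (cyl n U (Suc 0)) f"
      using p1 p2 in_cyl(1) by (auto simp: euclidean_smooth_def f_def less_Suc_eq Pi_iff)
    from plot_stable_comp[OF Z R V this] show "plot Z m V ((\<lambda>(u, s). Q u s) \<circ> p)"
      by (rule plot_stable_cong[OF Z]) (use p1 in_cyl in \<open>auto simp: f_def split_def Pi_iff\<close>)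
  qed
qed

lemma dsmooth_real_iff:
  assumes Z: "plot_stable Z"
  shows "dsmooth real_dspace Z \<gamma> \<longleftrightarrow> plot Z (Suc 0) (Rn (Suc 0)) (\<lambda>w. \<gamma> (w 0))" (is "?L \<longleftrightarrow> ?R")
proof
  assume ?L
  moreover have "plot real_dspace (Suc 0) (Rn (Suc 0)) (\<lambda>w. w 0)"
    by (simp add: real_dspace_def smooth_fun_coordinate)
  ultimately show ?R by (auto simp: dsmooth_def o_def)
next
  assume R: ?R
  have in_R: "(\<lambda>i. if i = 0 then s else 0) \<in> Rn (Suc 0)" for s by (auto simp: Rn_iff)
  show ?L unfolding dsmooth_def
  proof (intro conjI allI impI)
    show "\<gamma> \<in> points real_dspace \<rightarrow> points Z"
      using plot_stable_range[OF Z R] in_R by (fastforce simp: Pi_iff)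
  next
    fix m V p assume p: "plot real_dspace m V p"
    have "euclidean_smooth m V (Suc 0) (Rn (Suc 0)) (\<lambda>v i. if i = 0 then p v else 0)"
      using p in_R by (auto simp: euclidean_smooth_def real_dspace_def)
    from plot_stable_comp[OF Z R _ this] p show "plot Z m V (\<gamma> \<circ> p)" by (simp add: o_def real_dspace_def)
  qed
qed

context diffeology begin

lemma loop_family_slice:
  assumes F: "loop_family n U k X y F" and U: "openin (Euclidean_space n) U" and u: "u \<in> U"
  shows "(\<lambda>v. F (app n u v)) \<in> cubes k X y"
proof -
  have c: "app n u v \<in> cyl n U k" if "v \<in> Rn k" for v using app_cyl openin_subset[OF U] u that by blast
  have "smooth_fun k (Rn k) (\<lambda>v. app n u v j)" for j
    by (cases "j < n") (auto simp: app_def smooth_fun_const smooth_fun_coordinate)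
  moreover have "plot X (n + k) (cyl n U k) F" using F by (simp add: loop_family_def)
  ultimately have "plot X k (Rn k) (\<lambda>v. F (app n u v))"
    using plot_subst[OF _ openin_Rn, where p=F and f="app n u"] c by blast
  moreover have "F (app n u v) = y" if "v \<in> Rn k" "i < k" "v i \<in> {0,1}" for v i
    using F c[OF that(1)] that(2,3) app_offset[of n u v i] unfolding loop_family_def by metis
  ultimately show ?thesis unfolding cubes_def by blast
qed

lemma loop_family_comp:
  assumes F: "loop_family n U k X y F" and V: "openin (Euclidean_space m) V"
    and U: "openin (Euclidean_space n) U" and f: "euclidean_smooth m V n U f"
  shows "loop_family m V k X y (\<lambda>w. F (app n (f (trunc m w)) (\<lambda>i. w (m + i))))"
proof -
  have c: "app n (f (trunc m w)) (\<lambda>i. w (m + i)) \<in> cyl n U k" if "w \<in> cyl m V k" for w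
  proof (rule app_cyl[OF openin_subset[OF U]])
    show "f (trunc m w) \<in> U" using that f by (auto simp: cyl_def euclidean_smooth_def)
    show "(\<lambda>i. w (m + i)) \<in> Rn k" using that by (auto simp: cyl_def Rn_iff)
  qed
  have o: "openin (Euclidean_space (m + k)) (cyl m V k)" by (rule openin_cyl[OF V])
  have "smooth_fun (m + k) (cyl m V k) (\<lambda>w. app n (f (trunc m w)) (\<lambda>i. w (m + i)) j)" for j
  proof (cases "j < n")
    case True
    then have "smooth_fun m V (\<lambda>v. f v j)" using f by (simp add: euclidean_smooth_def)
    then have "smooth_fun (m + k) (cyl m V k) (\<lambda>w. f (trunc m w) j)"
      by (intro smooth_fun_compose[OF o V, where f="\<lambda>v. f v j"]) (auto simp: cyl_def smooth_fun_trunc[OF o, unfolded cyl_def])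
    then show ?thesis using True by (simp add: app_def)
  qed (auto simp: app_def smooth_fun_coordinate[OF o])
  moreover have "plot X (n + k) (cyl n U k) F" using F by (simp add: loop_family_def)
  ultimately have "plot X (m + k) (cyl m V k) (\<lambda>w. F (app n (f (trunc m w)) (\<lambda>i. w (m + i))))"
    using plot_subst[OF _ o, where p=F and f="\<lambda>w. app n (f (trunc m w)) (\<lambda>i. w (m + i))"] c by blast
  moreover have "F (app n (f (trunc m w)) (\<lambda>i. w (m + i))) = y"
    if "w \<in> cyl m V k" "i < k" "w (m + i) \<in> {0, 1}" for w i
    using F c[OF that(1)] that(2,3) app_offset[of n "f (trunc m w)" "\<lambda>i. w (m + i)" i] unfolding loop_family_def by metis
  ultimately show ?thesis unfolding loop_family_def by blast
qed

lemma loop_family_space_closed: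
  assumes Z: "\<And>n U P. plot Z n U P \<longleftrightarrow> openin (Euclidean_space n) U \<and>
      (\<exists>F. loop_family n U k X y F \<and> (\<forall>u\<in>U. P u = cube_loop k (\<lambda>v. F (app n u v))))"
    and pts: "points Z = cube_loop k ` cubes k X y"
  shows "plot_stable Z"
  unfolding plot_stable_def
proof (intro conjI allI impI)
  fix n U p q assume "plot Z n U p" "\<forall>u\<in>U. p u = q u"
  then show "plot Z n U q" unfolding Z by metis
next
  fix n U p assume "plot Z n U p"
  then show "p \<in> U \<rightarrow> points Z" unfolding Z pts using loop_family_slice by fastforce
next
  fix n U p m V f assume p: "plot Z n U p" and V: "openin (Euclidean_space m) V" and f: "euclidean_smooth m V n U f"
  then obtain F where F: "openin (Euclidean_space n) U" "loop_family n U k X y F" "\<And>u. u \<in> U \<Longrightarrow> p u = cube_loop k (\<lambda>v. F (app n u v))"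
    unfolding Z by blast
  show "plot Z m V (p \<circ> f)" unfolding Z
  proof (intro conjI exI ballI)
    show "loop_family m V k X y (\<lambda>w. F (app n (f (trunc m w)) (\<lambda>i. w (m + i))))"
      by (rule loop_family_comp[OF F(2) V F(1) f])
    fix v assume v: "v \<in> V"
    then have "trunc m (app m v x) = v" for x using trunc_app openin_subset[OF V] by blast
    moreover have "f v \<in> U" using f v by (auto simp: euclidean_smooth_def)
    ultimately show "(p \<circ> f) v = cube_loop k (\<lambda>x. F (app n (f (trunc m (app m v x))) (\<lambda>i. app m v x (m + i))))"
      by (simp add: F(3))
  qed (rule V)
qed

text \<open>The induction step over \<open>k\<close>. Uncurrying turns a plot of loops in
  \<open>Z\<close> into a plot of \<open>Z\<close> over \<open>U\<close> \<times> R, hence into a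
  family with one more cube coordinate. The end point conditions of the loops are the boundary
  condition on the faces of the new coordinate.\<close>

lemma plot_loop_dspace_iff:
  assumes Z: "\<And>n U P. plot Z n U P \<longleftrightarrow> openin (Euclidean_space n) U \<and>
      (\<exists>F. loop_family n U k X y F \<and> (\<forall>u\<in>U. P u = cube_loop k (\<lambda>v. F (app n u v))))"
    and pts: "points Z = cube_loop k ` cubes k X y"
  shows "plot (loop_dspace Z (const_iterated_loop k y)) n U Q \<longleftrightarrow> openin (Euclidean_space n) U \<and>
      (\<exists>F. loop_family n U (Suc k) X y F \<and> (\<forall>u\<in>U. Loop (Q u) = cube_loop (Suc k) (\<lambda>v. F (app n u v))))"
    (is "?L \<longleftrightarrow> ?R")
proof -
  note closed = loop_family_space_closed[OF Z pts]
  have unc: "plot (loop_dspace Z c) n U Q \<longleftrightarrow> openin (Euclidean_space n) U \<and>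
     (\<forall>u\<in>U. dsmooth real_dspace Z (Q u) \<and> Q u 0 = c \<and> Q u 1 = c) \<and>
     plot Z (Suc n) (cyl n U (Suc 0)) (\<lambda>w. Q (trunc n w) (w n))" for c
    using dsmooth_uncurry[OF closed, where n=n and U=U and Q=Q]
    by (auto simp: loop_dspace_def sub_dspace_def fun_dspace_def real_dspace_def extensional_def Pi_iff)
  have upd: "u(n := s) \<in> cyl n U (Suc 0)" "trunc n (u(n := s)) = u" if "u \<in> U" "openin (Euclidean_space n) U" for u s
    using that openin_subset[OF that(2)] trunc_upd[of u n s] by (auto simp: cyl_def) (auto simp: Rn_iff subset_iff)
  show ?thesis
  proof
    assume ?L
    then have U: "openin (Euclidean_space n) U"
      and Q01: "\<And>u. u\<in>U \<Longrightarrow> Q u 0 = cube_loop k (\<lambda>_. y) \<and> Q u 1 = cube_loop k (\<lambda>_. y)"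
      and p: "plot Z (Suc n) (cyl n U (Suc 0)) (\<lambda>w. Q (trunc n w) (w n))"
      unfolding unc const_iterated_loop_eq by auto
    from p obtain F where F: "loop_family (Suc n) (cyl n U (Suc 0)) k X y F"
      "\<And>w. w \<in> cyl n U (Suc 0) \<Longrightarrow> Q (trunc n w) (w n) = cube_loop k (\<lambda>v. F (app (Suc n) w v))"
      unfolding Z by blast
    have Q: "Q u s = cube_loop k (\<lambda>v. F (app n u (case_nat s v)))" if "u \<in> U" for u s
      using F(2)[OF upd(1)[OF that U], of s] upd(2)[OF that U] by (simp add: app_Suc)
    have "F w = y" if w: "w \<in> cyl n U (Suc k)" and i: "i < Suc k" "w (n + i) \<in> {0,1}" for w i
    \<comment> \<open>The faces of coordinate 0 come from the end points of the loops, those of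
      later coordinates from the family over the cylinder.\<close>
    proof (cases i)
      case 0
      from w obtain u v where uv: "u \<in> U" "v \<in> Rn (Suc k)" "w = app n u v" by (rule app_cyl_cases)
      have v0: "v 0 \<in> {0,1}" using i uv(3) 0 app_offset[of n u v 0] by simp
      then have "cube_loop k (\<lambda>x. F (app n u (case_nat (v 0) x))) = cube_loop k (\<lambda>_. y)"
        using Q[OF uv(1), of "v 0"] Q01[OF uv(1)] by auto
      then have "F (app n u (case_nat (v 0) (\<lambda>i. v (Suc i)))) = y"
        using tail_Rn[OF uv(2)] unfolding cube_loop_eq_iff by blast
      then show ?thesis by (simp add: case_nat_eta uv(3))
    next
      case (Suc i')
      then have "w (Suc n + i') \<in> {0,1}" "i' < k" using i by auto
      then show ?thesis using F(1) w unfolding loop_family_def cyl_cyl by blast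
    qed
    then have "loop_family n U (Suc k) X y F" using F(1) unfolding loop_family_def cyl_cyl by auto
    then show ?R using U Q by auto
  next
    assume R: ?R
    then obtain F where U: "openin (Euclidean_space n) U" and F: "loop_family n U (Suc k) X y F"
      and Q: "\<And>u s. u \<in> U \<Longrightarrow> Q u s = cube_loop k (\<lambda>v. F (app n u (case_nat s v)))"
      by (auto simp: fun_eq_iff)
    have "loop_family (Suc n) (cyl n U (Suc 0)) k X y F"
      using F unfolding loop_family_def cyl_cyl by (metis Suc_less_eq add_Suc add_Suc_right)
    moreover have "Q (trunc n w) (w n) = cube_loop k (\<lambda>v. F (app (Suc n) w v))" if w: "w \<in> cyl n U (Suc 0)" for w
    proof -
      have "(trunc n w)(n := w n) = w" using w by (auto simp: cyl_def trunc_def Rn_iff fun_eq_iff)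
      moreover have "trunc n w \<in> U" using w by (simp add: cyl_def)
      ultimately show ?thesis using Q[of "trunc n w" "w n"] app_Suc[of n "trunc n w" "w n"] by simp
    qed
    ultimately have p: "plot Z (Suc n) (cyl n U (Suc 0)) (\<lambda>w. Q (trunc n w) (w n))"
      unfolding Z using openin_cyl[OF U, of "Suc 0"] by auto
    have "dsmooth real_dspace Z (Q u)" if u: "u \<in> U" for u
    proof -
      have "euclidean_smooth (Suc 0) (Rn (Suc 0)) (Suc n) (cyl n U (Suc 0)) (\<lambda>w. u(n := w 0))"
      proof -
        have "smooth_fun (Suc 0) (Rn (Suc 0)) (\<lambda>w. (u(n := w 0)) j)" for j
          by (cases "j = n") (simp_all add: smooth_fun_const smooth_fun_coordinate)
        then show ?thesis using upd(1)[OF u U] by (auto simp: euclidean_smooth_def)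
      qed
      from plot_stable_comp[OF closed p openin_Rn this] show ?thesis
        unfolding dsmooth_real_iff[OF closed] using upd(2)[OF u U] by (simp add: o_def)
    qed
    moreover have "Q u s = cube_loop k (\<lambda>_. y)" if u: "u \<in> U" and s: "s \<in> {0,1}" for u s
      unfolding Q[OF u] cube_loop_eq_iff
    proof
      fix v assume "v \<in> Rn k"
      then have "app n u (case_nat s v) \<in> cyl n U (Suc k)"
        by (intro app_cyl[OF openin_subset[OF U] u] case_nat_Rn)
      moreover have "app n u (case_nat s v) (n + 0) \<in> {0,1}" unfolding app_offset using s by simp
      ultimately show "F (app n u (case_nat s v)) = y" using F unfolding loop_family_def by blast
    qed
    ultimately show ?L using U p unfolding unc const_iterated_loop_eq by auto
  qed
qed

lemma loop_family_0: "loop_family 0 (Rn 0) k X y F \<longleftrightarrow> F \<in> cubes k X y"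
proof -
  have "cyl 0 (Rn 0) k = Rn k" using trunc_Rn[of 0] by (auto simp: cyl_def)
  then show ?thesis by (simp add: loop_family_def cubes_def)
qed

lemma iterated_loop_dspace_iff:
  assumes y: "y \<in> points X"
  shows "(\<forall>n U P. plot (iterated_loop_dspace k X y) n U P \<longleftrightarrow> openin (Euclidean_space n) U \<and>
      (\<exists>F. loop_family n U k X y F \<and> (\<forall>u\<in>U. P u = cube_loop k (\<lambda>v. F (app n u v))))) \<and>
    points (iterated_loop_dspace k X y) = cube_loop k ` cubes k X y"
proof (induction k)
  case 0
  have c: "cyl n U 0 = U" "loop_family n U 0 X y F \<longleftrightarrow> plot X n U F" if "openin (Euclidean_space n) U" for n U F
  proof -
    show "cyl n U 0 = U" using openin_subset[OF that] trunc_id by (auto simp: cyl_def subset_iff)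
    then show "loop_family n U 0 X y F \<longleftrightarrow> plot X n U F" by (simp add: loop_family_def)
  qed
  have a: "app n u (\<lambda>_. 0) = u" if "u \<in> U" "openin (Euclidean_space n) U" for n u U
    using openin_subset[OF that(2)] that(1) by (auto simp: app_def Rn_iff subset_iff fun_eq_iff)
  have "plot (iterated_loop_dspace 0 X y) n U P \<longleftrightarrow> openin (Euclidean_space n) U \<and>
      (\<exists>F. loop_family n U 0 X y F \<and> (\<forall>u\<in>U. P u = cube_loop 0 (\<lambda>v. F (app n u v))))" for n U P
    using plot_domain[of n U] c a by (auto simp: image_dspace_def)
  moreover have "points (iterated_loop_dspace 0 X y) = cube_loop 0 ` cubes 0 X y"
  proof
    have "(\<lambda>_. x) \<in> cubes 0 X y" if "x \<in> points X" for x using that plot_const[OF openin_Rn] by (simp add: cubes_def)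
    then show "points (iterated_loop_dspace 0 X y) \<subseteq> cube_loop 0 ` cubes 0 X y"
      by (auto simp: image_dspace_def image_iff)
    show "cube_loop 0 ` cubes 0 X y \<subseteq> points (iterated_loop_dspace 0 X y)"
      using plot_point by (fastforce simp: image_dspace_def cubes_def Rn_iff)
  qed
  ultimately show ?case by blast
next
  case (Suc k)
  let ?Z = "iterated_loop_dspace k X y"
  have Z: "\<And>n U P. plot ?Z n U P \<longleftrightarrow> openin (Euclidean_space n) U \<and>
      (\<exists>F. loop_family n U k X y F \<and> (\<forall>u\<in>U. P u = cube_loop k (\<lambda>v. F (app n u v))))"
    and pts: "points ?Z = cube_loop k ` cubes k X y" using Suc by blast+
  note loop = plot_loop_dspace_iff[OF Z pts]
  note closed = loop_family_space_closed[OF Z pts]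
  have "plot (iterated_loop_dspace (Suc k) X y) n U P \<longleftrightarrow> openin (Euclidean_space n) U \<and>
      (\<exists>F. loop_family n U (Suc k) X y F \<and> (\<forall>u\<in>U. P u = cube_loop (Suc k) (\<lambda>v. F (app n u v))))" (is "?L \<longleftrightarrow> ?R") for n U P
  proof
    assume ?L
    then obtain Q where Q: "plot (loop_dspace ?Z (const_iterated_loop k y)) n U Q" "\<And>u. u \<in> U \<Longrightarrow> P u = Loop (Q u)"
      by (auto simp: image_dspace_def)
    then show ?R unfolding loop by metis
  next
    assume R: ?R
    then obtain F where F: "loop_family n U (Suc k) X y F" "\<And>u. u \<in> U \<Longrightarrow> P u = cube_loop (Suc k) (\<lambda>v. F (app n u v))" by blast
    then have "plot (loop_dspace ?Z (const_iterated_loop k y)) n U (\<lambda>u s. cube_loop k (\<lambda>v. F (app n u (case_nat s v))))"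
      unfolding loop using R by auto
    then show ?L using F(2) by (auto simp: image_dspace_def)
  qed
  moreover have "points (iterated_loop_dspace (Suc k) X y) = cube_loop (Suc k) ` cubes (Suc k) X y"
  proof -
    \<comment> \<open>Points correspond to plots on the one-point domain R^0, so the description of
      the points follows from that of the plots.\<close>
    have "\<gamma> \<in> points (loop_dspace ?Z (const_iterated_loop k y)) \<longleftrightarrow>
      plot (loop_dspace ?Z (const_iterated_loop k y)) 0 (Rn 0) (\<lambda>_. \<gamma>)" for \<gamma>
    proof -
      have "cyl 0 (Rn 0) (Suc 0) = Rn (Suc 0)" using trunc_Rn[of 0] by (auto simp: cyl_def)
      then have "dsmooth (prod_dspace (euclidean_dspace 0 (Rn 0)) real_dspace) ?Z (\<lambda>(u, s). \<gamma> s) \<longleftrightarrow> dsmooth real_dspace ?Z \<gamma>"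
        unfolding dsmooth_real_iff[OF closed] using dsmooth_uncurry[OF closed openin_Rn, where n=0 and Q="\<lambda>_. \<gamma>"] by simp
      moreover have "(\<lambda>_. 0) \<in> Rn 0" by (simp add: Rn_iff)
      ultimately show ?thesis
        by (auto simp: loop_dspace_def sub_dspace_def fun_dspace_def real_dspace_def extensional_def Pi_iff)
    qed
    then have "\<gamma> \<in> points (loop_dspace ?Z (const_iterated_loop k y)) \<longleftrightarrow>
        (\<exists>F\<in>cubes (Suc k) X y. Loop \<gamma> = cube_loop (Suc k) F)" for \<gamma>
    proof -
      have "(\<lambda>_. 0) \<in> Rn 0" "app 0 u v = v" for u v by (auto simp: Rn_iff app_def)
      then show ?thesis using \<open>\<And>\<gamma>. (\<gamma> \<in> _) = _\<close>[of \<gamma>] unfolding loop loop_family_0 by auto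
    qed
    then show ?thesis by (auto simp: image_dspace_def image_iff)
  qed
  ultimately show ?case by blast
qed

end

text \<open>A smooth path in the \<open>k\<close>-fold loop space, uncurried: coordinate 0 is the
  time, which runs through all of R, and the cube coordinates are shifted by one.\<close>

definition htpy :: "nat \<Rightarrow> 'a dspace \<Rightarrow> 'a \<Rightarrow> ((nat \<Rightarrow> real) \<Rightarrow> 'a) \<Rightarrow> ((nat \<Rightarrow> real) \<Rightarrow> 'a) \<Rightarrow> bool" where
  "htpy k Y y f g \<longleftrightarrow> (\<exists>H. plot Y (Suc k) (Rn (Suc k)) H \<and>
     (\<forall>w\<in>Rn (Suc k). (\<exists>i<k. w (Suc i) \<in> {0,1}) \<longrightarrow> H w = y) \<and>
     (\<forall>v\<in>Rn k. H (case_nat 0 v) = f v \<and> H (case_nat 1 v) = g v))"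

lemma htpyI:
  assumes "plot Y (Suc k) (Rn (Suc k)) H"
    "\<And>w i. w \<in> Rn (Suc k) \<Longrightarrow> i < k \<Longrightarrow> w (Suc i) = 0 \<or> w (Suc i) = 1 \<Longrightarrow> H w = y"
    "\<And>v. v \<in> Rn k \<Longrightarrow> H (case_nat 0 v) = f v" "\<And>v. v \<in> Rn k \<Longrightarrow> H (case_nat 1 v) = g v"
  shows "htpy k Y y f g"
  unfolding htpy_def by (rule exI[of _ H]) (use assms in auto)

lemma htpyE:
  assumes "htpy k Y y f g"
  obtains H where "plot Y (Suc k) (Rn (Suc k)) H"
    "\<And>w i. w \<in> Rn (Suc k) \<Longrightarrow> i < k \<Longrightarrow> w (Suc i) = 0 \<or> w (Suc i) = 1 \<Longrightarrow> H w = y"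
    "\<And>v. v \<in> Rn k \<Longrightarrow> H (case_nat 0 v) = f v" "\<And>v. v \<in> Rn k \<Longrightarrow> H (case_nat 1 v) = g v"
  using assms unfolding htpy_def by blast

lemma (in diffeology) path_rel_iterated_loop_iff:
  assumes y: "y \<in> points X"
  shows "(P, Q) \<in> path_rel (iterated_loop_dspace k X y) \<longleftrightarrow>
    (\<exists>f\<in>cubes k X y. \<exists>g\<in>cubes k X y. P = cube_loop k f \<and> Q = cube_loop k g \<and> htpy k X y f g)"
proof -
  let ?Z = "iterated_loop_dspace k X y"
  have Z: "\<And>n U P. plot ?Z n U P \<longleftrightarrow> openin (Euclidean_space n) U \<and>
      (\<exists>F. loop_family n U k X y F \<and> (\<forall>u\<in>U. P u = cube_loop k (\<lambda>v. F (app n u v))))"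
    and pts: "points ?Z = cube_loop k ` cubes k X y" using iterated_loop_dspace_iff[OF y] by blast+
  have a: "app (Suc 0) w v = case_nat (w 0) v" for w v
    by (auto simp: app_def fun_eq_iff split: nat.split)
  have cyl: "cyl (Suc 0) (Rn (Suc 0)) k = Rn (Suc k)"
    using trunc_Rn by (auto simp: cyl_def)
  have g: "dsmooth real_dspace ?Z \<gamma> \<longleftrightarrow>
     (\<exists>H. loop_family (Suc 0) (Rn (Suc 0)) k X y H \<and> (\<forall>s. \<gamma> s = cube_loop k (\<lambda>v. H (case_nat s v))))" for \<gamma>
  proof -
    have "(\<forall>w\<in>Rn (Suc 0). \<gamma> (w 0) = cube_loop k (\<lambda>v. H (case_nat (w 0) v))) \<longleftrightarrow>
      (\<forall>s. \<gamma> s = cube_loop k (\<lambda>v. H (case_nat s v)))" for H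
    proof -
      have "\<exists>w\<in>Rn (Suc 0). w 0 = s" for s
        by (rule bexI[of _ "\<lambda>i. if i = 0 then s else 0"]) (auto simp: Rn_iff)
      then show ?thesis by metis
    qed
    then show ?thesis
      unfolding dsmooth_real_iff[OF loop_family_space_closed[OF Z pts]] Z a by simp
  qed
  have lf: "loop_family (Suc 0) (Rn (Suc 0)) k X y H \<longleftrightarrow> plot X (Suc k) (Rn (Suc k)) H \<and>
     (\<forall>w\<in>Rn (Suc k). (\<exists>i<k. w (Suc i) \<in> {0,1}) \<longrightarrow> H w = y)" for H
    by (simp add: loop_family_def cyl)
  show ?thesis (is "?L \<longleftrightarrow> ?R")
  proof
    assume ?L
    then obtain f g' \<gamma> where fg: "f \<in> cubes k X y" "g' \<in> cubes k X y" "P = cube_loop k f" "Q = cube_loop k g'"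
      and \<gamma>: "dsmooth real_dspace ?Z \<gamma>" "\<gamma> 0 = P" "\<gamma> 1 = Q"
      unfolding path_rel_def pts by blast
    obtain H where H: "loop_family (Suc 0) (Rn (Suc 0)) k X y H" "\<And>s. \<gamma> s = cube_loop k (\<lambda>v. H (case_nat s v))"
      using \<gamma>(1) unfolding g by blast
    have "cube_loop k (\<lambda>v. H (case_nat 0 v)) = cube_loop k f" "cube_loop k (\<lambda>v. H (case_nat 1 v)) = cube_loop k g'"
      using \<gamma>(2,3) H(2) fg by auto
    then have "htpy k X y f g'"
      using H(1) unfolding lf htpy_def cube_loop_eq_iff by blast
    then show ?R using fg by blast
  next
    assume ?R
    then obtain f g' where fg: "f \<in> cubes k X y" "g' \<in> cubes k X y" "P = cube_loop k f" "Q = cube_loop k g'" "htpy k X y f g'"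
      by blast
    then obtain H where H: "loop_family (Suc 0) (Rn (Suc 0)) k X y H" "\<forall>v\<in>Rn k. H (case_nat 0 v) = f v \<and> H (case_nat 1 v) = g' v"
      unfolding htpy_def lf by blast
    define \<gamma> where "\<gamma> s = cube_loop k (\<lambda>v. H (case_nat s v))" for s
    have "dsmooth real_dspace ?Z \<gamma>" unfolding g \<gamma>_def using H by blast
    moreover have "\<gamma> 0 = P" "\<gamma> 1 = Q" using H(2) fg(3,4) by (simp_all add: \<gamma>_def cube_loop_eq_iff)
    ultimately show ?L using fg by (auto simp: path_rel_def pts)
  qed
qed

subsection \<open>Homotopy classes of maps of cubes\<close>

text \<open>Maps R^k into the unit cube and the collars \<open>w i \<le> 1/4\<close> and
  \<open>3/4 \<le> w i\<close> into its faces.\<close>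

definition smash_cube :: "nat \<Rightarrow> (nat \<Rightarrow> real) \<Rightarrow> nat \<Rightarrow> real" where
  "smash_cube k w = (\<lambda>i. if i < k then smash (w i) else 0)"

lemma smash_cube_Rn: "smash_cube k w \<in> Rn k" by (auto simp: smash_cube_def Rn_iff)

lemma smooth_fun_smash_cube: "openin (Euclidean_space n) U \<Longrightarrow> smooth_fun n U (\<lambda>w. smash_cube k w j)"
  by (cases "j < k") (auto simp: smash_cube_def smooth_fun_const smooth_fun_coordinate intro: smooth_fun_smash)

text \<open>\<open>loop_concat\<close> in coordinate \<open>j\<close>. Coordinate 0 of a cube gives
  the group operation, coordinate 0 of a homotopy the concatenation in time, and the later
  coordinates of a homotopy concatenate the cubes at each time.\<close>

definition cat :: "nat \<Rightarrow> ((nat \<Rightarrow> real) \<Rightarrow> 'a) \<Rightarrow> ((nat \<Rightarrow> real) \<Rightarrow> 'a) \<Rightarrow> (nat \<Rightarrow> real) \<Rightarrow> 'a" where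
  "cat j f g w = (if w j \<le> 1/2 then f (w(j := smash (2 * w j))) else g (w(j := smash (2 * w j - 1))))"

lemma case_nat_upd_Suc: "(case_nat t v)(Suc j := s) = case_nat t (v(j := s))"
  by (auto simp: fun_eq_iff split: nat.split)

lemma case_nat_upd_0: "(case_nat t v)(0 := s) = case_nat s v"
  by (auto simp: fun_eq_iff split: nat.split)

lemma smooth_fun_upd:
  assumes "openin (Euclidean_space n) U" "smooth_fun n U h"
  shows "smooth_fun n U (\<lambda>w. (w(j := h w)) i)"
  by (cases "i = j") (simp_all add: assms smooth_fun_coordinate)

context diffeology begin

lemma plot_cat:
  assumes f: "plot X m (Rn m) f" and g: "plot X m (Rn m) g" and j: "j < m"
    and fg: "\<And>w. w \<in> Rn m \<Longrightarrow> f (w(j := 1)) = g (w(j := 0))"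
  shows "plot X m (Rn m) (cat j f g)"
proof (rule plot_localI[OF openin_Rn])
  fix u assume u: "u \<in> Rn m"
  have sm: "smooth_fun m U (\<lambda>w. smash (2 * w j - a))" if "openin (Euclidean_space m) U" for U a
    using that by (intro smooth_fun_smash smooth_fun_diff smooth_fun_mult smooth_fun_const smooth_fun_coordinate)
  show "\<exists>V q. openin (Euclidean_space m) V \<and> u \<in> V \<and> plot X m V q \<and> (\<forall>v\<in>V \<inter> Rn m. cat j f g v = q v)"
  proof (cases "u j \<le> 1/2")
    case True
    \<comment> \<open>The first formula stays valid up to 5/8: between 3/8 and 5/8 the two
      reparametrised coordinates are constantly 1 and 0, where \<open>f\<close> and \<open>g\<close>
      agree.\<close>
    let ?V = "{w \<in> Rn m. w j \<in> {..<5/8}}"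
    have V: "openin (Euclidean_space m) ?V" by (rule openin_Euclidean_space_Int_coordinate) auto
    have "plot X m ?V (\<lambda>w. f (w(j := smash (2 * w j - 0))))"
      by (rule plot_subst[OF f V Rn_upd[OF _ j] smooth_fun_upd[OF V sm[OF V]]]) simp
    moreover have "cat j f g v = f (v(j := smash (2 * v j - 0)))" if "v \<in> ?V" for v
      using that fg[of v] smash_eq_1[of "2 * v j"] smash_eq_0[of "2 * v j - 1"] by (auto simp: cat_def)
    ultimately show ?thesis using V u True by (intro exI[of _ ?V] exI[of _ "\<lambda>w. f (w(j := smash (2 * w j - 0)))"]) auto
  next
    case False
    let ?V = "{w \<in> Rn m. w j \<in> {1/2<..}}"
    have V: "openin (Euclidean_space m) ?V" by (rule openin_Euclidean_space_Int_coordinate) auto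
    have "plot X m ?V (\<lambda>w. g (w(j := smash (2 * w j - 1))))"
      by (rule plot_subst[OF g V Rn_upd[OF _ j] smooth_fun_upd[OF V sm[OF V]]]) simp
    then show ?thesis using V u False
      by (intro exI[of _ ?V] exI[of _ "\<lambda>w. g (w(j := smash (2 * w j - 1)))"]) (auto simp: cat_def)
  qed
qed

lemma cubes_plot: "f \<in> cubes k X y \<Longrightarrow> plot X k (Rn k) f" by (simp add: cubes_def)

lemma cubes_boundary: "f \<in> cubes k X y \<Longrightarrow> w \<in> Rn k \<Longrightarrow> i < k \<Longrightarrow> w i = 0 \<or> w i = 1 \<Longrightarrow> f w = y"
  by (auto simp: cubes_def)

lemma cubesI:
  assumes "plot X k (Rn k) f" "\<And>w i. w \<in> Rn k \<Longrightarrow> i < k \<Longrightarrow> w i = 0 \<or> w i = 1 \<Longrightarrow> f w = y"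
  shows "f \<in> cubes k X y"
  using assms by (auto simp: cubes_def)

lemma cat_boundary:
  assumes "\<And>w. w \<in> Rn m \<Longrightarrow> w i = a \<Longrightarrow> f w = y" "\<And>w. w \<in> Rn m \<Longrightarrow> w i = a \<Longrightarrow> g w = y"
    and "a = 0 \<or> a = 1" "w \<in> Rn m" "w i = a" "j < m"
  shows "cat j f g w = y"
  using assms Rn_upd[OF assms(4,6)] by (cases "i = j") (auto simp: cat_def)

lemma cat_cubes:
  assumes f: "f \<in> cubes k X y" and g: "g \<in> cubes k X y" and j: "j < k"
  shows "cat j f g \<in> cubes k X y"
proof (rule cubesI)
  have "f (w(j := 1)) = g (w(j := 0))" if "w \<in> Rn k" for w
    using cubes_boundary[OF f, of "w(j := 1)" j] cubes_boundary[OF g, of "w(j := 0)" j] that j Rn_upd by auto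
  then show "plot X k (Rn k) (cat j f g)" by (intro plot_cat cubes_plot[OF f] cubes_plot[OF g] j)
  fix w i assume w: "w \<in> Rn k" "i < k" "w i = 0 \<or> w i = 1"
  show "cat j f g w = y"
    by (rule cat_boundary[of k i "w i"]) (use w j cubes_boundary[OF f] cubes_boundary[OF g] in auto)
qed

lemma smooth_tail_plot:
  assumes "f \<in> cubes k X y"
  shows "plot X (Suc k) (Rn (Suc k)) (\<lambda>w. f (\<lambda>i. w (Suc i)))"
  by (rule plot_subst[OF cubes_plot[OF assms] openin_Rn]) (auto simp: tail_Rn smooth_fun_coordinate)

lemma htpy_refl: "f \<in> cubes k X y \<Longrightarrow> htpy k X y f f"
  by (rule htpyI[where H="\<lambda>w. f (\<lambda>i. w (Suc i))"])
     (auto intro: smooth_tail_plot cubes_boundary tail_Rn)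

lemma htpy_sym:
  assumes "htpy k X y f g" shows "htpy k X y g f"
proof -
  obtain H where H: "plot X (Suc k) (Rn (Suc k)) H"
    "\<And>w i. w \<in> Rn (Suc k) \<Longrightarrow> i < k \<Longrightarrow> w (Suc i) = 0 \<or> w (Suc i) = 1 \<Longrightarrow> H w = y"
    "\<And>v. v \<in> Rn k \<Longrightarrow> H (case_nat 0 v) = f v" "\<And>v. v \<in> Rn k \<Longrightarrow> H (case_nat 1 v) = g v"
    using assms by (rule htpyE) (rule that; assumption)
  show ?thesis
  proof (rule htpyI[where H="\<lambda>w. H (w(0 := 1 - w 0))"])
    show "plot X (Suc k) (Rn (Suc k)) (\<lambda>w. H (w(0 := 1 - w 0)))"
      by (rule plot_subst[OF H(1) openin_Rn])
         (auto simp: Rn_upd intro!: smooth_fun_upd smooth_fun_diff smooth_fun_const smooth_fun_coordinate simp del: fun_upd_apply)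
  qed (use H Rn_upd in \<open>auto simp: case_nat_upd_0\<close>)
qed

lemma htpy_trans:
  assumes "htpy k X y f g" "htpy k X y g h" shows "htpy k X y f h"
proof -
  obtain H where H: "plot X (Suc k) (Rn (Suc k)) H"
    "\<And>w i. w \<in> Rn (Suc k) \<Longrightarrow> i < k \<Longrightarrow> w (Suc i) = 0 \<or> w (Suc i) = 1 \<Longrightarrow> H w = y"
    "\<And>v. v \<in> Rn k \<Longrightarrow> H (case_nat 0 v) = f v" "\<And>v. v \<in> Rn k \<Longrightarrow> H (case_nat 1 v) = g v"
    using assms(1) by (rule htpyE) (rule that; assumption)
  obtain K where K: "plot X (Suc k) (Rn (Suc k)) K"
    "\<And>w i. w \<in> Rn (Suc k) \<Longrightarrow> i < k \<Longrightarrow> w (Suc i) = 0 \<or> w (Suc i) = 1 \<Longrightarrow> K w = y"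
    "\<And>v. v \<in> Rn k \<Longrightarrow> K (case_nat 0 v) = g v" "\<And>v. v \<in> Rn k \<Longrightarrow> K (case_nat 1 v) = h v"
    using assms(2) by (rule htpyE) (rule that; assumption)
  show ?thesis
  proof (rule htpyI[where H="cat 0 H K"])
    have "H (w(0 := 1)) = K (w(0 := 0))" if "w \<in> Rn (Suc k)" for w
      using H(4) K(3) tail_Rn[OF that] case_nat_upd_0[of "w 0" "\<lambda>i. w (Suc i)"] by (simp add: case_nat_eta)
    then show "plot X (Suc k) (Rn (Suc k)) (cat 0 H K)" by (intro plot_cat H K) auto
    fix w i assume w: "w \<in> Rn (Suc k)" "i < k" "w (Suc i) = 0 \<or> w (Suc i) = 1"
    show "cat 0 H K w = y"
      by (rule cat_boundary[of "Suc k" "Suc i" "w (Suc i)"]) (use w H(2) K(2) in auto)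
  qed (use H K in \<open>auto simp: cat_def case_nat_upd_0\<close>)
qed

lemma htpy_cat:
  assumes "htpy k X y f g" "htpy k X y f' g'" and j: "j < k"
  shows "htpy k X y (cat j f f') (cat j g g')"
proof -
  obtain H where H: "plot X (Suc k) (Rn (Suc k)) H"
    "\<And>w i. w \<in> Rn (Suc k) \<Longrightarrow> i < k \<Longrightarrow> w (Suc i) = 0 \<or> w (Suc i) = 1 \<Longrightarrow> H w = y"
    "\<And>v. v \<in> Rn k \<Longrightarrow> H (case_nat 0 v) = f v" "\<And>v. v \<in> Rn k \<Longrightarrow> H (case_nat 1 v) = g v"
    using assms(1) by (rule htpyE) (rule that; assumption)
  obtain K where K: "plot X (Suc k) (Rn (Suc k)) K"
    "\<And>w i. w \<in> Rn (Suc k) \<Longrightarrow> i < k \<Longrightarrow> w (Suc i) = 0 \<or> w (Suc i) = 1 \<Longrightarrow> K w = y"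
    "\<And>v. v \<in> Rn k \<Longrightarrow> K (case_nat 0 v) = f' v" "\<And>v. v \<in> Rn k \<Longrightarrow> K (case_nat 1 v) = g' v"
    using assms(2) by (rule htpyE) (rule that; assumption)
  show ?thesis
  proof (rule htpyI[where H="cat (Suc j) H K"])
    have "H (w(Suc j := 1)) = K (w(Suc j := 0))" if "w \<in> Rn (Suc k)" for w
      using H(2)[of "w(Suc j := 1)" j] K(2)[of "w(Suc j := 0)" j] that j Rn_upd by simp
    then show "plot X (Suc k) (Rn (Suc k)) (cat (Suc j) H K)" using j by (intro plot_cat H K) auto
    fix w i assume w: "w \<in> Rn (Suc k)" "i < k" "w (Suc i) = 0 \<or> w (Suc i) = 1"
    show "cat (Suc j) H K w = y"
      by (rule cat_boundary[of "Suc k" "Suc i" "w (Suc i)"]) (use w j H(2) K(2) in auto)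
  next
    fix v assume "v \<in> Rn k"
    then show "cat (Suc j) H K (case_nat 0 v) = cat j f f' v" "cat (Suc j) H K (case_nat 1 v) = cat j g g' v"
      using H(3,4) K(3,4) Rn_upd[OF _ j] by (auto simp: cat_def case_nat_upd_Suc)
  qed
qed

text \<open>The straight-line homotopy from the identity to \<open>smash\<close> in each coordinate
  fixes 0 and 1, hence respects the faces. Every class thus has a representative that is constant on
  collars.\<close>

lemma htpy_smash:
  assumes f: "f \<in> cubes k X y"
  shows "htpy k X y f (\<lambda>w. f (smash_cube k w))"
proof -
  define h where "h w = (\<lambda>i. if i < k then (1 - w 0) * w (Suc i) + w 0 * smash (w (Suc i)) else 0)" for w :: "nat \<Rightarrow> real"
  have h: "h w \<in> Rn k" for w by (auto simp: h_def Rn_iff)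
  have s: "smooth_fun (Suc k) (Rn (Suc k)) (\<lambda>w. h w j)" for j
    by (cases "j < k") (auto simp: h_def intro!: smooth_fun_add smooth_fun_mult smooth_fun_diff smooth_fun_smash smooth_fun_const smooth_fun_coordinate)
  show ?thesis
  proof (rule htpyI[where H="\<lambda>w. f (h w)"])
    show "plot X (Suc k) (Rn (Suc k)) (\<lambda>w. f (h w))"
      by (rule plot_subst[OF cubes_plot[OF f] openin_Rn]) (auto simp: h s)
    fix w i assume "w \<in> Rn (Suc k)" "i < k" "w (Suc i) = 0 \<or> w (Suc i) = 1"
    then show "f (h w) = y" by (intro cubes_boundary[OF f h]) (auto simp: h_def)
  next
    fix v assume v: "v \<in> Rn k"
    then have "h (case_nat 0 v) = v" by (auto simp: h_def Rn_iff fun_eq_iff)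
    then show "f (h (case_nat 0 v)) = f v" by simp
    have "h (case_nat 1 v) = smash_cube k v" by (auto simp: h_def smash_cube_def fun_eq_iff)
    then show "f (h (case_nat 1 v)) = f (smash_cube k v)" by simp
  qed
qed

lemma smash_cubes: "f \<in> cubes k X y \<Longrightarrow> (\<lambda>w. f (smash_cube k w)) \<in> cubes k X y"
proof (rule cubesI)
  assume f: "f \<in> cubes k X y"
  show "plot X k (Rn k) (\<lambda>w. f (smash_cube k w))"
    by (rule plot_subst[OF cubes_plot[OF f] openin_Rn smash_cube_Rn smooth_fun_smash_cube[OF openin_Rn]])
  show "f (smash_cube k w) = y" if "i < k" "w i = 0 \<or> w i = 1" for w i
    by (rule cubes_boundary[OF f smash_cube_Rn that(1)]) (use that in \<open>auto simp: smash_cube_def\<close>)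
qed

section \<open>Classes of cubes and the group operation\<close>

definition cube_class :: "nat \<Rightarrow> 'a \<Rightarrow> ((nat \<Rightarrow> real) \<Rightarrow> 'a) \<Rightarrow> 'a iterated_loop set" where
  "cube_class k y f = path_rel (iterated_loop_dspace k X y) `` {cube_loop k f}"

context
  fixes y assumes y: "y \<in> points X"
begin

lemma htpy_cong:
  assumes "htpy k X y f g" "\<And>v. v \<in> Rn k \<Longrightarrow> f v = f' v" "\<And>v. v \<in> Rn k \<Longrightarrow> g v = g' v"
  shows "htpy k X y f' g'"
  using assms unfolding htpy_def by metis

lemma cube_class_eq:
  assumes "f \<in> cubes k X y"
  shows "cube_class k y f = cube_loop k ` {g \<in> cubes k X y. htpy k X y f g}"
proof -
  have "Q \<in> cube_class k y f \<longleftrightarrow> Q \<in> cube_loop k ` {g \<in> cubes k X y. htpy k X y f g}" for Q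
  proof
    assume "Q \<in> cube_class k y f"
    then obtain f' g where fg: "g \<in> cubes k X y" "cube_loop k f = cube_loop k f'" "Q = cube_loop k g" "htpy k X y f' g"
      unfolding cube_class_def Image_singleton_iff path_rel_iterated_loop_iff[OF y] by blast
    then have "htpy k X y f g" by (auto simp: cube_loop_eq_iff intro: htpy_cong)
    then show "Q \<in> cube_loop k ` {g \<in> cubes k X y. htpy k X y f g}" using fg by blast
  next
    assume "Q \<in> cube_loop k ` {g \<in> cubes k X y. htpy k X y f g}"
    then show "Q \<in> cube_class k y f"
      unfolding cube_class_def Image_singleton_iff path_rel_iterated_loop_iff[OF y] using assms by blast
  qed
  then show ?thesis by blast
qed

lemma cube_class_eq_iff:
  assumes "f \<in> cubes k X y" "g \<in> cubes k X y"
  shows "cube_class k y f = cube_class k y g \<longleftrightarrow> htpy k X y f g"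
proof
  assume "cube_class k y f = cube_class k y g"
  moreover have "cube_loop k g \<in> cube_class k y g"
    using assms htpy_refl by (auto simp: cube_class_eq)
  ultimately obtain g' where "htpy k X y f g'" "cube_loop k g = cube_loop k g'"
    using assms by (auto simp: cube_class_eq)
  then show "htpy k X y f g" by (auto simp: cube_loop_eq_iff intro: htpy_cong)
next
  assume "htpy k X y f g"
  then have "htpy k X y f h \<longleftrightarrow> htpy k X y g h" for h using htpy_sym htpy_trans by blast
  then show "cube_class k y f = cube_class k y g" using assms by (simp add: cube_class_eq)
qed

lemma pi0_iterated_loop: "pi0 (iterated_loop_dspace k X y) = cube_class k y ` cubes k X y"
  using iterated_loop_dspace_iff[OF y, of k]
  by (auto simp: pi0_def quotient_def cube_class_def)

lemma cube_class_memD: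
  assumes "P \<in> cube_class k y f" "f \<in> cubes k X y"
  obtains g where "g \<in> cubes k X y" "htpy k X y f g" "P = cube_loop k g"
  using assms by (auto simp: cube_class_eq)

lemma cube_loop_in_class: "f \<in> cubes k X y \<Longrightarrow> cube_loop k f \<in> cube_class k y f"
  using htpy_refl by (auto simp: cube_class_eq)

lemma homotopy_group_carrier: "carrier (homotopy_group k X y) = cube_class k y ` cubes k X y"
  by (simp add: homotopy_group_def pi0_iterated_loop)

text \<open>The union in the definition of the product is a union of copies of one class, because
  \<open>htpy_cat\<close> makes the concatenation independent of the representatives.\<close>

lemma homotopy_group_mult:
  assumes f: "f \<in> cubes (Suc k) X y" and g: "g \<in> cubes (Suc k) X y"
  shows "mult (homotopy_group (Suc k) X y) (cube_class (Suc k) y f) (cube_class (Suc k) y g)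
    = cube_class (Suc k) y (cat 0 f g)"
proof -
  have concat: "Loop (loop_concat \<gamma> \<delta>) = cube_loop (Suc k) (cat 0 f' g')"
    if "Loop \<gamma> = cube_loop (Suc k) f'" "Loop \<delta> = cube_loop (Suc k) g'" for \<gamma> \<delta> f' g'
    using that by (auto simp: loop_concat_def cat_def case_nat_upd_0)
  have eq: "path_rel (iterated_loop_dspace (Suc k) X y) `` {Loop (loop_concat \<gamma> \<delta>)} = cube_class (Suc k) y (cat 0 f g)"
    if \<gamma>\<delta>: "Loop \<gamma> \<in> cube_class (Suc k) y f" "Loop \<delta> \<in> cube_class (Suc k) y g" for \<gamma> \<delta>
  proof -
    obtain f' where f': "f' \<in> cubes (Suc k) X y" "htpy (Suc k) X y f f'" "Loop \<gamma> = cube_loop (Suc k) f'"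
      using \<gamma>\<delta>(1) f by (rule cube_class_memD)
    obtain g' where g': "g' \<in> cubes (Suc k) X y" "htpy (Suc k) X y g g'" "Loop \<delta> = cube_loop (Suc k) g'"
      using \<gamma>\<delta>(2) g by (rule cube_class_memD)
    have "htpy (Suc k) X y (cat 0 f g) (cat 0 f' g')" by (rule htpy_cat) (use f' g' in auto)
    then have "cube_class (Suc k) y (cat 0 f g) = cube_class (Suc k) y (cat 0 f' g')"
      using f g f' g' by (subst cube_class_eq_iff) (auto intro: cat_cubes)
    then show ?thesis using concat[OF f'(3) g'(3)] by (simp add: cube_class_def)
  qed
  \<comment> \<open>A pair of representatives has to exist, as the union would otherwise be
    empty.\<close>
  have "Loop (\<lambda>s. cube_loop k (\<lambda>v. f (case_nat s v))) \<in> cube_class (Suc k) y f"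
    "Loop (\<lambda>s. cube_loop k (\<lambda>v. g (case_nat s v))) \<in> cube_class (Suc k) y g"
    using cube_loop_in_class[OF f] cube_loop_in_class[OF g] by simp_all
  then obtain \<gamma> \<delta> where \<gamma>\<delta>: "Loop \<gamma> \<in> cube_class (Suc k) y f" "Loop \<delta> \<in> cube_class (Suc k) y g" by blast
  have "{path_rel (iterated_loop_dspace (Suc k) X y) `` {Loop (loop_concat \<gamma> \<delta>)} |
      \<gamma> \<delta>. Loop \<gamma> \<in> cube_class (Suc k) y f \<and> Loop \<delta> \<in> cube_class (Suc k) y g} = {cube_class (Suc k) y (cat 0 f g)}"
    (is "?S = {?C}")
  proof
    show "?S \<subseteq> {?C}" using eq by blast
    have "?C \<in> ?S" using eq[OF \<gamma>\<delta>, symmetric] \<gamma>\<delta> unfolding mem_Collect_eq by blast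
    then show "{?C} \<subseteq> ?S" by (simp only: insert_subset empty_subsetI)
  qed
  then show ?thesis by (simp only: homotopy_group_def monoid.simps) simp
qed

end

end

subsection \<open>Compactness of cubes\<close>

text \<open>
  The coordinates are released one after another, each time by bisection of an interval.
\<close>

lemma cube_induct:
  fixes P :: "(nat \<Rightarrow> real) \<Rightarrow> (nat \<Rightarrow> real) \<Rightarrow> bool"
  assumes glue: "\<And>a b j c. j < m \<Longrightarrow> (\<And>i. i < m \<Longrightarrow> a i \<le> b i) \<Longrightarrow> a j \<le> c \<Longrightarrow> c \<le> b j \<Longrightarrow>
        P a (b(j := c)) \<Longrightarrow> P (a(j := c)) b \<Longrightarrow> P a b"
    and loc: "\<And>x. \<exists>e>0. \<forall>a b. (\<forall>i<m. x i - e \<le> a i \<and> a i \<le> x i \<and> x i \<le> b i \<and> b i \<le> x i + e) \<longrightarrow> P a b"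
    and a: "\<And>i. i < m \<Longrightarrow> a i = 0" and b: "\<And>i. i < m \<Longrightarrow> b i = 1"
  shows "P a b"
proof -
  \<comment> \<open>The first \<open>j\<close> coordinates of the box already span [0,1]; in every
    other coordinate the box contains \<open>x i\<close> and stays within \<open>e\<close> of
    it.\<close>
  define near where "near x e j a b \<longleftrightarrow> (\<forall>i<m. if i < j then a i = 0 \<and> b i = 1
     else x i - e \<le> a i \<and> a i \<le> x i \<and> x i \<le> b i \<and> b i \<le> x i + e)" for x e j and a b :: "nat \<Rightarrow> real"
  have near_mono: "near x e' j a b" if "e \<le> e'" "near x e j a b" for x e e' j a b
    unfolding near_def
  proof (intro allI impI)
    fix i assume "i < m"
    then show "if i < j then a i = 0 \<and> b i = 1
       else x i - e' \<le> a i \<and> a i \<le> x i \<and> x i \<le> b i \<and> b i \<le> x i + e'"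
      using that unfolding near_def by (auto split: if_splits dest!: spec[of _ i])
  qed
  have "j \<le> m \<Longrightarrow> \<forall>x. \<exists>e>0. \<forall>a b. near x e j a b \<longrightarrow> P a b" for j
  proof (induction j)
    case 0
    then show ?case using loc by (simp add: near_def)
  next
    case (Suc j)
    show ?case
    proof
      fix x
      \<comment> \<open>Bisection in coordinate \<open>j\<close>. Overwriting this coordinate by 0
        and 1 makes its condition in \<open>near\<close> true, so only the other coordinates are
        restricted and \<open>p\<close>, \<open>q\<close> are free to shrink.\<close>
      have "\<exists>e>0. \<forall>a b. near x e (Suc j) (a(j := 0)) (b(j := 1)) \<and> a j = p \<and> b j = q \<longrightarrow> P a b"
        if "0 \<le> p" "p \<le> q" "q \<le> 1" for p q :: real
      proof (rule Bolzano[where P="\<lambda>p q. \<exists>e>0. \<forall>a b. near x e (Suc j) (a(j := 0)) (b(j := 1)) \<and> a j = p \<and> b j = q \<longrightarrow> P a b", OF that(2)])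
        fix p r q :: real
        assume "p \<le> r" "r \<le> q"
          and "\<exists>e>0. \<forall>a b. near x e (Suc j) (a(j := 0)) (b(j := 1)) \<and> a j = p \<and> b j = r \<longrightarrow> P a b"
          and "\<exists>e>0. \<forall>a b. near x e (Suc j) (a(j := 0)) (b(j := 1)) \<and> a j = r \<and> b j = q \<longrightarrow> P a b"
        then obtain e1 e2 where e: "e1 > 0" "e2 > 0"
          "\<And>a b. near x e1 (Suc j) (a(j := 0)) (b(j := 1)) \<Longrightarrow> a j = p \<Longrightarrow> b j = r \<Longrightarrow> P a b"
          "\<And>a b. near x e2 (Suc j) (a(j := 0)) (b(j := 1)) \<Longrightarrow> a j = r \<Longrightarrow> b j = q \<Longrightarrow> P a b"
          by metis
        have mono: "near x e1 (Suc j) a b" "near x e2 (Suc j) a b" if "near x (min e1 e2) (Suc j) a b" for a b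
          using that near_mono[of "min e1 e2"] by auto
        have "P a b" if n: "near x (min e1 e2) (Suc j) (a(j := 0)) (b(j := 1))" and ab: "a j = p" "b j = q" for a b
        proof (rule glue[of j a b r])
          show "a i \<le> b i" if "i < m" for i
            using n that ab \<open>p \<le> r\<close> \<open>r \<le> q\<close> unfolding near_def by (cases "i = j") (auto split: if_splits)
          show "P a (b(j := r))" by (rule e(3)) (use mono(1)[OF n] ab in auto)
          show "P (a(j := r)) b" by (rule e(4)) (use mono(2)[OF n] ab in auto)
        qed (use Suc.prems ab \<open>p \<le> r\<close> \<open>r \<le> q\<close> in auto)
        then show "\<exists>e>0. \<forall>a b. near x e (Suc j) (a(j := 0)) (b(j := 1)) \<and> a j = p \<and> b j = q \<longrightarrow> P a b"
          using e(1,2) by (intro exI[of _ "min e1 e2"]) auto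
      next
        fix c :: real assume "p \<le> c" "c \<le> q"
        \<comment> \<open>A short interval around \<open>c\<close> falls under the hypothesis for
          \<open>j\<close>, applied at the point whose coordinate \<open>j\<close> is moved to
          \<open>c\<close>.\<close>
        obtain e where e: "e > 0" "\<And>a b. near (x(j := c)) e j a b \<Longrightarrow> P a b" using Suc by (meson Suc_leD)
        have "P a b" if n: "near x e (Suc j) (a(j := 0)) (b(j := 1))"
          and ab: "a j \<le> c" "c \<le> b j" "b j - a j < e" for a b
        proof (rule e(2))
          show "near (x(j := c)) e j a b" unfolding near_def
          proof (intro allI impI)
            fix i assume i: "i < m"
            show "if i < j then a i = 0 \<and> b i = 1
               else (x(j := c)) i - e \<le> a i \<and> a i \<le> (x(j := c)) i \<and> (x(j := c)) i \<le> b i \<and> b i \<le> (x(j := c)) i + e"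
              using n i ab unfolding near_def by (cases "i = j") (auto simp: less_Suc_eq split: if_splits)
          qed
        qed
        then show "\<exists>d>0. \<forall>p' q'. p' \<le> c \<and> c \<le> q' \<and> q' - p' < d \<longrightarrow>
           (\<exists>e>0. \<forall>a b. near x e (Suc j) (a(j := 0)) (b(j := 1)) \<and> a j = p' \<and> b j = q' \<longrightarrow> P a b)"
          using e(1) by blast
      qed
      from this[of 0 1] obtain e where "e > 0"
        "\<And>a b. near x e (Suc j) (a(j := 0)) (b(j := 1)) \<Longrightarrow> a j = 0 \<Longrightarrow> b j = 1 \<Longrightarrow> P a b" by auto
      moreover have "near x e (Suc j) (a(j := 0)) (b(j := 1)) \<and> a j = 0 \<and> b j = 1" if "near x e (Suc j) a b" for a b e
      proof -
        have "a j = 0" "b j = 1" using that Suc.prems unfolding near_def by auto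
        moreover from this have "a(j := 0) = a" "b(j := 1) = b" by auto
        ultimately show ?thesis using that by simp
      qed
      ultimately show "\<exists>e>0. \<forall>a b. near x e (Suc j) a b \<longrightarrow> P a b" by blast
    qed
  qed
  from this[of m] show ?thesis using a b by (auto simp: near_def)
qed

subsection \<open>The Milnor construction\<close>

definition weights :: "(nat \<Rightarrow> real) \<Rightarrow> bool" where
  "weights t \<longleftrightarrow> (\<forall>i. 0 \<le> t i) \<and> finite {i. t i \<noteq> 0} \<and> (\<Sum>i | t i \<noteq> 0. t i) = 1"

text \<open>Any finite set containing the support may carry the sum, which avoids determining the
  exact support of a new weight function.\<close>

lemma weights_iff:
  "weights t \<longleftrightarrow> (\<forall>i. 0 \<le> t i) \<and> (\<exists>J. finite J \<and> (\<forall>i. i \<notin> J \<longrightarrow> t i = 0) \<and> sum t J = 1)"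
proof -
  have "finite {i. t i \<noteq> 0} \<and> (\<Sum>i | t i \<noteq> 0. t i) = sum t J" if "finite J" "\<forall>i. i \<notin> J \<longrightarrow> t i = 0" for J
  proof
    have sub: "{i. t i \<noteq> 0} \<subseteq> J" using that by auto
    then show "finite {i. t i \<noteq> 0}" using that(1) finite_subset by blast
    show "(\<Sum>i | t i \<noteq> 0. t i) = sum t J" using that(1) sub by (intro sum.mono_neutral_left) auto
  qed
  then show ?thesis unfolding weights_def by (metis (mono_tags, lifting) mem_Collect_eq)
qed

lemma weights_le_1: "weights t \<Longrightarrow> t i \<le> 1"
  by (cases "t i = 0") (use member_le_sum[of i "{i. t i \<noteq> 0}" t] in \<open>auto simp: weights_def\<close>)

lemma weights_ex: "weights t \<Longrightarrow> \<exists>i. t i \<noteq> 0"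
  unfolding weights_def by (metis (mono_tags, lifting) empty_Collect_eq sum.empty zero_neq_one)

lemma weights_single: "weights (\<lambda>i. if i = N then 1 else 0)"
  unfolding weights_iff by (auto intro!: exI[of _ "{N}"])

lemma weights_convex:
  assumes "weights t" "weights t'" "0 \<le> s" "s \<le> 1"
  shows "weights (\<lambda>i. (1 - s) * t i + s * t' i)"
proof -
  obtain J where J: "finite J" "\<forall>i. i \<notin> J \<longrightarrow> t i = 0" "sum t J = 1" using assms(1) unfolding weights_iff by blast
  obtain J' where J': "finite J'" "\<forall>i. i \<notin> J' \<longrightarrow> t' i = 0" "sum t' J' = 1" using assms(2) unfolding weights_iff by blast
  have "sum t (J \<union> J') = sum t J" "sum t' (J \<union> J') = sum t' J'"
    using J J' by (intro sum.mono_neutral_right; auto)+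
  then have "(\<Sum>i\<in>J \<union> J'. (1 - s) * t i + s * t' i) = 1"
    using J(3) J'(3) by (simp add: sum.distrib flip: sum_distrib_left)
  then show ?thesis using assms J J' unfolding weights_iff by (intro conjI allI exI[of _ "J \<union> J'"]) auto
qed

text \<open>\<open>milnor_rel\<close> without the membership conditions, hence reflexive for all
  arguments.\<close>

definition same :: "'a milnor_seq \<Rightarrow> 'a milnor_seq \<Rightarrow> bool" where
  "same x y \<longleftrightarrow> fst x = fst y \<and> (\<forall>i. fst x i \<noteq> 0 \<longrightarrow> snd x i = snd y i)"

lemma same_refl [simp]: "same x x" and same_sym: "same x y \<Longrightarrow> same y x"
  and same_trans: "same x y \<Longrightarrow> same y z \<Longrightarrow> same x z"
  by (auto simp: same_def)

text \<open>A cutoff that vanishes at 0 and 1 and equals 1 on a neighbourhood of [1/4, 3/4]. With a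
  factor c in place of 4/5, vanishing at the ends needs c \<ge> 3/4, and a plateau reaching strictly
  beyond [1/4, 3/4] needs c < 1. The numbers 6/25 and 19/25 used below lie just outside this
  interval.\<close>

definition bump :: "real \<Rightarrow> real" where
  "bump x = 1 - smash (4/5 * (2 * x - 1)\<^sup>2)"

lemma bump_bounds: "0 \<le> bump x" "bump x \<le> 1"
  using smash_nonneg smash_le_1 by (auto simp: bump_def)

lemma bump_ends: "x = 0 \<or> x = 1 \<Longrightarrow> bump x = 0"
  by (auto simp: bump_def smash_eq_1)

lemma bump_eq_1: assumes "6/25 < x" "x < 19/25" shows "bump x = 1"
proof -
  have "\<bar>2 * x - 1\<bar> < 13/25" using assms by linarith
  then have "(2 * x - 1)\<^sup>2 < (13/25)\<^sup>2" by (metis abs_ge_zero power2_abs power_strict_mono pos2)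
  then have "4/5 * (2 * x - 1)\<^sup>2 \<le> 1/4" by (simp add: power2_eq_square)
  then show ?thesis by (simp add: bump_def smash_eq_0)
qed

lemma smooth_fun_bump:
  "openin (Euclidean_space n) U \<Longrightarrow> smooth_fun n U f \<Longrightarrow> smooth_fun n U (\<lambda>x. bump (f x))"
  unfolding bump_def
  by (intro smooth_fun_diff smooth_fun_smash smooth_fun_mult smooth_fun_power smooth_fun_const)

text \<open>Lifts are kept on open neighbourhoods of closed boxes, so that those over two boxes with
  a common face overlap in an open strip.\<close>

definition box_nbhd :: "nat \<Rightarrow> (nat \<Rightarrow> real) \<Rightarrow> (nat \<Rightarrow> real) \<Rightarrow> real \<Rightarrow> (nat \<Rightarrow> real) set" where
  "box_nbhd m a b e = {w \<in> Rn m. \<forall>i<m. a i - e < w i \<and> w i < b i + e}"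

lemma openin_box_nbhd: "openin (Euclidean_space m) (box_nbhd m a b e)"
proof -
  have "box_nbhd m a b e = {v \<in> Rn m. \<forall>i<m. \<bar>v i - (a i + b i) / 2\<bar> < (b i - a i) / 2 + e}"
    unfolding box_nbhd_def by (intro Collect_cong conj_cong refl all_cong) (auto simp: abs_less_iff field_simps)
  then show ?thesis using openin_Euclidean_space_box by simp
qed

lemma box_upd_upper:
  assumes "j < m" "c \<le> b j" shows "w \<in> box_nbhd m a (b(j := c)) e \<longleftrightarrow> w \<in> box_nbhd m a b e \<and> w j < c + e"
proof
  assume L: "w \<in> box_nbhd m a (b(j := c)) e"
  then have w: "a i - e < w i" "w i < (b(j := c)) i + e" if "i < m" for i using that by (auto simp: box_nbhd_def)
  have "w i < b i + e" if "i < m" for i using w(2)[OF that] assms by (cases "i = j") auto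
  then show "w \<in> box_nbhd m a b e \<and> w j < c + e" using L w w(2)[OF assms(1)] by (simp add: box_nbhd_def)
qed (auto simp: box_nbhd_def)

lemma box_upd_lower:
  assumes "j < m" "a j \<le> c" shows "w \<in> box_nbhd m (a(j := c)) b e \<longleftrightarrow> w \<in> box_nbhd m a b e \<and> c - e < w j"
proof
  assume L: "w \<in> box_nbhd m (a(j := c)) b e"
  then have w: "(a(j := c)) i - e < w i" "w i < b i + e" if "i < m" for i using that by (auto simp: box_nbhd_def)
  have "a i - e < w i" if "i < m" for i using w(1)[OF that] assms by (cases "i = j") auto
  then show "w \<in> box_nbhd m a b e \<and> c - e < w j" using L w w(1)[OF assms(1)] by (simp add: box_nbhd_def)
qed (auto simp: box_nbhd_def)

section \<open>Representatives in S_G, the group action and its orbits\<close>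

context diffeological_group begin

lemma plot_carrier: "plot X n U a \<Longrightarrow> u \<in> U \<Longrightarrow> a u \<in> carrier G"
  using plot_point points_eq_carrier by auto

lemma plot_mult:
  assumes "plot X n U a" "plot X n U b" shows "plot X n U (\<lambda>u. a u \<otimes> b u)"
proof -
  have "plot (prod_dspace X X) n U (\<lambda>u. (a u, b u))" using assms by (simp add: prod_dspace_def o_def)
  then show ?thesis using smooth_mult by (fastforce simp: dsmooth_def o_def)
qed

lemma plot_inv: "plot X n U a \<Longrightarrow> plot X n U (\<lambda>u. inv (a u))"
  using smooth_inv by (fastforce simp: dsmooth_def o_def)

abbreviation S :: "'a milnor_seq set" where "S \<equiv> points (milnor_S X)"

lemma milnor_S_iff: "x \<in> S \<longleftrightarrow> weights (fst x) \<and> (\<forall>i. snd x i \<in> carrier G)"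
proof -
  have "x \<in> S \<longleftrightarrow> (\<forall>i. fst x i \<in> {0..1}) \<and> weights (fst x) \<and> (\<forall>i. snd x i \<in> carrier G)"
    by (auto simp: milnor_S_def sub_dspace_def prod_dspace_def seq_dspace_def real_dspace_def
        points_eq_carrier weights_def split_def Pi_iff mem_Times_iff)
  then show ?thesis using weights_le_1 by (auto simp: weights_def)
qed

lemma diffeology_milnor_S: "diffeology (milnor_S X)"
  unfolding milnor_S_def
  by (intro diffeology_sub diffeology_prod diffeology_seq diffeology_real diffeology_axioms)

lemma plot_milnor_S_iff:
  "plot (milnor_S X) n U p \<longleftrightarrow> openin (Euclidean_space n) U \<and> (\<forall>i. smooth_fun n U (\<lambda>u. fst (p u) i)) \<and>
    (\<forall>i. plot X n U (\<lambda>u. snd (p u) i)) \<and> (\<forall>u\<in>U. p u \<in> S)" (is "?L \<longleftrightarrow> ?R")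
proof
  assume L: ?L
  with L have "\<forall>u\<in>U. p u \<in> S" using diffeology.plot_point[OF diffeology_milnor_S] by blast
  with L show ?R
    by (auto simp: milnor_S_def sub_dspace_def prod_dspace_def seq_dspace_def real_dspace_def o_def)
next
  assume R: ?R
  then have "p \<in> U \<rightarrow> {(t, g). finite {i. t i \<noteq> 0} \<and> (\<Sum>i | t i \<noteq> 0. t i) = 1}" "\<forall>i. \<forall>u\<in>U. 0 \<le> fst (p u) i \<and> fst (p u) i \<le> 1"
    using weights_le_1 by (auto simp: milnor_S_iff weights_def)
  with R show ?L
    by (auto simp: milnor_S_def sub_dspace_def prod_dspace_def seq_dspace_def real_dspace_def o_def Pi_iff)
qed

definition act :: "'a \<Rightarrow> 'a milnor_seq \<Rightarrow> 'a milnor_seq" where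
  "act h x = (fst x, \<lambda>i. snd x i \<otimes> inv h)"

text \<open>The point of BG under a representative in S_G; the two nested layers of classes then
  stay out of the later arguments.\<close>

definition orbit :: "'a milnor_seq \<Rightarrow> 'a milnor_seq set set" where
  "orbit x = orbit_rel G X `` {milnor_rel X `` {x}}"

lemma act_S: "x \<in> S \<Longrightarrow> h \<in> carrier G \<Longrightarrow> act h x \<in> S"
  by (simp add: milnor_S_iff act_def)

lemma act_one: "x \<in> S \<Longrightarrow> act \<one> x = x"
  by (cases x) (simp add: milnor_S_iff act_def)

lemma act_act: "x \<in> S \<Longrightarrow> h \<in> carrier G \<Longrightarrow> k \<in> carrier G \<Longrightarrow> act h (act k x) = act (h \<otimes> k) x"
  by (simp add: milnor_S_iff act_def inv_mult_group m_assoc)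

lemma same_act: "same x y \<Longrightarrow> same (act h x) (act h y)"
  by (simp add: same_def act_def)

lemma milnor_rel_iff: "(x, y) \<in> milnor_rel X \<longleftrightarrow> x \<in> S \<and> y \<in> S \<and> same x y"
  by (cases x; cases y) (auto simp: milnor_rel_def same_def)

lemma milnor_class_eq_iff:
  assumes "x \<in> S" "y \<in> S"
  shows "milnor_rel X `` {x} = milnor_rel X `` {y} \<longleftrightarrow> same x y"
proof -
  have c: "milnor_rel X `` {z} = {w \<in> S. same z w}" if "z \<in> S" for z
    using that by (auto simp: milnor_rel_iff)
  show ?thesis unfolding c[OF assms(1)] c[OF assms(2)]
    using assms same_refl same_sym same_trans by blast
qed

lemma milnor_E_points: "points (milnor_E X) = (\<lambda>x. milnor_rel X `` {x}) ` S"
  by (auto simp: milnor_E_def quotient_dspace_def quotient_def)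

lemma milnor_action_class:
  assumes x: "x \<in> S" and h: "h \<in> carrier G"
  shows "milnor_action G X h (milnor_rel X `` {x}) = milnor_rel X `` {act h x}"
proof -
  have a: "(\<lambda>(t, g). (t, \<lambda>i. g i \<otimes> inv h)) = act h" by (auto simp: act_def fun_eq_iff)
  have "same (act h x) z \<longleftrightarrow> (\<exists>y. y \<in> S \<and> same x y \<and> same (act h y) z)" for z
    using x same_refl same_act same_trans by blast
  then have "(\<exists>y. (x, y) \<in> milnor_rel X \<and> (act h y, z) \<in> milnor_rel X) \<longleftrightarrow> (act h x, z) \<in> milnor_rel X" for z
    unfolding milnor_rel_iff using x act_S[OF _ h] by blast
  moreover have "z \<in> milnor_action G X h (milnor_rel X `` {x}) \<longleftrightarrow>
     (\<exists>y. (x, y) \<in> milnor_rel X \<and> (act h y, z) \<in> milnor_rel X)" for z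
    unfolding milnor_action_def a by blast
  ultimately show ?thesis by blast
qed

lemma orbit_eq:
  assumes x: "x \<in> S" shows "orbit x = {milnor_rel X `` {act h x} | h. h \<in> carrier G}"
proof -
  have "milnor_rel X `` {x} \<in> points (milnor_E X)" using x by (auto simp: milnor_E_points)
  moreover have "milnor_rel X `` {act h x} \<in> points (milnor_E X)" if "h \<in> carrier G" for h
    using act_S[OF x that] by (auto simp: milnor_E_points)
  ultimately show ?thesis using milnor_action_class[OF x]
    by (auto simp: orbit_def orbit_rel_def)
qed

lemma orbit_act:
  assumes x: "x \<in> S" and h: "h \<in> carrier G" shows "orbit (act h x) = orbit x"
proof -
  have "c \<in> orbit (act h x) \<longleftrightarrow> c \<in> orbit x" for c
  proof
    assume "c \<in> orbit (act h x)"
    then obtain k where "k \<in> carrier G" "c = milnor_rel X `` {act k (act h x)}"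
      using orbit_eq[OF act_S[OF x h]] by blast
    then show "c \<in> orbit x" using act_act[OF x _ h] h orbit_eq[OF x] by auto
  next
    assume "c \<in> orbit x"
    then obtain k where k: "k \<in> carrier G" "c = milnor_rel X `` {act k x}" using orbit_eq[OF x] by blast
    then have "act k x = act (k \<otimes> inv h) (act h x)" using act_act[OF x _ h, of "k \<otimes> inv h"] h by (simp add: m_assoc)
    then show "c \<in> orbit (act h x)" using k h orbit_eq[OF act_S[OF x h]] by auto
  qed
  then show ?thesis by blast
qed

lemma orbit_same: "x \<in> S \<Longrightarrow> y \<in> S \<Longrightarrow> same x y \<Longrightarrow> orbit x = orbit y"
  using milnor_class_eq_iff[of x y] by (simp add: orbit_def)

lemma orbit_eqD:
  assumes x: "x \<in> S" and y: "y \<in> S" and xy: "orbit x = orbit y"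
  obtains h where "h \<in> carrier G" "same (act h x) y"
proof -
  have "milnor_rel X `` {act \<one> y} \<in> orbit y" using orbit_eq[OF y] by blast
  then have "milnor_rel X `` {y} \<in> orbit x" using xy act_one[OF y] by simp
  then obtain h where h: "h \<in> carrier G" "milnor_rel X `` {y} = milnor_rel X `` {act h x}"
    using orbit_eq[OF x] by blast
  then have "same (act h x) y" using milnor_class_eq_iff[OF act_S[OF x h(1)] y] by simp
  then show thesis using that h(1) by blast
qed

text \<open>Freeness of the action: some weight of \<open>x\<close> is nonzero, and at that index
  the group components can be compared.\<close>

lemma same_act_unique:
  assumes "x \<in> S" "h \<in> carrier G" "k \<in> carrier G" "same (act h x) y" "same (act k x) y"
  shows "h = k"
proof -
  obtain i where i: "fst x i \<noteq> 0" using assms(1) weights_ex by (auto simp: milnor_S_iff)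
  then have "snd x i \<otimes> inv h = snd x i \<otimes> inv k" using assms(4,5) by (simp add: same_def act_def)
  moreover have "snd x i \<in> carrier G" using assms(1) by (simp add: milnor_S_iff)
  ultimately have "inv h = inv k" using assms(2,3) by simp
  then show ?thesis using assms(2,3) inv_inv by metis
qed

text \<open>
  Maps to \<open>EG\<close> are represented by maps to \<open>S\<^sub>G\<close>; near every point the group components are
  required to agree with plots only where the corresponding weight does not vanish.
\<close>

definition eplot :: "nat \<Rightarrow> (nat \<Rightarrow> real) set \<Rightarrow> ((nat \<Rightarrow> real) \<Rightarrow> 'a milnor_seq) \<Rightarrow> bool" where
  "eplot n U F \<longleftrightarrow> openin (Euclidean_space n) U \<and> (\<forall>u\<in>U. F u \<in> S) \<and>
     (\<forall>u\<in>U. \<exists>V q. openin (Euclidean_space n) V \<and> u \<in> V \<and> plot (milnor_S X) n V q \<and>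
        (\<forall>v\<in>V \<inter> U. same (F v) (q v)))"

lemma eplot_open: "eplot n U F \<Longrightarrow> openin (Euclidean_space n) U" by (simp add: eplot_def)

lemma eplot_S: "eplot n U F \<Longrightarrow> u \<in> U \<Longrightarrow> F u \<in> S" by (simp add: eplot_def)

lemma eplot_local_plot:
  assumes "eplot n U F" "u \<in> U"
  obtains V q where "openin (Euclidean_space n) V" "u \<in> V" "V \<subseteq> U" "plot (milnor_S X) n V q"
    "\<And>v. v \<in> V \<Longrightarrow> same (F v) (q v)"
proof -
  obtain V q where V: "openin (Euclidean_space n) V" "u \<in> V" "plot (milnor_S X) n V q" "\<forall>v\<in>V \<inter> U. same (F v) (q v)"
    using assms by (auto simp: eplot_def)
  have o: "openin (Euclidean_space n) (V \<inter> U)" using V(1) eplot_open[OF assms(1)] by auto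
  show thesis
    by (rule that[OF o _ _ diffeology.plot_restrict[OF diffeology_milnor_S V(3) o]]) (use V assms in auto)
qed

lemma eplot_smooth_weight:
  assumes "eplot n U F" shows "smooth_fun n U (\<lambda>u. fst (F u) i)"
proof (rule smooth_fun_local[OF eplot_open[OF assms]])
  fix u assume "u \<in> U"
  then obtain V q where V: "openin (Euclidean_space n) V" "u \<in> V" "plot (milnor_S X) n V q" "\<And>v. v \<in> V \<Longrightarrow> same (F v) (q v)"
    using eplot_local_plot[OF assms] by metis
  then have "smooth_fun n V (\<lambda>u. fst (q u) i)" by (simp add: plot_milnor_S_iff)
  then have "smooth_fun n V (\<lambda>u. fst (F u) i)"
    by (rule smooth_fun_cong[OF V(1), THEN iffD1, rotated]) (use V(4) in \<open>auto simp: same_def\<close>)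
  then show "\<exists>V. openin (Euclidean_space n) V \<and> u \<in> V \<and> smooth_fun n V (\<lambda>u. fst (F u) i)" using V by blast
qed

lemma eplot_local:
  assumes "openin (Euclidean_space n) U" "\<And>u. u \<in> U \<Longrightarrow> F u \<in> S"
    and "\<And>u. u \<in> U \<Longrightarrow> \<exists>V F'. eplot n V F' \<and> u \<in> V \<and> (\<forall>v\<in>V \<inter> U. same (F v) (F' v))"
  shows "eplot n U F"
  unfolding eplot_def
proof (intro conjI assms(1) ballI assms(2))
  fix u assume u: "u \<in> U"
  then obtain V F' where V: "eplot n V F'" "u \<in> V" "\<forall>v\<in>V \<inter> U. same (F v) (F' v)" using assms(3) by blast
  obtain W q where W: "openin (Euclidean_space n) W" "u \<in> W" "W \<subseteq> V" "plot (milnor_S X) n W q" "\<And>v. v \<in> W \<Longrightarrow> same (F' v) (q v)"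
    using eplot_local_plot[OF V(1,2)] by metis
  then show "\<exists>V q. openin (Euclidean_space n) V \<and> u \<in> V \<and> plot (milnor_S X) n V q \<and> (\<forall>v\<in>V \<inter> U. same (F v) (q v))"
    using V(3) same_trans by (intro exI[of _ W] exI[of _ q]) blast
qed

lemma plot_imp_eplot: "plot (milnor_S X) n U q \<Longrightarrow> eplot n U q"
  using same_refl unfolding eplot_def by (metis plot_milnor_S_iff)

lemma eplot_const: "openin (Euclidean_space n) U \<Longrightarrow> x \<in> S \<Longrightarrow> eplot n U (\<lambda>_. x)"
  by (rule plot_imp_eplot)
     (auto simp: plot_milnor_S_iff smooth_fun_const milnor_S_iff points_eq_carrier intro: plot_const)

lemma eplot_subst:
  assumes F: "eplot n U F" and V: "openin (Euclidean_space m) V" and f: "\<And>v. v \<in> V \<Longrightarrow> f v \<in> U"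
    "\<And>j. j < n \<Longrightarrow> smooth_fun m V (\<lambda>v. f v j)"
  shows "eplot m V (\<lambda>v. F (f v))"
proof (rule eplot_local[OF V eplot_S[OF F f(1)]])
  fix v assume v: "v \<in> V"
  obtain W q where W: "openin (Euclidean_space n) W" "f v \<in> W" "W \<subseteq> U" "plot (milnor_S X) n W q" "\<And>v. v \<in> W \<Longrightarrow> same (F v) (q v)"
    using eplot_local_plot[OF F f(1)[OF v]] by metis
  let ?W = "{v \<in> V. f v \<in> W}"
  have o: "openin (Euclidean_space m) ?W"
    using f openin_subset[OF eplot_open[OF F]] by (intro openin_smooth_preimage[OF V W(1)]) auto
  have "plot (milnor_S X) m ?W (\<lambda>v. q (f v))"
    by (rule diffeology.plot_subst[OF diffeology_milnor_S W(4) o]) (use f smooth_fun_subset[OF V o] in auto)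
  then have "eplot m ?W (\<lambda>v. q (f v))" by (rule plot_imp_eplot)
  then show "\<exists>V' F'. eplot m V' F' \<and> v \<in> V' \<and> (\<forall>x\<in>V' \<inter> V. same (F (f x)) (F' x))"
    using W(2,5) v by (intro exI[of _ ?W] exI[of _ "\<lambda>v. q (f v)"]) auto
qed

lemma eplot_restrict: "eplot n U F \<Longrightarrow> openin (Euclidean_space n) V \<Longrightarrow> V \<subseteq> U \<Longrightarrow> eplot n V F"
  using eplot_subst[of n U F n V "\<lambda>v. v"] by (auto intro: smooth_fun_coordinate)

lemma eplot_act:
  assumes F: "eplot n U F" and d: "plot X n U d"
  shows "eplot n U (\<lambda>u. act (d u) (F u))"
proof (rule eplot_local[OF eplot_open[OF F]])
  show "u \<in> U \<Longrightarrow> act (d u) (F u) \<in> S" for u using act_S eplot_S[OF F] plot_carrier[OF d] by blast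
  fix u assume "u \<in> U"
  then obtain W q where W: "openin (Euclidean_space n) W" "u \<in> W" "W \<subseteq> U" "plot (milnor_S X) n W q" "\<And>v. v \<in> W \<Longrightarrow> same (F v) (q v)"
    using eplot_local_plot[OF F] by metis
  have dW: "plot X n W d" by (rule plot_restrict[OF d W(1,3)])
  have "plot (milnor_S X) n W (\<lambda>u. act (d u) (q u))"
    using W(4) plot_mult[OF _ plot_inv[OF dW]] act_S plot_carrier[OF dW] unfolding plot_milnor_S_iff
    by (auto simp: act_def)
  then have "eplot n W (\<lambda>u. act (d u) (q u))" by (rule plot_imp_eplot)
  then show "\<exists>V F'. eplot n V F' \<and> u \<in> V \<and> (\<forall>v\<in>V \<inter> U. same (act (d v) (F v)) (F' v))"
    using W(2,5) same_act by blast
qed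

section \<open>Lifts of plots of BG and their modifications\<close>

lemma eplot_imp_plot_B:
  assumes "eplot n U F" shows "plot (milnor_B G X) n U (\<lambda>u. orbit (F u))"
proof -
  have "\<exists>V p. openin (Euclidean_space n) V \<and> u \<in> V \<and> V \<subseteq> U \<and> plot (milnor_E X) n V p \<and>
      (\<forall>v\<in>V. orbit (F v) = orbit_rel G X `` {p v})" if u: "u \<in> U" for u
  proof -
    obtain V q where V: "openin (Euclidean_space n) V" "u \<in> V" "V \<subseteq> U" "plot (milnor_S X) n V q" "\<And>v. v \<in> V \<Longrightarrow> same (F v) (q v)"
      using eplot_local_plot[OF assms u] by metis
    have "plot (milnor_E X) n V (\<lambda>v. milnor_rel X `` {q v})"
      using V(1,4) by (auto simp: milnor_E_def quotient_dspace_def)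
    moreover have "orbit (F v) = orbit_rel G X `` {milnor_rel X `` {q v}}" if "v \<in> V" for v
    proof -
      have "q v \<in> S" using V(4) that by (simp add: plot_milnor_S_iff)
      then show ?thesis using orbit_same[OF eplot_S[OF assms] _ V(5)] that V(3) by (auto simp: orbit_def)
    qed
    ultimately show ?thesis using V(1-3) by (intro exI[of _ V] exI[of _ "\<lambda>v. milnor_rel X `` {q v}"]) simp
  qed
  then show ?thesis using eplot_open[OF assms] by (simp add: milnor_B_def quotient_dspace_def)
qed

text \<open>By the definition of the two quotient diffeologies, a plot of BG is locally represented
  in EG, and this representative is locally represented in S_G.\<close>

lemma plot_B_local_lift:
  assumes "plot (milnor_B G X) n U f" "u \<in> U"
  obtains V F where "u \<in> V" "V \<subseteq> U" "eplot n V F" "\<And>v. v \<in> V \<Longrightarrow> f v = orbit (F v)"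
proof -
  obtain V p where V: "u \<in> V" "V \<subseteq> U" "plot (milnor_E X) n V p" "\<And>v. v \<in> V \<Longrightarrow> f v = orbit_rel G X `` {p v}"
    using quotient_plotD[OF assms(1)[unfolded milnor_B_def] assms(2)] by metis
  obtain W q where W: "u \<in> W" "W \<subseteq> V" "plot (milnor_S X) n W q" "\<And>v. v \<in> W \<Longrightarrow> p v = milnor_rel X `` {q v}"
    using quotient_plotD[OF V(3)[unfolded milnor_E_def] V(1)] by metis
  show thesis
    by (rule that[OF W(1) _ plot_imp_eplot[OF W(3)]]) (use V W in \<open>auto simp: orbit_def subset_iff\<close>)
qed

lemma diffeology_milnor_B: "diffeology (milnor_B G X)"
  unfolding milnor_B_def milnor_E_def by (intro diffeology_quotient diffeology_milnor_S)

text \<open>The value \<open>d u\<close> is chosen pointwise. It is smooth because near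
  \<open>u\<close> some index \<open>i\<close> keeps a nonzero weight; as \<open>h\<close> acts by
  right multiplication with \<open>inv h\<close>, comparing the components \<open>g\<close> of
  \<open>F\<close> and \<open>g'\<close> of \<open>F'\<close> at \<open>i\<close> forces
  \<open>d\<close> to be \<open>inv g' \<otimes> g\<close>.\<close>

lemma lift_difference:
  assumes F: "eplot n U F" and F': "eplot n U F'" and eq: "\<And>u. u \<in> U \<Longrightarrow> orbit (F u) = orbit (F' u)"
  obtains d where "plot X n U d" "\<And>u. u \<in> U \<Longrightarrow> same (act (d u) (F u)) (F' u)"
proof -
  have "\<exists>h. h \<in> carrier G \<and> same (act h (F u)) (F' u)" if "u \<in> U" for u
    using orbit_eqD[OF eplot_S[OF F that] eplot_S[OF F' that] eq[OF that]] by metis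
  then obtain d where d: "\<And>u. u \<in> U \<Longrightarrow> d u \<in> carrier G" "\<And>u. u \<in> U \<Longrightarrow> same (act (d u) (F u)) (F' u)"
    by metis
  have "plot X n U d"
  proof (rule plot_localI[OF eplot_open[OF F]])
    fix u assume u: "u \<in> U"
    obtain i where i: "fst (F u) i \<noteq> 0" using eplot_S[OF F u] weights_ex by (auto simp: milnor_S_iff)
    obtain V q where V: "openin (Euclidean_space n) V" "u \<in> V" "V \<subseteq> U" "plot (milnor_S X) n V q" "\<And>v. v \<in> V \<Longrightarrow> same (F v) (q v)"
      using eplot_local_plot[OF F u] by metis
    obtain V' q' where V': "openin (Euclidean_space n) V'" "u \<in> V'" "V' \<subseteq> U" "plot (milnor_S X) n V' q'" "\<And>v. v \<in> V' \<Longrightarrow> same (F' v) (q' v)"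
      using eplot_local_plot[OF F' u] by metis
    let ?W = "{w \<in> U. fst (F w) i \<in> -{0}} \<inter> (V \<inter> V')"
    have W: "openin (Euclidean_space n) ?W"
      by (intro openin_Int V(1) V'(1) smooth_fun_preimage_open[OF eplot_open[OF F] eplot_smooth_weight[OF F]]) auto
    have "plot X n V (\<lambda>w. snd (q w) i)" "plot X n V' (\<lambda>w. snd (q' w) i)"
      using V(4) V'(4) by (simp_all add: plot_milnor_S_iff)
    moreover have "?W \<subseteq> V" "?W \<subseteq> V'" by auto
    ultimately have "plot X n ?W (\<lambda>w. snd (q w) i)" "plot X n ?W (\<lambda>w. snd (q' w) i)"
      using plot_restrict[OF _ W] by blast+
    then have "plot X n ?W (\<lambda>w. inv (snd (q' w) i) \<otimes> snd (q w) i)" by (intro plot_mult plot_inv)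
    moreover have "d w = inv (snd (q' w) i) \<otimes> snd (q w) i" if w: "w \<in> ?W" for w
    proof -
      have qS: "snd (q w) i \<in> carrier G" "snd (q' w) i \<in> carrier G"
        using V(4) V'(4) w by (auto simp: plot_milnor_S_iff milnor_S_iff)
      have dw: "d w \<in> carrier G" using d(1) w by auto
      have "same (act (d w) (q w)) (q' w)"
      proof -
        have "same (q w) (F w)" "same (F' w) (q' w)" "same (act (d w) (F w)) (F' w)"
          using V(5)[of w] V'(5)[of w] d(2)[of w] w by (auto intro: same_sym)
        then show ?thesis by (meson same_act same_trans)
      qed
      moreover have "fst (q w) i \<noteq> 0" using V(5)[of w] w by (auto simp: same_def)
      ultimately have "snd (q' w) i = snd (q w) i \<otimes> inv (d w)" by (simp add: same_def act_def)
      then show ?thesis using qS dw by (simp add: inv_mult_group m_assoc)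
    qed
    ultimately show "\<exists>V q. openin (Euclidean_space n) V \<and> u \<in> V \<and> plot X n V q \<and> (\<forall>v\<in>V \<inter> U. d v = q v)"
      using W u i V(2) V'(2) by (intro exI[of _ ?W] exI[of _ "\<lambda>w. inv (snd (q' w) i) \<otimes> snd (q w) i"]) auto
  qed
  then show thesis using that d by blast
qed

text \<open>The group components are controlled only where the old weight is nonzero, so new weights
  are admissible as long as their support does not grow.\<close>

lemma eplot_reweight:
  assumes F: "eplot n U F" and \<theta>: "\<And>i. smooth_fun n U (\<lambda>u. \<theta> u i)" "\<And>u. u \<in> U \<Longrightarrow> weights (\<theta> u)"
    and supp: "\<And>u i. u \<in> U \<Longrightarrow> \<theta> u i \<noteq> 0 \<Longrightarrow> fst (F u) i \<noteq> 0"
  shows "eplot n U (\<lambda>u. (\<theta> u, snd (F u)))"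
proof (rule eplot_local[OF eplot_open[OF F]])
  show "u \<in> U \<Longrightarrow> (\<theta> u, snd (F u)) \<in> S" for u using eplot_S[OF F] \<theta>(2) by (auto simp: milnor_S_iff)
  fix u assume "u \<in> U"
  then obtain V q where V: "openin (Euclidean_space n) V" "u \<in> V" "V \<subseteq> U" "plot (milnor_S X) n V q" "\<And>v. v \<in> V \<Longrightarrow> same (F v) (q v)"
    using eplot_local_plot[OF F] by metis
  have "plot (milnor_S X) n V (\<lambda>v. (\<theta> v, snd (q v)))"
    using V \<theta> smooth_fun_subset[OF eplot_open[OF F] V(1,3)] unfolding plot_milnor_S_iff milnor_S_iff by auto
  then have "eplot n V (\<lambda>v. (\<theta> v, snd (q v)))" by (rule plot_imp_eplot)
  moreover have "same (\<theta> v, snd (F v)) (\<theta> v, snd (q v))" if "v \<in> V" for v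
    using V(5)[OF that] supp[of v] V(3) that by (auto simp: same_def)
  ultimately show "\<exists>V F'. eplot n V F' \<and> u \<in> V \<and> (\<forall>v\<in>V \<inter> U. same (\<theta> v, snd (F v)) (F' v))"
    using V(2) by blast
qed

text \<open>The segment from \<open>x\<close> to the vertex of the join with index \<open>N\<close>
  and group component 1. Overwriting component \<open>N\<close> is invisible at \<open>s = 0\<close>
  if the weight of \<open>x\<close> there vanishes.\<close>

definition join_vertex :: "nat \<Rightarrow> real \<Rightarrow> 'a milnor_seq \<Rightarrow> 'a milnor_seq" where
  "join_vertex N s x = (\<lambda>i. (1 - s) * fst x i + s * (if i = N then 1 else 0), (snd x)(N := \<one>))"

lemma join_S: "x \<in> S \<Longrightarrow> 0 \<le> s \<Longrightarrow> s \<le> 1 \<Longrightarrow> join_vertex N s x \<in> S"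
  using weights_convex[OF _ weights_single] by (auto simp: milnor_S_iff join_vertex_def)

lemma join_0: "fst x N = 0 \<Longrightarrow> same (join_vertex N 0 x) x"
  by (auto simp: join_vertex_def same_def)

text \<open>All segments end in the same vertex, and at the vertex a discontinuity in the other
  components becomes invisible.\<close>

lemma join_1: "same (join_vertex N 1 x) (join_vertex N 1 y)"
  by (auto simp: join_vertex_def same_def)

lemma same_join: "same x y \<Longrightarrow> same (join_vertex N s x) (join_vertex N s y)"
  by (auto simp: join_vertex_def same_def)

lemma eplot_join:
  assumes F: "eplot n U F" and N: "\<And>u. u \<in> U \<Longrightarrow> fst (F u) N = 0"
    and \<mu>: "smooth_fun n U \<mu>" "\<And>u. u \<in> U \<Longrightarrow> 0 \<le> \<mu> u" "\<And>u. u \<in> U \<Longrightarrow> \<mu> u \<le> 1"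
  shows "eplot n U (\<lambda>u. join_vertex N (\<mu> u) (F u))"
proof (rule eplot_local[OF eplot_open[OF F]])
  show "u \<in> U \<Longrightarrow> join_vertex N (\<mu> u) (F u) \<in> S" for u using eplot_S[OF F] \<mu> join_S by blast
  fix u assume "u \<in> U"
  then obtain V q where V: "openin (Euclidean_space n) V" "u \<in> V" "V \<subseteq> U" "plot (milnor_S X) n V q" "\<And>v. v \<in> V \<Longrightarrow> same (F v) (q v)"
    using eplot_local_plot[OF F] by metis
  have "plot (milnor_S X) n V (\<lambda>v. join_vertex N (\<mu> v) (q v))"
    unfolding plot_milnor_S_iff
  proof (intro conjI allI ballI V(1))
    show "v \<in> V \<Longrightarrow> join_vertex N (\<mu> v) (q v) \<in> S" for v
      using V(3,4) \<mu>(2,3) by (intro join_S) (auto simp: plot_milnor_S_iff)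
    have "smooth_fun n V \<mu>" by (rule smooth_fun_subset[OF eplot_open[OF F] V(1,3) \<mu>(1)])
    then show "smooth_fun n V (\<lambda>v. fst (join_vertex N (\<mu> v) (q v)) i)" for i
      using V(4) unfolding join_vertex_def plot_milnor_S_iff fst_conv
      by (intro smooth_fun_add smooth_fun_mult smooth_fun_diff smooth_fun_const V(1)) auto
    show "plot X n V (\<lambda>v. snd (join_vertex N (\<mu> v) (q v)) i)" for i
      using V(1,4) plot_const[OF V(1), of \<one>] by (cases "i = N") (auto simp: join_vertex_def plot_milnor_S_iff points_eq_carrier)
  qed
  then have "eplot n V (\<lambda>v. join_vertex N (\<mu> v) (q v))" by (rule plot_imp_eplot)
  then show "\<exists>V F'. eplot n V F' \<and> u \<in> V \<and> (\<forall>v\<in>V \<inter> U. same (join_vertex N (\<mu> v) (F v)) (F' v))"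
    using V(2,5) same_join by blast
qed

end

subsection \<open>Lifting cubes\<close>

context diffeological_group begin

lemma smooth_fun_bump_prod:
  "smooth_fun m (Rn m) (\<lambda>w. \<Prod>i\<in>I. bump (w i))"
  by (intro smooth_fun_prod smooth_fun_bump smooth_fun_coordinate openin_Rn)

lemma bump_prod_bounds: "0 \<le> (\<Prod>i\<in>I. bump (w i))" "(\<Prod>i\<in>I. bump (w i)) \<le> 1"
  using bump_bounds by (auto intro: prod_nonneg prod_le_1)

text \<open>The jump from \<open>F1\<close> to \<open>F2\<close> at \<open>w j = 1/2\<close> does no
  harm. Near such a point either some coordinate in \<open>I\<close> lies in a collar, where both
  maps represent the same point, or all coordinates lie on the plateau of \<open>bump\<close>, where
  the join is the constant vertex.\<close>

lemma eplot_join_halves: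
  assumes F1: "eplot m (Rn m) F1" and F2: "eplot m (Rn m) F2" and I: "finite I"
    and N: "\<And>w. w \<in> Rn m \<Longrightarrow> fst (F1 w) N = 0" "\<And>w. w \<in> Rn m \<Longrightarrow> fst (F2 w) N = 0"
    and agree: "\<And>w i. w \<in> Rn m \<Longrightarrow> i \<in> I \<Longrightarrow> w i < 1/4 \<or> 3/4 < w i \<Longrightarrow> same (F1 w) (F2 w)"
  shows "eplot m (Rn m) (\<lambda>w. join_vertex N (\<Prod>i\<in>insert j I. bump (w i)) (if w j < 1/2 then F1 w else F2 w))"
proof (rule eplot_local[OF openin_Rn])
  define \<mu> where "\<mu> w = (\<Prod>i\<in>insert j I. bump (w i))" for w :: "nat \<Rightarrow> real"
  have \<mu>: "0 \<le> \<mu> w" "\<mu> w \<le> 1" for w using bump_prod_bounds by (auto simp: \<mu>_def)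
  have E: "eplot m (Rn m) (\<lambda>w. join_vertex N (\<mu> w) (F1 w))" "eplot m (Rn m) (\<lambda>w. join_vertex N (\<mu> w) (F2 w))"
    using smooth_fun_bump_prod[of m "insert j I", folded \<mu>_def] \<mu>
    by (intro eplot_join F1 F2 N; simp)+
  show "w \<in> Rn m \<Longrightarrow> join_vertex N (\<Prod>i\<in>insert j I. bump (w i)) (if w j < 1/2 then F1 w else F2 w) \<in> S" for w
    using bump_prod_bounds eplot_S[OF F1] eplot_S[OF F2] by (intro join_S) auto
  fix u assume u: "u \<in> Rn m"
  consider "u j < 1/2" | "u j > 1/2" | i where "u j = 1/2" "i \<in> I" "u i < 1/4 \<or> 3/4 < u i"
    | "u j = 1/2" "\<forall>i\<in>insert j I. 1/4 \<le> u i \<and> u i \<le> 3/4" by fastforce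
  then have "\<exists>V F'. eplot m V F' \<and> u \<in> V \<and> (\<forall>v\<in>V \<inter> Rn m.
      same (join_vertex N (\<mu> v) (if v j < 1/2 then F1 v else F2 v)) (F' v))" (is ?goal)
  proof cases
    case 1
    let ?V = "{w \<in> Rn m. w j \<in> {..<1/2}}"
    have "eplot m ?V (\<lambda>w. join_vertex N (\<mu> w) (F1 w))"
      by (rule eplot_restrict[OF E(1) openin_Euclidean_space_Int_coordinate[OF openin_Rn]]) auto
    then show ?goal
      using 1 u same_refl by (intro exI[of _ ?V] exI[of _ "\<lambda>w. join_vertex N (\<mu> w) (F1 w)"]) auto
  next
    case 2
    let ?V = "{w \<in> Rn m. w j \<in> {1/2<..}}"
    have "eplot m ?V (\<lambda>w. join_vertex N (\<mu> w) (F2 w))"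
      by (rule eplot_restrict[OF E(2) openin_Euclidean_space_Int_coordinate[OF openin_Rn]]) auto
    then show ?goal
      using 2 u same_refl by (intro exI[of _ ?V] exI[of _ "\<lambda>w. join_vertex N (\<mu> w) (F2 w)"]) auto
  next
    case 3
    let ?V = "{w \<in> Rn m. w i \<in> {..<1/4} \<union> {3/4<..}}"
    have "eplot m ?V (\<lambda>w. join_vertex N (\<mu> w) (F1 w))"
      by (rule eplot_restrict[OF E(1) openin_Euclidean_space_Int_coordinate[OF openin_Rn]]) auto
    moreover have "same (join_vertex N (\<mu> v) (if v j < 1/2 then F1 v else F2 v)) (join_vertex N (\<mu> v) (F1 v))" if "v \<in> ?V" for v
      using agree[OF _ 3(2), of v] that same_refl by (auto intro!: same_join intro: same_sym)
    ultimately show ?goal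
      using 3 u by (intro exI[of _ ?V] exI[of _ "\<lambda>w. join_vertex N (\<mu> w) (F1 w)"]) auto
  next
    case 4
    \<comment> \<open>The open plateau of \<open>bump\<close> contains the closed interval
      [1/4, 3/4] that the collars leave over.\<close>
    let ?V = "\<Inter>i\<in>insert j I. {w \<in> Rn m. w i \<in> {6/25<..<19/25}}"
    have "openin (Euclidean_space m) ?V"
      using I by (intro openin_INT2 openin_Euclidean_space_Int_coordinate[OF openin_Rn]) auto
    then have "eplot m ?V (\<lambda>_. join_vertex N 1 (F1 u))"
      by (rule eplot_const) (use join_S[OF eplot_S[OF F1 u]] in auto)
    moreover have "same (join_vertex N (\<mu> v) x) (join_vertex N 1 (F1 u))" if "v \<in> ?V" for v x
    proof -
      have "\<mu> v = 1" using that bump_eq_1 unfolding \<mu>_def by (intro prod.neutral) auto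
      then show ?thesis by (simp add: join_1)
    qed
    moreover have "u \<in> ?V" using u 4(2) by fastforce
    ultimately show ?goal
      by blast
  qed
  then show "\<exists>V F'. eplot m V F' \<and> u \<in> V \<and> (\<forall>v\<in>V \<inter> Rn m.
      same (join_vertex N (\<Prod>i\<in>insert j I. bump (v i)) (if v j < 1/2 then F1 v else F2 v)) (F' v))"
    by (simp only: \<mu>_def)
qed

text \<open>
  Two lifts over boxes with a common face in the hyperplane \<open>w j = c\<close> differ there by a smooth
  map \<open>d\<close> to the group. Composed with a smooth map into a neighbourhood of the face that is the identity near it, \<open>d\<close>
  extends to the second box and corrects the second lift.
\<close>

lemma lift_glue:
  assumes j: "j < m" and ac: "a j \<le> c" and cb: "c \<le> b j" and e: "e > 0"
    and F1: "eplot m (box_nbhd m a (b(j := c)) e) F1" "\<And>w. w \<in> box_nbhd m a (b(j := c)) e \<Longrightarrow> orbit (F1 w) = f w"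
    and F2: "eplot m (box_nbhd m (a(j := c)) b e) F2" "\<And>w. w \<in> box_nbhd m (a(j := c)) b e \<Longrightarrow> orbit (F2 w) = f w"
  shows "\<exists>F. eplot m (box_nbhd m a b e) F \<and> (\<forall>w\<in>box_nbhd m a b e. orbit (F w) = f w)"
proof -
  let ?B = "box_nbhd m a b e" and ?B1 = "box_nbhd m a (b(j := c)) e" and ?B2 = "box_nbhd m (a(j := c)) b e"
  have B1: "w \<in> ?B1 \<longleftrightarrow> w \<in> ?B \<and> w j < c + e" for w
    by (rule box_upd_upper[OF j, of c b, OF cb])
  have B2: "w \<in> ?B2 \<longleftrightarrow> w \<in> ?B \<and> c - e < w j" for w
    by (rule box_upd_lower[OF j, of a c, OF ac])
  have o: "openin (Euclidean_space m) (?B1 \<inter> ?B2)" by (intro openin_Int openin_box_nbhd)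
  obtain d where d: "plot X m (?B1 \<inter> ?B2) d" "\<And>u. u \<in> ?B1 \<inter> ?B2 \<Longrightarrow> same (act (d u) (F2 u)) (F1 u)"
    using lift_difference[OF eplot_restrict[OF F2(1) o] eplot_restrict[OF F1(1) o]] F1(2) F2(2) by auto
  \<comment> \<open>Within distance \<open>e/2\<close> of \<open>c\<close> the argument of
    \<open>smash\<close> is at most 1/4 and \<open>\<rho>\<close> is the identity. From distance
    \<open>e\<close> on it is at least 1 and \<open>\<rho>\<close> moves coordinate \<open>j\<close>
    to \<open>c\<close>. In between the distance to \<open>c\<close> does not grow.\<close>
  define \<rho> where "\<rho> w = w(j := c + (w j - c) * (1 - smash ((w j - c)\<^sup>2 / e\<^sup>2)))" for w :: "nat \<Rightarrow> real"
  have \<rho>_dist: "\<bar>\<rho> w j - c\<bar> < e" for w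
  proof (cases "\<bar>w j - c\<bar> < e")
    case True
    have "\<bar>w j - c\<bar> * (1 - smash ((w j - c)\<^sup>2 / e\<^sup>2)) \<le> \<bar>w j - c\<bar> * 1"
      using smash_nonneg by (intro mult_left_mono) auto
    then show ?thesis using True smash_le_1[of "(w j - c)\<^sup>2 / e\<^sup>2"] by (simp add: \<rho>_def abs_mult)
  next
    case False
    then have "e\<^sup>2 \<le> (w j - c)\<^sup>2" using e by (simp add: abs_le_square_iff[symmetric])
    then have "3/4 * e\<^sup>2 \<le> (w j - c)\<^sup>2" using zero_le_power2[of e] by linarith
    then have "3/4 \<le> (w j - c)\<^sup>2 / e\<^sup>2" using e by (simp add: pos_le_divide_eq)
    then show ?thesis using e by (simp add: \<rho>_def smash_eq_1)
  qed
  have \<rho>_near: "\<rho> w = w" if "\<bar>w j - c\<bar> < e/2" for w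
  proof -
    have "(w j - c)\<^sup>2 \<le> (e/2)\<^sup>2" using that e by (simp add: abs_le_square_iff[symmetric])
    then have "(w j - c)\<^sup>2 / e\<^sup>2 \<le> 1/4" using e by (simp add: field_simps)
    then show ?thesis by (simp add: \<rho>_def smash_eq_0)
  qed
  have \<rho>_in: "\<rho> w \<in> ?B1 \<inter> ?B2" if "w \<in> ?B" for w
  proof -
    have "\<rho> w i = w i" if "i \<noteq> j" for i using that by (simp add: \<rho>_def)
    then have "\<rho> w \<in> ?B" using \<rho>_dist[of w] that ac cb j unfolding box_nbhd_def
      by (auto simp: Rn_iff) (smt (verit))+
    then show ?thesis using \<rho>_dist[of w] B1 B2 by auto
  qed
  have d\<rho>: "plot X m ?B (\<lambda>w. d (\<rho> w))"
  proof (rule plot_subst[OF d(1) openin_box_nbhd \<rho>_in])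
    fix i
    have "smooth_fun m ?B (\<lambda>w. c + (w j - c) * (1 - smash ((w j - c)\<^sup>2 / e\<^sup>2)))"
      by (intro smooth_fun_add smooth_fun_mult smooth_fun_diff smooth_fun_smash smooth_fun_divide smooth_fun_power
          smooth_fun_const smooth_fun_coordinate openin_box_nbhd) (use e in auto)
    then show "smooth_fun m ?B (\<lambda>w. \<rho> w i)" unfolding \<rho>_def by (rule smooth_fun_upd[OF openin_box_nbhd])
  qed
  \<comment> \<open>For \<open>w j\<close> between \<open>c - e/2\<close> and \<open>c\<close> both
    branches represent the same point, since \<open>\<rho> w = w\<close> there and \<open>d\<close>
    carries \<open>F2\<close> to \<open>F1\<close>.\<close>
  define F where "F w = (if w j < c then F1 w else act (d (\<rho> w)) (F2 w))" for w
  have "eplot m ?B F"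
  proof (rule eplot_local[OF openin_box_nbhd])
    show "F w \<in> S" if "w \<in> ?B" for w
      using that e eplot_S[OF F1(1)] eplot_S[OF F2(1)] act_S plot_carrier[OF d\<rho> that] by (auto simp: F_def B1 B2)
    fix u assume u: "u \<in> ?B"
    show "\<exists>V F'. eplot m V F' \<and> u \<in> V \<and> (\<forall>v\<in>V \<inter> ?B. same (F v) (F' v))"
    proof (cases "u j < c")
      case True
      let ?V = "{w \<in> ?B. w j \<in> {..<c}}"
      have "eplot m ?V F1"
        by (rule eplot_restrict[OF F1(1) openin_Euclidean_space_Int_coordinate[OF openin_box_nbhd]]) (use e in \<open>auto simp: B1\<close>)
      then show ?thesis using u True same_refl by (intro exI[of _ ?V] exI[of _ F1]) (auto simp: F_def)
    next
      case False
      let ?V = "{w \<in> ?B. w j \<in> {c - e/2<..}}"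
      have V: "openin (Euclidean_space m) ?V" by (rule openin_Euclidean_space_Int_coordinate[OF openin_box_nbhd]) auto
      have "?V \<subseteq> ?B2" "?V \<subseteq> ?B" using e by (auto simp: B2)
      then have "eplot m ?V (\<lambda>w. act (d (\<rho> w)) (F2 w))"
        by (intro eplot_act eplot_restrict[OF F2(1) V] plot_restrict[OF d\<rho> V])
      moreover have "same (F v) (act (d (\<rho> v)) (F2 v))" if v: "v \<in> ?V" for v
      proof (cases "v j < c")
        case True
        then have "\<rho> v = v" using v by (intro \<rho>_near) auto
        moreover have "v \<in> ?B1 \<inter> ?B2" using v True e by (auto simp: B1 B2)
        ultimately show ?thesis using same_sym[OF d(2)[of v]] True by (simp add: F_def)
      qed (simp add: F_def same_refl)
      ultimately show ?thesis using u False e by (intro exI[of _ ?V] exI[of _ "\<lambda>w. act (d (\<rho> w)) (F2 w)"]) auto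
    qed
  qed
  moreover have "orbit (F w) = f w" if "w \<in> ?B" for w
  proof (cases "w j < c")
    case True then show ?thesis using that e F1(2)[of w] by (simp add: F_def B1)
  next
    case False
    then have "w \<in> ?B2" using that e by (simp add: B2)
    then show ?thesis using False F2(2) orbit_act[OF eplot_S[OF F2(1)] plot_carrier[OF d\<rho> that]] by (simp add: F_def)
  qed
  ultimately show ?thesis by blast
qed

lemma box_mono: "e \<le> e' \<Longrightarrow> box_nbhd m a b e \<subseteq> box_nbhd m a b e'"
  by (force simp: box_nbhd_def)

text \<open>Gluing over the subdivided cube lifts \<open>f\<close> on a neighbourhood of the unit
  cube only. \<open>smash_cube\<close> maps all of R^m into it, whence the reparametrisation in the
  conclusion.\<close>

lemma cube_lift:
  assumes f: "plot (milnor_B G X) m (Rn m) f"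
  shows "\<exists>F. eplot m (Rn m) F \<and> (\<forall>w\<in>Rn m. orbit (F w) = f (smash_cube m w))"
proof -
  define P where "P a b \<longleftrightarrow> (\<exists>e>0. \<exists>F. eplot m (box_nbhd m a b e) F \<and> (\<forall>w\<in>box_nbhd m a b e. orbit (F w) = f w))" for a b
  have "P (\<lambda>_. 0) (\<lambda>_. 1)"
  proof (rule cube_induct[of m P])
    fix a b :: "nat \<Rightarrow> real" and j c
    assume j: "j < m" and ac: "a j \<le> c" "c \<le> b j" and P: "P a (b(j := c))" "P (a(j := c)) b"
    obtain e1 F1 where 1: "e1 > 0" "eplot m (box_nbhd m a (b(j := c)) e1) F1" "\<forall>w\<in>box_nbhd m a (b(j := c)) e1. orbit (F1 w) = f w"
      using P(1) unfolding P_def by blast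
    obtain e2 F2 where 2: "e2 > 0" "eplot m (box_nbhd m (a(j := c)) b e2) F2" "\<forall>w\<in>box_nbhd m (a(j := c)) b e2. orbit (F2 w) = f w"
      using P(2) unfolding P_def by blast
    let ?e = "min e1 e2"
    have sub: "box_nbhd m a (b(j := c)) ?e \<subseteq> box_nbhd m a (b(j := c)) e1" "box_nbhd m (a(j := c)) b ?e \<subseteq> box_nbhd m (a(j := c)) b e2"
      by (intro box_mono; simp)+
    have "\<exists>F. eplot m (box_nbhd m a b ?e) F \<and> (\<forall>w\<in>box_nbhd m a b ?e. orbit (F w) = f w)"
      by (rule lift_glue[OF j ac _ eplot_restrict[OF 1(2) openin_box_nbhd sub(1)] _ eplot_restrict[OF 2(2) openin_box_nbhd sub(2)]])
         (use 1 2 sub in auto)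
    moreover have "?e > 0" using 1(1) 2(1) by simp
    ultimately show "P a b" unfolding P_def by blast
  next
    fix x :: "nat \<Rightarrow> real"
    obtain V F where V: "trunc m x \<in> V" "V \<subseteq> Rn m" "eplot m V F" "\<And>v. v \<in> V \<Longrightarrow> f v = orbit (F v)"
      using plot_B_local_lift[OF f trunc_Rn[of m x]] by metis
    obtain e where e: "e > 0" "\<And>v. v \<in> Rn m \<Longrightarrow> (\<And>i. i < m \<Longrightarrow> \<bar>v i - trunc m x i\<bar> < e) \<Longrightarrow> v \<in> V"
      using openin_Euclidean_spaceD[OF eplot_open[OF V(3)] V(1)] by metis
    \<comment> \<open>One half of \<open>e\<close> is spent on the size of the box, the other on its
      neighbourhood.\<close>
    have "P a b" if ab: "\<forall>i<m. x i - e/2 \<le> a i \<and> a i \<le> x i \<and> x i \<le> b i \<and> b i \<le> x i + e/2" for a b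
    proof -
      have "box_nbhd m a b (e/2) \<subseteq> V"
      proof
        fix v assume v: "v \<in> box_nbhd m a b (e/2)"
        show "v \<in> V"
        proof (rule e(2))
          show "v \<in> Rn m" using v by (simp add: box_nbhd_def)
          fix i assume i: "i < m"
          then have "a i - e/2 < v i" "v i < b i + e/2" using v by (auto simp: box_nbhd_def)
          moreover have "x i - e/2 \<le> a i" "b i \<le> x i + e/2" using ab i by auto
          ultimately have "\<bar>v i - x i\<bar> < e" by linarith
          then show "\<bar>v i - trunc m x i\<bar> < e" using i by (simp add: trunc_def)
        qed
      qed
      then show ?thesis unfolding P_def using eplot_restrict[OF V(3) openin_box_nbhd] V(4) e(1)
        by (intro exI[of _ "e/2"]) (auto intro!: exI[of _ F])
    qed
    then show "\<exists>e>0. \<forall>a b. (\<forall>i<m. x i - e \<le> a i \<and> a i \<le> x i \<and> x i \<le> b i \<and> b i \<le> x i + e) \<longrightarrow> P a b"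
      using e(1) by (intro exI[of _ "e/2"]) auto
  qed auto
  then obtain e F where e: "e > 0" and F: "eplot m (box_nbhd m (\<lambda>_. 0) (\<lambda>_. 1) e) F" "\<forall>w\<in>box_nbhd m (\<lambda>_. 0) (\<lambda>_. 1) e. orbit (F w) = f w"
    unfolding P_def by blast
  have "- e < smash x \<and> smash x < 1 + e" for x
    using e smash_nonneg[of x] smash_le_1[of x] by linarith
  then have "smash_cube m w \<in> box_nbhd m (\<lambda>_. 0) (\<lambda>_. 1) e" for w
    using smash_cube_Rn by (auto simp: box_nbhd_def smash_cube_def)
  then show ?thesis using F eplot_subst[OF F(1) openin_Rn, of m "smash_cube m"] smooth_fun_smash_cube[OF openin_Rn]
    by (intro exI[of _ "\<lambda>w. F (smash_cube m w)"]) auto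
qed

text \<open>The weights in the support of one point sum to 1 there, so by continuity their sum stays
  positive nearby. For boxes with a common face the union of the two index sets serves.\<close>

lemma finite_support_on_cube:
  assumes F: "eplot m (Rn m) F"
  shows "\<exists>J. finite J \<and> (\<forall>w. 0 < (\<Sum>j\<in>J. fst (F (smash_cube m w)) j))"
proof -
  define P where "P a b \<longleftrightarrow> (\<exists>J. finite J \<and> (\<forall>w\<in>Rn m. (\<forall>i<m. a i \<le> w i \<and> w i \<le> b i) \<longrightarrow> 0 < (\<Sum>j\<in>J. fst (F w) j)))" for a b
  have nonneg: "0 \<le> fst (F w) j" if "w \<in> Rn m" for w j
    using eplot_S[OF F that] by (simp add: milnor_S_iff weights_def)
  have "P (\<lambda>_. 0) (\<lambda>_. 1)"
  proof (rule cube_induct[of m P])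
    fix a b :: "nat \<Rightarrow> real" and j c
    assume "P a (b(j := c))" "P (a(j := c)) b"
    then obtain J1 J2 where J: "finite J1" "finite J2"
      "\<And>w. w\<in>Rn m \<Longrightarrow> (\<forall>i<m. a i \<le> w i \<and> w i \<le> (b(j := c)) i) \<Longrightarrow> 0 < (\<Sum>j\<in>J1. fst (F w) j)"
      "\<And>w. w\<in>Rn m \<Longrightarrow> (\<forall>i<m. (a(j := c)) i \<le> w i \<and> w i \<le> b i) \<Longrightarrow> 0 < (\<Sum>j\<in>J2. fst (F w) j)"
      unfolding P_def by blast
    have "0 < (\<Sum>j\<in>J1 \<union> J2. fst (F w) j)" if w: "w \<in> Rn m" "\<forall>i<m. a i \<le> w i \<and> w i \<le> b i" for w
    proof -
      have "(\<Sum>j\<in>J1. fst (F w) j) \<le> (\<Sum>j\<in>J1 \<union> J2. fst (F w) j)" "(\<Sum>j\<in>J2. fst (F w) j) \<le> (\<Sum>j\<in>J1 \<union> J2. fst (F w) j)"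
        using J(1,2) nonneg[OF w(1)] by (intro sum_mono2; auto)+
      moreover have "0 < (\<Sum>j\<in>J1. fst (F w) j) \<or> 0 < (\<Sum>j\<in>J2. fst (F w) j)"
        using J(3,4)[OF w(1)] w(2) by (cases "w j \<le> c") auto
      ultimately show ?thesis by linarith
    qed
    then show "P a b" unfolding P_def using J(1,2) by blast
  next
    fix x :: "nat \<Rightarrow> real"
    let ?J = "{i. fst (F (trunc m x)) i \<noteq> 0}"
    have w: "weights (fst (F (trunc m x)))" using eplot_S[OF F trunc_Rn] by (simp add: milnor_S_iff)
    have "smooth_fun m (Rn m) (\<lambda>w. \<Sum>j\<in>?J. fst (F w) j)"
      by (intro smooth_fun_sum eplot_smooth_weight[OF F] openin_Rn)
    then have "openin (Euclidean_space m) {w \<in> Rn m. (\<Sum>j\<in>?J. fst (F w) j) \<in> {0<..}}"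
      by (rule smooth_fun_preimage_open[OF openin_Rn]) simp
    moreover have "trunc m x \<in> {w \<in> Rn m. (\<Sum>j\<in>?J. fst (F w) j) \<in> {0<..}}"
      using w trunc_Rn by (simp add: weights_def)
    ultimately obtain e where e: "e > 0"
      "\<And>v. v \<in> Rn m \<Longrightarrow> (\<And>i. i < m \<Longrightarrow> \<bar>v i - trunc m x i\<bar> < e) \<Longrightarrow> v \<in> {w \<in> Rn m. (\<Sum>j\<in>?J. fst (F w) j) \<in> {0<..}}"
      by (rule openin_Euclidean_spaceD) blast
    have "P a b" if ab: "\<forall>i<m. x i - e/2 \<le> a i \<and> a i \<le> x i \<and> x i \<le> b i \<and> b i \<le> x i + e/2" for a b
      unfolding P_def
    proof (intro exI conjI ballI impI)
      show "finite ?J" using w by (simp add: weights_def)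
      fix v assume v: "v \<in> Rn m" "\<forall>i<m. a i \<le> v i \<and> v i \<le> b i"
      have "v \<in> {w \<in> Rn m. (\<Sum>j\<in>?J. fst (F w) j) \<in> {0<..}}"
      proof (rule e(2)[OF v(1)])
        fix i assume i: "i < m"
        then have "a i \<le> v i" "v i \<le> b i" "x i - e/2 \<le> a i" "b i \<le> x i + e/2" using v(2) ab by auto
        then show "\<bar>v i - trunc m x i\<bar> < e" using i e(1) by (simp add: trunc_def abs_less_iff)
      qed
      then show "0 < (\<Sum>j\<in>?J. fst (F v) j)" by simp
    qed
    then show "\<exists>e>0. \<forall>a b. (\<forall>i<m. x i - e \<le> a i \<and> a i \<le> x i \<and> x i \<le> b i \<and> b i \<le> x i + e) \<longrightarrow> P a b"
      using e(1) by (intro exI[of _ "e/2"]) auto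
  qed auto
  then obtain J where J: "finite J" "\<And>w. w\<in>Rn m \<Longrightarrow> (\<forall>i<m. 0 \<le> w i \<and> w i \<le> 1) \<Longrightarrow> 0 < (\<Sum>j\<in>J. fst (F w) j)"
    unfolding P_def by blast
  have "0 < (\<Sum>j\<in>J. fst (F (smash_cube m w)) j)" for w
    by (rule J(2)[OF smash_cube_Rn]) (simp add: smash_cube_def smash_nonneg smash_le_1)
  then show ?thesis using J(1) by blast
qed

context
  fixes x0 :: "'a milnor_seq" assumes x0: "x0 \<in> S"
begin

lemma same_act_base_one: "h \<in> carrier G \<Longrightarrow> same (act h x0) x0 \<Longrightarrow> h = \<one>"
  using same_act_unique[OF x0 _ one_closed, of h x0] act_one[OF x0] same_refl by metis

text \<open>
  The lift is first chosen arbitrarily. Where \<open>f \<circ> smash\<close> is constant for trivial reasons it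
  differs from \<open>x0\<close> by a smooth map to the group. Away from the edge of that region this map
  extends to the whole space: push the coordinate \<open>s\<close> down to \<open>0\<close> over the inner part of the cube.
\<close>

lemma relative_lift:
  assumes f: "plot (milnor_B G X) (Suc s) (Rn (Suc s)) f" and I: "I \<subseteq> {..<s}"
    and f0: "\<And>w i. w \<in> Rn (Suc s) \<Longrightarrow> i \<in> insert s I \<Longrightarrow> w i = 0 \<or> w i = 1 \<Longrightarrow> f w = orbit x0"
  obtains F A where "eplot (Suc s) (Rn (Suc s)) F" "\<And>w. w \<in> Rn (Suc s) \<Longrightarrow> orbit (F w) = f (smash_cube (Suc s) w)"
    "\<And>w i. w \<in> Rn (Suc s) \<Longrightarrow> i \<in> I \<Longrightarrow> w i = 0 \<or> w i = 1 \<Longrightarrow> same (F w) x0"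
    "\<And>w. w \<in> Rn (Suc s) \<Longrightarrow> w s = 0 \<Longrightarrow> same (F w) x0"
    "plot X s (Rn s) A" "\<And>v i. v \<in> Rn s \<Longrightarrow> i \<in> I \<Longrightarrow> v i = 0 \<or> v i = 1 \<Longrightarrow> A v = \<one>"
    "\<And>w. w \<in> Rn (Suc s) \<Longrightarrow> w s = 1 \<Longrightarrow> same (F w) (act (A (trunc s w)) x0)"
proof -
  let ?m = "Suc s"
  have finI: "finite I" and sI: "s \<notin> I" using I finite_subset by auto
  obtain F0 where F0: "eplot ?m (Rn ?m) F0" "\<And>w. w \<in> Rn ?m \<Longrightarrow> orbit (F0 w) = f (smash_cube ?m w)"
    using cube_lift[OF f] by blast
  \<comment> \<open>The collar of the face \<open>w s = 0\<close> and both collars in every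
    direction of \<open>I\<close>: there \<open>smash_cube\<close> lands on a face on which
    \<open>f\<close> is constant. The collar of \<open>w s = 1\<close> is not added, as the lift
    must remain free to move in the fibre there.\<close>
  define A0 where "A0 = {w \<in> Rn ?m. w s \<in> {..<1/4}} \<union> (\<Union>i\<in>I. {w \<in> Rn ?m. w i \<in> {..<1/4} \<union> {3/4<..}})"
  have oA0: "openin (Euclidean_space ?m) A0" unfolding A0_def
    by (intro openin_Un openin_Union ballI)
       (auto intro!: openin_Euclidean_space_Int_coordinate[OF openin_Rn] simp del: Un_iff lessThan_iff greaterThan_iff)
  have A0_sub: "A0 \<subseteq> Rn ?m" by (auto simp: A0_def)
  have flat: "f (smash_cube ?m w) = orbit x0" if "w \<in> A0" for w
  proof -
    have "w s < 1/4 \<or> (\<exists>i\<in>I. w i < 1/4 \<or> 3/4 < w i)" using that unfolding A0_def by blast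
    then obtain i where i: "i \<in> insert s I" "w i \<le> 1/4 \<or> 3/4 \<le> w i" by (metis insertCI less_imp_le)
    then have "smash_cube ?m w i = 0 \<or> smash_cube ?m w i = 1"
      using I by (auto simp: smash_cube_def smash_eq_0 smash_eq_1)
    then show ?thesis using f0[OF smash_cube_Rn i(1)] by simp
  qed
  obtain d where d: "plot X ?m A0 d" "\<And>w. w \<in> A0 \<Longrightarrow> same (act (d w) (F0 w)) x0"
    using lift_difference[OF eplot_restrict[OF F0(1) oA0 A0_sub] eplot_const[OF oA0 x0]] F0(2) flat A0_sub by (metis subsetD)
  \<comment> \<open>If all coordinates in \<open>I\<close> are on the plateau, the product is 1 and
    coordinate \<open>s\<close> becomes 0; otherwise one of them is in a collar, and membership in
    \<open>A0\<close> does not depend on coordinate \<open>s\<close>. If one of them is 0 or 1, the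
    product vanishes and \<open>r\<close> is the identity, so the correction is exact on these
    faces.\<close>
  define r where "r w = w(s := (1 - (\<Prod>i\<in>I. bump (w i))) * w s)" for w :: "nat \<Rightarrow> real"
  have r_in: "r w \<in> A0" if w: "w \<in> Rn ?m" for w
  proof (cases "\<exists>i\<in>I. w i < 1/4 \<or> 3/4 < w i")
    case True
    then show ?thesis using w sI by (auto simp: A0_def r_def Rn_iff)
  next
    case False
    then have "(\<Prod>i\<in>I. bump (w i)) = 1" by (intro prod.neutral ballI bump_eq_1) force+
    then show ?thesis using w by (auto simp: A0_def r_def Rn_iff)
  qed
  have dr: "plot X ?m (Rn ?m) (\<lambda>w. d (r w))"
  proof (rule plot_subst[OF d(1) openin_Rn r_in])
    fix i
    have "smooth_fun ?m (Rn ?m) (\<lambda>w. (1 - (\<Prod>i\<in>I. bump (w i))) * w s)"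
      by (intro smooth_fun_mult smooth_fun_diff smooth_fun_bump_prod smooth_fun_const smooth_fun_coordinate openin_Rn)
    then show "smooth_fun ?m (Rn ?m) (\<lambda>w. r w i)" unfolding r_def by (rule smooth_fun_upd[OF openin_Rn])
  qed
  define F where "F w = act (d (r w)) (F0 w)" for w
  have F: "eplot ?m (Rn ?m) F" unfolding F_def by (rule eplot_act[OF F0(1) dr])
  have orbF: "orbit (F w) = f (smash_cube ?m w)" if "w \<in> Rn ?m" for w
    unfolding F_def using orbit_act[OF eplot_S[OF F0(1) that] plot_carrier[OF dr that]] F0(2)[OF that] by simp
  have Fx0: "same (F w) x0" if "w \<in> A0" "r w = w" for w using d(2)[OF that(1)] that(2) by (simp add: F_def)
  have side: "same (F w) x0" if "w \<in> Rn ?m" "i \<in> I" "w i = 0 \<or> w i = 1" for w i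
  proof (rule Fx0)
    show "w \<in> A0" using that by (force simp: A0_def)
    have "(\<Prod>i\<in>I. bump (w i)) = 0" using that finI bump_ends by (intro prod_zero) auto
    then show "r w = w" by (simp add: r_def)
  qed
  have bottom: "same (F w) x0" if "w \<in> Rn ?m" "w s = 0" for w
    by (rule Fx0) (use that in \<open>auto simp: A0_def r_def\<close>)
  let ?F1 = "\<lambda>v. F (v(s := 1))"
  have up: "v(s := 1) \<in> Rn ?m" if "v \<in> Rn s" for v using that by (auto simp: Rn_iff)
  have F1: "eplot s (Rn s) ?F1"
    by (rule eplot_subst[OF F openin_Rn]) (use up in \<open>auto intro: smooth_fun_upd[OF openin_Rn smooth_fun_const[OF openin_Rn]] simp del: fun_upd_apply\<close>)
  have "orbit (?F1 v) = orbit x0" if "v \<in> Rn s" for v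
  proof -
    have "smash_cube ?m (v(s := 1)) s = 1" by (simp add: smash_cube_def)
    then show ?thesis using orbF[OF up[OF that]] f0[OF smash_cube_Rn, of s "v(s := 1)"] by simp
  qed
  \<comment> \<open>On the last face the lift runs over the base point and is compared with the
    constant lift \<open>x0\<close>.\<close>
  then obtain A where A: "plot X s (Rn s) A" "\<And>v. v \<in> Rn s \<Longrightarrow> same (act (A v) x0) (?F1 v)"
    using lift_difference[OF eplot_const[OF openin_Rn x0] F1] by metis
  show thesis
  proof (rule that[OF F orbF side bottom A(1)])
    fix v i assume v: "v \<in> Rn s" "i \<in> I" "v i = 0 \<or> v i = 1"
    have "same (?F1 v) x0" by (rule side[OF up[OF v(1)] v(2)]) (use v sI in auto)
    then have "same (act (A v) x0) x0" using A(2)[OF v(1)] same_trans by blast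
    then show "A v = \<one>" using same_act_base_one plot_carrier[OF A(1) v(1)] by blast
  next
    fix w assume w: "w \<in> Rn ?m" "w s = 1"
    have "(trunc s w)(s := 1) = w" using w by (auto simp: trunc_def Rn_iff fun_eq_iff)
    then show "same (F w) (act (A (trunc s w)) x0)" using A(2)[OF trunc_Rn, of w] same_sym by simp
  qed blast+
qed

end

end

subsection \<open>The connecting isomorphism\<close>

lemma smash_cube_case_nat: "smash_cube (Suc m) (case_nat p w) = case_nat (smash p) (smash_cube m w)"
  by (auto simp: smash_cube_def fun_eq_iff split: nat.split)

lemma trunc_case_nat: "trunc (Suc m) (case_nat p w) = case_nat p (trunc m w)"
  by (auto simp: trunc_def fun_eq_iff split: nat.split)

lemma trunc_smash_cube: "trunc k (smash_cube (Suc k) w) = smash_cube k w"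
  by (auto simp: trunc_def smash_cube_def fun_eq_iff)

lemma smash_cube_trunc: "smash_cube k (trunc k w) = smash_cube k w"
  by (auto simp: trunc_def smash_cube_def fun_eq_iff)

lemma smash_cube_upd: "smash_cube k (w(k := s)) = smash_cube k w"
  by (auto simp: smash_cube_def fun_eq_iff)

lemma smooth_fun_case_nat:
  assumes "openin (Euclidean_space n) U" "smooth_fun n U h" "\<And>j. smooth_fun n U (\<lambda>w. g w j)"
  shows "smooth_fun n U (\<lambda>w. case_nat (h w) (g w) j)"
  by (cases j) (simp_all add: assms)

lemma prod_bump_eq_0:
  fixes w :: "nat \<Rightarrow> real"
  assumes "i < m" "w i = 0 \<or> w i = 1" shows "(\<Prod>i<m. bump (w i)) = 0"
proof -
  have "bump (w i) = 0" using assms(2) by (rule bump_ends)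
  then have "\<exists>i\<in>{..<m}. bump (w i) = 0" using assms(1) by blast
  then show ?thesis by (rule prod_zero[OF finite_lessThan])
qed

text \<open>The index set on the left is the one produced by \<open>eplot_join_halves\<close>. It
  consists of the cube coordinates of a homotopy, coordinate 0 being the time.\<close>

lemma prod_bump_Suc: "(\<Prod>i\<in>insert (Suc k) (Suc ` {..<k}). bump (w i)) = (\<Prod>i<Suc k. bump (w (Suc i)))"
proof -
  have "insert (Suc k) (Suc ` {..<k}) = Suc ` {..<Suc k}" by (simp add: lessThan_Suc)
  then have "(\<Prod>i\<in>insert (Suc k) (Suc ` {..<k}). bump (w i)) = (\<Prod>i\<in>Suc ` {..<Suc k}. bump (w i))" by metis
  also have "\<dots> = (\<Prod>i<Suc k. bump (w (Suc i)))" by (subst prod.reindex) (simp_all add: o_def)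
  finally show ?thesis .
qed

context diffeological_group begin

text \<open>The analogue of \<open>plot_cat\<close> for representatives of points of EG: at the seam
  they have to agree only up to \<open>same\<close>.\<close>

lemma eplot_cat:
  assumes F: "eplot m (Rn m) F" and F': "eplot m (Rn m) F'" and j: "j < m"
    and eq: "\<And>w. w \<in> Rn m \<Longrightarrow> same (F (w(j := 1))) (F' (w(j := 0)))"
  shows "eplot m (Rn m) (cat j F F')"
proof (rule eplot_local[OF openin_Rn])
  show "cat j F F' w \<in> S" if "w \<in> Rn m" for w
    using eplot_S[OF F Rn_upd[OF that j]] eplot_S[OF F' Rn_upd[OF that j]] by (simp add: cat_def)
  fix u assume u: "u \<in> Rn m"
  have sm: "smooth_fun m U (\<lambda>w. smash (2 * w j - a))" if "openin (Euclidean_space m) U" for U a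
    using that by (intro smooth_fun_smash smooth_fun_diff smooth_fun_mult smooth_fun_const smooth_fun_coordinate)
  show "\<exists>V q. eplot m V q \<and> u \<in> V \<and> (\<forall>v\<in>V \<inter> Rn m. same (cat j F F' v) (q v))"
  proof (cases "u j \<le> 1/2")
    case True
    let ?V = "{w \<in> Rn m. w j \<in> {..<5/8}}"
    have V: "openin (Euclidean_space m) ?V" by (rule openin_Euclidean_space_Int_coordinate) auto
    have "eplot m ?V (\<lambda>w. F (w(j := smash (2 * w j - 0))))"
      by (rule eplot_subst[OF F V Rn_upd[OF _ j] smooth_fun_upd[OF V sm[OF V]]]) simp
    moreover have "same (cat j F F' v) (F (v(j := smash (2 * v j - 0))))" if "v \<in> ?V" for v
      using that same_sym[OF eq[of v]] smash_eq_1[of "2 * v j"] smash_eq_0[of "2 * v j - 1"] by (auto simp: cat_def)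
    ultimately show ?thesis using u True by (intro exI[of _ ?V] exI[of _ "\<lambda>w. F (w(j := smash (2 * w j - 0)))"]) auto
  next
    case False
    let ?V = "{w \<in> Rn m. w j \<in> {1/2<..}}"
    have V: "openin (Euclidean_space m) ?V" by (rule openin_Euclidean_space_Int_coordinate) auto
    have "eplot m ?V (\<lambda>w. F' (w(j := smash (2 * w j - 1))))"
      by (rule eplot_subst[OF F' V Rn_upd[OF _ j] smooth_fun_upd[OF V sm[OF V]]]) simp
    then show ?thesis using u False
      by (intro exI[of _ ?V] exI[of _ "\<lambda>w. F' (w(j := smash (2 * w j - 1)))"]) (auto simp: cat_def)
  qed
qed

lemma fst_act: "fst (act h x) = fst x"
  by (simp add: act_def)

lemma one_point: "\<one> \<in> points X"
  by (simp add: points_eq_carrier)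

lemma cubes_carrier: "a \<in> cubes k X y \<Longrightarrow> v \<in> Rn k \<Longrightarrow> a v \<in> carrier G"
  by (rule plot_carrier[OF cubes_plot])

context
  fixes x0 :: "'a milnor_seq" assumes x0: "x0 \<in> S"
begin

text \<open>
  A disk lifts a cube of \<open>BG\<close> based at the orbit of \<open>x0\<close>; it is constant on all faces of the cube
  but one, and there it runs in the fibre over the base point. The connecting map
  \<open>\<pi>\<^sub>k\<^sub>+\<^sub>1 BG \<rightarrow> \<pi>\<^sub>k G\<close> sends the class of the cube to the class of the last face.
\<close>

definition disk :: "nat \<Rightarrow> ((nat \<Rightarrow> real) \<Rightarrow> 'a) \<Rightarrow> ((nat \<Rightarrow> real) \<Rightarrow> 'a milnor_seq) \<Rightarrow> bool" where
  "disk k a F \<longleftrightarrow> a \<in> cubes k X \<one> \<and> eplot (Suc k) (Rn (Suc k)) F \<and>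
     (\<forall>w\<in>Rn (Suc k). w k = 0 \<or> (\<exists>i<k. w i = 0 \<or> w i = 1) \<longrightarrow> same (F w) x0) \<and>
     (\<forall>w\<in>Rn (Suc k). w k = 1 \<longrightarrow> same (F w) (act (a (trunc k w)) x0))"

lemma diskD:
  assumes "disk k a F"
  shows "a \<in> cubes k X \<one>" "eplot (Suc k) (Rn (Suc k)) F"
    "\<And>w. w \<in> Rn (Suc k) \<Longrightarrow> w k = 0 \<Longrightarrow> same (F w) x0"
    "\<And>w i. w \<in> Rn (Suc k) \<Longrightarrow> i < k \<Longrightarrow> w i = 0 \<or> w i = 1 \<Longrightarrow> same (F w) x0"
    "\<And>w. w \<in> Rn (Suc k) \<Longrightarrow> w k = 1 \<Longrightarrow> same (F w) (act (a (trunc k w)) x0)"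
  using assms unfolding disk_def by blast+

lemma diskI:
  assumes "a \<in> cubes k X \<one>" "eplot (Suc k) (Rn (Suc k)) F"
    "\<And>w. w \<in> Rn (Suc k) \<Longrightarrow> w k = 0 \<Longrightarrow> same (F w) x0"
    "\<And>w i. w \<in> Rn (Suc k) \<Longrightarrow> i < k \<Longrightarrow> w i = 0 \<or> w i = 1 \<Longrightarrow> same (F w) x0"
    "\<And>w. w \<in> Rn (Suc k) \<Longrightarrow> w k = 1 \<Longrightarrow> same (F w) (act (a (trunc k w)) x0)"
  shows "disk k a F"
  using assms unfolding disk_def by blast

lemma orbit_base: "same y x0 \<Longrightarrow> y \<in> S \<Longrightarrow> orbit y = orbit x0"
  using orbit_same x0 by blast

lemma orbit_act_base: "same y (act h x0) \<Longrightarrow> y \<in> S \<Longrightarrow> h \<in> carrier G \<Longrightarrow> orbit y = orbit x0"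
  using orbit_same[OF _ act_S[OF x0]] orbit_act[OF x0] by metis

lemma disk_orbit_boundary:
  assumes F: "disk k a F" and w: "w \<in> Rn (Suc k)" "i < Suc k" "w i = 0 \<or> w i = 1"
  shows "orbit (F w) = orbit x0"
proof -
  have FS: "F w \<in> S" by (rule eplot_S[OF diskD(2)[OF F] w(1)])
  consider "i < k" | "w k = 0" | "w k = 1" using w by (cases "i = k") auto
  then show ?thesis
  proof cases
    case 1 then show ?thesis using diskD(4)[OF F w(1) _ w(3)] orbit_base FS by blast
  next
    case 2 then show ?thesis using diskD(3)[OF F w(1)] orbit_base FS by blast
  next
    case 3 then show ?thesis
      using diskD(5)[OF F w(1)] orbit_act_base FS cubes_carrier[OF diskD(1)[OF F] trunc_Rn] by blast
  qed
qed

lemma disk_cubes: "disk k a F \<Longrightarrow> (\<lambda>w. orbit (F w)) \<in> cubes (Suc k) (milnor_B G X) (orbit x0)"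
  by (rule diffeology.cubesI[OF diffeology_milnor_B eplot_imp_plot_B[OF diskD(2)] disk_orbit_boundary])

lemma disk_smash:
  assumes F: "disk k a F"
  shows "disk k (\<lambda>v. a (smash_cube k v)) (\<lambda>w. F (smash_cube (Suc k) w))"
proof (rule diskI)
  show "(\<lambda>v. a (smash_cube k v)) \<in> cubes k X \<one>" by (rule smash_cubes[OF diskD(1)[OF F]])
  show "eplot (Suc k) (Rn (Suc k)) (\<lambda>w. F (smash_cube (Suc k) w))"
    by (rule eplot_subst[OF diskD(2)[OF F] openin_Rn smash_cube_Rn smooth_fun_smash_cube[OF openin_Rn]])
  fix w :: "nat \<Rightarrow> real"
  show "w k = 0 \<Longrightarrow> same (F (smash_cube (Suc k) w)) x0"
    by (rule diskD(3)[OF F smash_cube_Rn]) (simp add: smash_cube_def)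
  show "i < k \<Longrightarrow> w i = 0 \<or> w i = 1 \<Longrightarrow> same (F (smash_cube (Suc k) w)) x0" for i
    by (rule diskD(4)[OF F smash_cube_Rn]) (auto simp: smash_cube_def)
  show "w k = 1 \<Longrightarrow> same (F (smash_cube (Suc k) w)) (act (a (smash_cube k (trunc k w))) x0)"
    using diskD(5)[OF F smash_cube_Rn, of w] unfolding trunc_smash_cube smash_cube_trunc
    by (simp add: smash_cube_def)
qed

text \<open>Independence of the lift. Two lifts of one cube differ by a map \<open>d\<close> to the
  group that is 1 on the faces where both lifts represent \<open>x0\<close>; on the last face
  \<open>d \<otimes> a = a'\<close> by freeness. With the last coordinate read as time,
  \<open>d \<otimes> a\<close> is the homotopy.\<close>

lemma disk_htpy_same_cube:
  assumes F: "disk k a F" and F': "disk k a' F'"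
    and eq: "\<And>w. w \<in> Rn (Suc k) \<Longrightarrow> orbit (F w) = orbit (F' w)"
  shows "htpy k X \<one> a a'"
proof -
  obtain d where d: "plot X (Suc k) (Rn (Suc k)) d" "\<And>w. w \<in> Rn (Suc k) \<Longrightarrow> same (act (d w) (F w)) (F' w)"
    using lift_difference[OF diskD(2)[OF F] diskD(2)[OF F'] eq] by metis
  have d_one: "d w = \<one>" if w: "w \<in> Rn (Suc k)" and "same (F w) x0" "same (F' w) x0" for w
  proof -
    have "same (act (d w) x0) x0"
      using d(2)[OF w] same_act[OF that(2), of "d w"] that(3) same_trans same_sym by meson
    then show ?thesis using same_act_base_one[OF x0] plot_carrier[OF d(1) w] by blast
  qed
  \<comment> \<open>Moves the time from coordinate 0, its place in a homotopy, to the last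
    coordinate \<open>k\<close> of the disk.\<close>
  define e where "e w = (\<lambda>i. w (Suc i))(k := w 0)" for w :: "nat \<Rightarrow> real"
  have e: "e w \<in> Rn (Suc k)" if "w \<in> Rn (Suc k)" for w using that by (auto simp: e_def Rn_iff)
  have es: "smooth_fun (Suc k) (Rn (Suc k)) (\<lambda>w. e w j)" for j
    by (cases "j = k") (auto simp: e_def smooth_fun_coordinate)
  have e_trunc: "trunc k (e w) = (\<lambda>i. w (Suc i))" if "w \<in> Rn (Suc k)" for w
    using that by (auto simp: e_def trunc_def Rn_iff fun_eq_iff)
  show ?thesis
  proof (rule htpyI[where H="\<lambda>w. d (e w) \<otimes> a (\<lambda>i. w (Suc i))"])
    show "plot X (Suc k) (Rn (Suc k)) (\<lambda>w. d (e w) \<otimes> a (\<lambda>i. w (Suc i)))"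
      by (intro plot_mult smooth_tail_plot[OF diskD(1)[OF F]] plot_subst[OF d(1) openin_Rn]) (use e es in auto)
    fix w i assume w: "w \<in> Rn (Suc k)" "i < k" "w (Suc i) = 0 \<or> w (Suc i) = 1"
    have "e w i = 0 \<or> e w i = 1" using w by (simp add: e_def)
    then have "d (e w) = \<one>" using d_one[OF e[OF w(1)]] diskD(4)[OF F e[OF w(1)] w(2)] diskD(4)[OF F' e[OF w(1)] w(2)] by blast
    moreover have "a (\<lambda>i. w (Suc i)) = \<one>" using cubes_boundary[OF diskD(1)[OF F] tail_Rn[OF w(1)] w(2)] w(3) by simp
    ultimately show "d (e w) \<otimes> a (\<lambda>i. w (Suc i)) = \<one>" by simp
  next
    fix v assume v: "v \<in> Rn k"
    have R: "case_nat s v \<in> Rn (Suc k)" for s by (rule case_nat_Rn[OF v])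
    have ek: "e (case_nat s v) k = s" for s by (simp add: e_def)
    have av: "a v \<in> carrier G" "a' v \<in> carrier G"
      using cubes_carrier[OF diskD(1)[OF F] v] cubes_carrier[OF diskD(1)[OF F'] v] by auto
    have "d (e (case_nat 0 v)) = \<one>"
      by (rule d_one[OF e[OF R]]) (use diskD(3)[OF F e[OF R] ek] diskD(3)[OF F' e[OF R] ek] in auto)
    then show "d (e (case_nat 0 v)) \<otimes> a (\<lambda>i. case_nat 0 v (Suc i)) = a v" using av by simp
    let ?w = "e (case_nat 1 v)"
    have dw: "d ?w \<in> carrier G" by (rule plot_carrier[OF d(1) e[OF R]])
    have "trunc k ?w = v" using e_trunc[OF R] by simp
    then have "same (F ?w) (act (a v) x0)" "same (F' ?w) (act (a' v) x0)"
      using diskD(5)[OF F e[OF R] ek] diskD(5)[OF F' e[OF R] ek] by auto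
    then have "same (act (d ?w) (act (a v) x0)) (act (a' v) x0)"
      using d(2)[OF e[OF R]] same_act same_trans same_sym by meson
    then have "same (act (d ?w \<otimes> a v) x0) (act (a' v) x0)" using act_act[OF x0 dw av(1)] by simp
    then have "d ?w \<otimes> a v = a' v" using same_act_unique[OF x0 _ av(2)] dw av(1) same_refl by (metis m_closed)
    then show "d (e (case_nat 1 v)) \<otimes> a (\<lambda>i. case_nat 1 v (Suc i)) = a' v" by simp
  qed
qed

text \<open>The relative lift in direction \<open>k\<close>, held at \<open>x0\<close> on the faces
  of all other directions, projects to the smashed cube, which is homotopic to
  \<open>f\<close>.\<close>

lemma disk_exists:
  assumes f: "f \<in> cubes (Suc k) (milnor_B G X) (orbit x0)"
  obtains a F where "disk k a F" "htpy (Suc k) (milnor_B G X) (orbit x0) f (\<lambda>w. orbit (F w))"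
proof -
  interpret B: diffeology "milnor_B G X" by (rule diffeology_milnor_B)
  have side: "f w = orbit x0" if "w \<in> Rn (Suc k)" "i \<in> insert k {..<k}" "w i = 0 \<or> w i = 1" for w i
    using B.cubes_boundary[OF f that(1) _ that(3)] that(2) by auto
  obtain F A where F: "eplot (Suc k) (Rn (Suc k)) F" "\<And>w. w \<in> Rn (Suc k) \<Longrightarrow> orbit (F w) = f (smash_cube (Suc k) w)"
    "\<And>w i. w \<in> Rn (Suc k) \<Longrightarrow> i \<in> {..<k} \<Longrightarrow> w i = 0 \<or> w i = 1 \<Longrightarrow> same (F w) x0"
    "\<And>w. w \<in> Rn (Suc k) \<Longrightarrow> w k = 0 \<Longrightarrow> same (F w) x0"
    "plot X k (Rn k) A" "\<And>v i. v \<in> Rn k \<Longrightarrow> i \<in> {..<k} \<Longrightarrow> v i = 0 \<or> v i = 1 \<Longrightarrow> A v = \<one>"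
    "\<And>w. w \<in> Rn (Suc k) \<Longrightarrow> w k = 1 \<Longrightarrow> same (F w) (act (A (trunc k w)) x0)"
    by (rule relative_lift[OF x0 B.cubes_plot[OF f] subset_refl side]) (assumption+, (rule that; assumption))
  have "disk k A F" by (rule diskI) (use F in \<open>auto intro!: cubesI\<close>)
  moreover have "htpy (Suc k) (milnor_B G X) (orbit x0) f (\<lambda>w. orbit (F w))"
    using B.htpy_smash[OF f] F(2) unfolding htpy_def by simp
  ultimately show thesis by (rule that)
qed

text \<open>The connecting map respects classes. The homotopy is lifted like a cube of one dimension
  more, except that the directions held fixed leave out the time, for which there is no boundary
  condition. The values \<open>A\<close> on the last face form a homotopy between its end slices;
  these belong to lifts of the smashed end cubes and are compared with the given disks by
  \<open>disk_htpy_same_cube\<close>.\<close>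

lemma disk_htpy_imp:
  assumes F: "disk k a F" and F': "disk k a' F'"
    and h: "htpy (Suc k) (milnor_B G X) (orbit x0) (\<lambda>w. orbit (F w)) (\<lambda>w. orbit (F' w))"
  shows "htpy k X \<one> a a'"
proof -
  obtain H where H: "plot (milnor_B G X) (Suc (Suc k)) (Rn (Suc (Suc k))) H"
    "\<And>w i. w \<in> Rn (Suc (Suc k)) \<Longrightarrow> i < Suc k \<Longrightarrow> w (Suc i) = 0 \<or> w (Suc i) = 1 \<Longrightarrow> H w = orbit x0"
    "\<And>v. v \<in> Rn (Suc k) \<Longrightarrow> H (case_nat 0 v) = orbit (F v)"
    "\<And>v. v \<in> Rn (Suc k) \<Longrightarrow> H (case_nat 1 v) = orbit (F' v)"
    using h by (rule htpyE) (rule that; assumption)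
  have side: "H w = orbit x0" if "w \<in> Rn (Suc (Suc k))" "i \<in> insert (Suc k) (Suc ` {..<k})" "w i = 0 \<or> w i = 1" for w i
  proof -
    have "insert (Suc k) (Suc ` {..<k}) = Suc ` {..<Suc k}" by (simp add: lessThan_Suc)
    with that(2) have "i \<in> Suc ` {..<Suc k}" by (simp only:)
    then obtain i' where "i = Suc i'" "i' < Suc k" by blast
    then show ?thesis using H(2)[OF that(1), of i'] that(3) by blast
  qed
  have sub: "Suc ` {..<k} \<subseteq> {..<Suc k}" by auto
  obtain K A where K: "eplot (Suc (Suc k)) (Rn (Suc (Suc k))) K"
    "\<And>w. w \<in> Rn (Suc (Suc k)) \<Longrightarrow> orbit (K w) = H (smash_cube (Suc (Suc k)) w)"
    "\<And>w i. w \<in> Rn (Suc (Suc k)) \<Longrightarrow> i \<in> Suc ` {..<k} \<Longrightarrow> w i = 0 \<or> w i = 1 \<Longrightarrow> same (K w) x0"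
    "\<And>w. w \<in> Rn (Suc (Suc k)) \<Longrightarrow> w (Suc k) = 0 \<Longrightarrow> same (K w) x0"
    "plot X (Suc k) (Rn (Suc k)) A" "\<And>v i. v \<in> Rn (Suc k) \<Longrightarrow> i \<in> Suc ` {..<k} \<Longrightarrow> v i = 0 \<or> v i = 1 \<Longrightarrow> A v = \<one>"
    "\<And>w. w \<in> Rn (Suc (Suc k)) \<Longrightarrow> w (Suc k) = 1 \<Longrightarrow> same (K w) (act (A (trunc (Suc k) w)) x0)"
    by (rule relative_lift[OF x0 H(1) sub side]) (assumption+, (rule that; assumption))
  have slice: "disk k (\<lambda>v. A (case_nat p v)) (\<lambda>w. K (case_nat p w))" for p
  proof (rule diskI)
    have "smooth_fun m (Rn m) (\<lambda>w. case_nat p w j)" for m j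
      by (rule smooth_fun_case_nat) (simp_all add: smooth_fun_const smooth_fun_coordinate)
    note s = this
    show "(\<lambda>v. A (case_nat p v)) \<in> cubes k X \<one>"
    proof (rule cubesI)
      show "plot X k (Rn k) (\<lambda>v. A (case_nat p v))" by (rule plot_subst[OF K(5) openin_Rn case_nat_Rn s])
      fix v i assume "v \<in> Rn k" "i < k" "v i = 0 \<or> v i = 1"
      then show "A (case_nat p v) = \<one>" by (intro K(6)[of _ "Suc i"] case_nat_Rn) auto
    qed
    show "eplot (Suc k) (Rn (Suc k)) (\<lambda>w. K (case_nat p w))"
      by (rule eplot_subst[OF K(1) openin_Rn case_nat_Rn s])
    fix w assume w: "w \<in> Rn (Suc k)"
    note R = case_nat_Rn[OF w, of p]
    show "w k = 0 \<Longrightarrow> same (K (case_nat p w)) x0" by (rule K(4)[OF R]) simp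
    show "i < k \<Longrightarrow> w i = 0 \<or> w i = 1 \<Longrightarrow> same (K (case_nat p w)) x0" for i
      by (rule K(3)[OF R, of "Suc i"]) auto
    show "w k = 1 \<Longrightarrow> same (K (case_nat p w)) (act (A (case_nat p (trunc k w))) x0)"
      using K(7)[OF R] by (simp add: trunc_case_nat)
  qed
  have orb: "orbit (K (case_nat p w)) = H (case_nat (smash p) (smash_cube (Suc k) w))" if "w \<in> Rn (Suc k)" for p w
    using K(2)[OF case_nat_Rn[OF that]] by (simp only: smash_cube_case_nat)
  note htpy_trans[trans]
  have "htpy k X \<one> a (\<lambda>v. a (smash_cube k v))" by (rule htpy_smash[OF diskD(1)[OF F]])
  also have "htpy k X \<one> \<dots> (\<lambda>v. A (case_nat 0 v))"
    by (rule disk_htpy_same_cube[OF disk_smash[OF F] slice]) (simp add: orb H(3) smash_cube_Rn)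
  also have "htpy k X \<one> \<dots> (\<lambda>v. A (case_nat 1 v))"
    by (rule htpyI[where H=A]) (use K(5,6) in auto)
  also have "htpy k X \<one> \<dots> (\<lambda>v. a' (smash_cube k v))"
    by (rule disk_htpy_same_cube[OF slice disk_smash[OF F']]) (simp add: orb H(4) smash_cube_Rn)
  also have "htpy k X \<one> \<dots> a'" by (rule htpy_sym[OF htpy_smash[OF diskD(1)[OF F']]])
  finally show ?thesis .
qed

section \<open>Disks with collars and standard cones\<close>

lemma htpy_orbitI:
  assumes K: "eplot (Suc m) (Rn (Suc m)) K"
    and "\<And>w i. w \<in> Rn (Suc m) \<Longrightarrow> i < m \<Longrightarrow> w (Suc i) = 0 \<or> w (Suc i) = 1 \<Longrightarrow> orbit (K w) = orbit x0"
    and "\<And>v. v \<in> Rn m \<Longrightarrow> orbit (K (case_nat 0 v)) = f v" "\<And>v. v \<in> Rn m \<Longrightarrow> orbit (K (case_nat 1 v)) = g v"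
  shows "htpy m (milnor_B G X) (orbit x0) f g"
  by (rule htpyI[where H="\<lambda>w. orbit (K w)"]) (use assms eplot_imp_plot_B[OF K] in auto)

text \<open>A lift with collars that leaves join coordinate \<open>N\<close> free.
  \<open>eplot_join_halves\<close> asks for the collars, \<open>join_vertex\<close> for the free
  coordinate.\<close>

definition flat_disk :: "nat \<Rightarrow> nat \<Rightarrow> ((nat \<Rightarrow> real) \<Rightarrow> 'a) \<Rightarrow> ((nat \<Rightarrow> real) \<Rightarrow> 'a milnor_seq) \<Rightarrow> bool" where
  "flat_disk N k a F \<longleftrightarrow> eplot (Suc k) (Rn (Suc k)) F \<and> (\<forall>w\<in>Rn (Suc k). fst (F w) N = 0) \<and>
     (\<forall>w\<in>Rn (Suc k). w k \<le> 1/4 \<or> (\<exists>i<k. w i \<le> 1/4 \<or> 3/4 \<le> w i) \<longrightarrow> same (F w) x0) \<and>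
     (\<forall>w\<in>Rn (Suc k). 3/4 \<le> w k \<longrightarrow> same (F w) (act (a (smash_cube k w)) x0))"

lemma flat_diskD:
  assumes "flat_disk N k a F"
  shows "eplot (Suc k) (Rn (Suc k)) F" "\<And>w. w \<in> Rn (Suc k) \<Longrightarrow> fst (F w) N = 0"
    "\<And>w. w \<in> Rn (Suc k) \<Longrightarrow> w k \<le> 1/4 \<Longrightarrow> same (F w) x0"
    "\<And>w i. w \<in> Rn (Suc k) \<Longrightarrow> i < k \<Longrightarrow> w i \<le> 1/4 \<or> 3/4 \<le> w i \<Longrightarrow> same (F w) x0"
    "\<And>w. w \<in> Rn (Suc k) \<Longrightarrow> 3/4 \<le> w k \<Longrightarrow> same (F w) (act (a (smash_cube k w)) x0)"
  using assms unfolding flat_disk_def by blast+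

text \<open>A standard disk over \<open>a\<close>: along the last direction it rises from
  \<open>x0\<close> to the vertex \<open>N\<close> and descends to the translate of
  \<open>x0\<close> by \<open>a\<close>. The switch at 1/2 takes place at the vertex, or in a side
  collar, where the translation is trivial.\<close>

definition cone_disk :: "nat \<Rightarrow> nat \<Rightarrow> ((nat \<Rightarrow> real) \<Rightarrow> 'a) \<Rightarrow> (nat \<Rightarrow> real) \<Rightarrow> 'a milnor_seq" where
  "cone_disk N k a w = join_vertex N (\<Prod>i<Suc k. bump (w i))
     (if w k < 1/2 then x0 else act (a (smash_cube k w)) x0)"

lemma orbit_join_0:
  assumes "x \<in> S" "fst x N = 0" shows "orbit (join_vertex N 0 x) = orbit x"
  by (rule orbit_same[OF join_S[OF assms(1)] assms(1) join_0[OF assms(2)]]) auto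

text \<open>Surjectivity of the connecting map. On the side collars
  \<open>a (smash_cube k w)\<close> is 1, so both halves agree there; on every face the bump product
  vanishes and the join returns the map that was coned off.\<close>

lemma cone_disk:
  assumes a: "a \<in> cubes k X \<one>" and N: "fst x0 N = 0"
  shows "disk k (\<lambda>v. a (smash_cube k v)) (cone_disk N k a)"
proof (rule diskI)
  have as: "plot X (Suc k) (Rn (Suc k)) (\<lambda>w. a (smash_cube k w))"
    by (rule plot_subst[OF cubes_plot[OF a] openin_Rn smash_cube_Rn smooth_fun_smash_cube[OF openin_Rn]])
  have a_one: "a (smash_cube k w) = \<one>" if "i < k" "w i \<le> 1/4 \<or> 3/4 \<le> w i" for w i
    by (rule cubes_boundary[OF a smash_cube_Rn that(1)]) (use that in \<open>auto simp: smash_cube_def smash_eq_0 smash_eq_1\<close>)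
  have ac: "a (smash_cube k w) \<in> carrier G" for w by (rule cubes_carrier[OF a smash_cube_Rn])
  show "(\<lambda>v. a (smash_cube k v)) \<in> cubes k X \<one>" by (rule smash_cubes[OF a])
  have "eplot (Suc k) (Rn (Suc k)) (\<lambda>w. join_vertex N (\<Prod>i\<in>insert k {..<k}. bump (w i))
     (if w k < 1/2 then x0 else act (a (smash_cube k w)) x0))"
    by (rule eplot_join_halves)
       (use N a_one act_one[OF x0] eplot_const[OF openin_Rn x0] eplot_act[OF eplot_const[OF openin_Rn x0] as]
        in \<open>auto simp: fst_act\<close>)
  then show "eplot (Suc k) (Rn (Suc k)) (cone_disk N k a)"
    by (simp add: cone_disk_def[abs_def] lessThan_Suc)
  have end0: "same (cone_disk N k a w) (if w k < 1/2 then x0 else act (a (smash_cube k w)) x0)"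
    if "i < Suc k" "w i = 0 \<or> w i = 1" for w i
    unfolding cone_disk_def using prod_bump_eq_0[of i "Suc k" w] that N
    by (simp only:) (rule join_0, simp add: act_def)
  fix w :: "nat \<Rightarrow> real"
  show "w k = 0 \<Longrightarrow> same (cone_disk N k a w) x0" using end0[of k w] by simp
  show "i < k \<Longrightarrow> w i = 0 \<or> w i = 1 \<Longrightarrow> same (cone_disk N k a w) x0" for i
    using end0[of i w] a_one[of i w] act_one[OF x0] by (auto split: if_splits)
  show "w k = 1 \<Longrightarrow> same (cone_disk N k a w) (act (a (smash_cube k (trunc k w))) x0)"
    using end0[of k w] by (simp add: smash_cube_trunc)
qed

text \<open>The cone construction over a homotopy from \<open>a\<close> to \<open>a'\<close>. The
  time coordinate 0 is neither smashed nor part of the bump product, so the two ends are exactly the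
  two cones.\<close>

lemma cone_disk_htpy:
  assumes h: "htpy k X \<one> a a'" and N: "fst x0 N = 0"
  shows "htpy (Suc k) (milnor_B G X) (orbit x0) (\<lambda>w. orbit (cone_disk N k a w)) (\<lambda>w. orbit (cone_disk N k a' w))"
proof -
  obtain H where H: "plot X (Suc k) (Rn (Suc k)) H"
    "\<And>w i. w \<in> Rn (Suc k) \<Longrightarrow> i < k \<Longrightarrow> w (Suc i) = 0 \<or> w (Suc i) = 1 \<Longrightarrow> H w = \<one>"
    "\<And>v. v \<in> Rn k \<Longrightarrow> H (case_nat 0 v) = a v" "\<And>v. v \<in> Rn k \<Longrightarrow> H (case_nat 1 v) = a' v"
    using h by (rule htpyE) (rule that; assumption)
  let ?m = "Suc (Suc k)"
  let ?t = "\<lambda>w. smash_cube k (\<lambda>i. w (Suc i))"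
  have s: "smooth_fun ?m (Rn ?m) (\<lambda>w. ?t w j)" for j
    by (cases "j < k") (auto simp: smash_cube_def intro!: smooth_fun_smash smooth_fun_const smooth_fun_coordinate)
  have Hs: "plot X ?m (Rn ?m) (\<lambda>w. H (case_nat (w 0) (?t w)))"
    by (rule plot_subst[OF H(1) openin_Rn case_nat_Rn[OF smash_cube_Rn]
          smooth_fun_case_nat[OF openin_Rn smooth_fun_coordinate[OF openin_Rn] s]])
  have H_one: "H (case_nat (w 0) (?t w)) = \<one>" if "i \<in> Suc ` {..<k}" "w i < 1/4 \<or> 3/4 < w i" for w i
  proof -
    from that(1) obtain i' where i': "i = Suc i'" "i' < k" by blast
    show ?thesis
      by (rule H(2)[OF case_nat_Rn[OF smash_cube_Rn] i'(2)])
         (use that i' in \<open>auto simp: smash_cube_def smash_eq_0 smash_eq_1\<close>)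
  qed
  define K where "K w = join_vertex N (\<Prod>i\<in>insert (Suc k) (Suc ` {..<k}). bump (w i))
     (if w (Suc k) < 1/2 then x0 else act (H (case_nat (w 0) (?t w))) x0)" for w
  show ?thesis
  proof (rule htpy_orbitI)
    show "eplot ?m (Rn ?m) K" unfolding K_def
      by (rule eplot_join_halves)
         (use N H_one act_one[OF x0] eplot_const[OF openin_Rn x0] eplot_act[OF eplot_const[OF openin_Rn x0] Hs]
        in \<open>auto simp: fst_act\<close>)
    fix w i assume w: "w \<in> Rn ?m" "i < Suc k" "w (Suc i) = 0 \<or> w (Suc i) = 1"
    have "K w = join_vertex N 0 (if w (Suc k) < 1/2 then x0 else act (H (case_nat (w 0) (?t w))) x0)"
      unfolding K_def prod_bump_Suc prod_bump_eq_0[OF w(2), of "\<lambda>i. w (Suc i)", OF w(3)] ..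
    then show "orbit (K w) = orbit x0"
      using orbit_join_0[OF x0 N] orbit_join_0[OF act_S[OF x0 plot_carrier[OF Hs w(1)]], of N] orbit_act[OF x0 plot_carrier[OF Hs w(1)]] N
      by (auto simp: act_def)
  next
    fix v assume v: "v \<in> Rn (Suc k)"
    have "K (case_nat 0 v) = cone_disk N k a v" "K (case_nat 1 v) = cone_disk N k a' v"
      using H(3,4)[OF smash_cube_Rn, of v] unfolding K_def prod_bump_Suc cone_disk_def by simp_all
    then show "orbit (K (case_nat 0 v)) = orbit (cone_disk N k a v)" "orbit (K (case_nat 1 v)) = orbit (cone_disk N k a' v)"
      by simp_all
  qed
qed

end

end

section \<open>Injectivity, products and the isomorphism\<close>

context diffeological_group begin

context
  fixes x0 :: "'a milnor_seq" assumes x0: "x0 \<in> S"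
begin

text \<open>
  Only finitely many weights are needed to have a positive sum on the compact cube. Deforming all
  other weights to \<open>0\<close> leaves room for a new vertex of the join.
\<close>

lemma flat_disk_exists:
  assumes F: "disk x0 k a F"
  shows "\<exists>J. finite J \<and> (\<forall>N. N \<notin> J \<longrightarrow> fst x0 N = 0 \<and> (\<exists>F'. flat_disk x0 N k a F' \<and>
    htpy (Suc k) (milnor_B G X) (orbit x0) (\<lambda>w. orbit (F w)) (\<lambda>w. orbit (F' w))))"
proof -
  interpret B: diffeology "milnor_B G X" by (rule diffeology_milnor_B)
  let ?m = "Suc k"
  note FD = diskD[OF x0 F]
  define E where "E w = F (smash_cube ?m w)" for w
  have dE: "disk x0 k (\<lambda>v. a (smash_cube k v)) E" unfolding E_def by (rule disk_smash[OF x0 F])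
  have E: "eplot ?m (Rn ?m) E" by (rule diskD(2)[OF x0 dE])
  obtain J1 where J1: "finite J1" "\<And>w. 0 < (\<Sum>j\<in>J1. fst (E w) j)"
    using finite_support_on_cube[OF FD(2)] by (auto simp: E_def)
  have wx0: "weights (fst x0)" using x0 by (simp add: milnor_S_iff)
  \<comment> \<open>With the support of \<open>x0\<close> included, truncation to \<open>J\<close>
    does not alter the weights over the base point.\<close>
  define J where "J = J1 \<union> {j. fst x0 j \<noteq> 0}"
  have J: "finite J" using J1(1) wx0 by (simp add: J_def weights_def)
  have x0J: "fst x0 j = 0" if "j \<notin> J" for j using that by (auto simp: J_def)
  have wE: "weights (fst (E w))" if "w \<in> Rn ?m" for w using eplot_S[OF E that] by (simp add: milnor_S_iff)
  define T where "T w = (\<Sum>j\<in>J. fst (E w) j)" for w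
  have T: "0 < T w" if "w \<in> Rn ?m" for w
  proof -
    have "(\<Sum>j\<in>J1. fst (E w) j) \<le> T w"
      unfolding T_def using J wE[OF that] by (intro sum_mono2) (auto simp: J_def weights_def)
    then show ?thesis using J1(2)[of w] by linarith
  qed
  \<comment> \<open>Truncation to \<open>J\<close>, renormalised by the positive sum
    \<open>T w\<close>.\<close>
  define tJ where "tJ w j = (if j \<in> J then fst (E w) j / T w else 0)" for w j
  have tJ: "weights (tJ w)" if "w \<in> Rn ?m" for w
    unfolding weights_iff
  proof (intro conjI allI exI[of _ J] J impI)
    show "0 \<le> tJ w i" for i using T[OF that] wE[OF that] by (auto simp: tJ_def weights_def)
    have "sum (tJ w) J = (\<Sum>j\<in>J. fst (E w) j / T w)" by (intro sum.cong) (auto simp: tJ_def)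
    also have "\<dots> = T w / T w" by (simp only: T_def sum_divide_distrib)
    finally show "sum (tJ w) J = 1" using T[OF that] by simp
  qed (simp add: tJ_def)
  have tJ_smooth: "smooth_fun ?m (Rn ?m) (\<lambda>w. tJ w j)" for j
  proof (cases "j \<in> J")
    case True
    have "smooth_fun ?m (Rn ?m) T" unfolding T_def[abs_def]
      by (intro smooth_fun_sum eplot_smooth_weight[OF E] openin_Rn)
    then have "smooth_fun ?m (Rn ?m) (\<lambda>w. fst (E w) j / T w)"
      by (intro smooth_fun_divide eplot_smooth_weight[OF E] openin_Rn) (use T in force)+
    then show ?thesis using True by (simp add: tJ_def)
  qed (simp add: tJ_def smooth_fun_const)
  have tJ_supp: "fst (E w) j \<noteq> 0" if "tJ w j \<noteq> 0" for w j using that by (auto simp: tJ_def split: if_splits)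
  have tJ_base: "tJ w = fst (E w)" if "fst (E w) = fst x0" for w
  proof -
    have "sum (fst x0) J = sum (fst x0) {j. fst x0 j \<noteq> 0}"
      by (rule sum.mono_neutral_right[OF J]) (auto simp: J_def)
    also have "\<dots> = 1" using wx0 by (simp add: weights_def)
    finally have "T w = 1" by (simp add: T_def that)
    then show ?thesis using x0J that by (auto simp: tJ_def fun_eq_iff)
  qed
  define F' where "F' w = (tJ w, snd (E w))" for w
  have F': "eplot ?m (Rn ?m) F'" unfolding F'_def
    by (rule eplot_reweight[OF E tJ_smooth tJ tJ_supp])
  have F'_base: "same (F' w) y" if "same (E w) y" "fst y = fst x0" for w y
  proof -
    have "tJ w = fst (E w)" using that by (intro tJ_base) (simp add: same_def)
    then have "F' w = E w" unfolding F'_def by (simp only: prod.collapse)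
    then show ?thesis using that(1) by simp
  qed
  have tail: "(\<lambda>i. w (Suc i)) \<in> Rn ?m" if "w \<in> Rn (Suc ?m)" for w using that by (rule tail_Rn)
  have Etail: "eplot (Suc ?m) (Rn (Suc ?m)) (\<lambda>w. E (\<lambda>i. w (Suc i)))"
    by (rule eplot_subst[OF E openin_Rn tail smooth_fun_coordinate[OF openin_Rn]])
  \<comment> \<open>The support of this convex combination lies in that of the weights of
    \<open>E\<close>, so the group components can be kept.\<close>
  define \<theta> where "\<theta> w j = (1 - smash (w 0)) * fst (E (\<lambda>i. w (Suc i))) j + smash (w 0) * tJ (\<lambda>i. w (Suc i)) j"
    for w :: "nat \<Rightarrow> real" and j
  define K where "K w = (\<theta> w, snd (E (\<lambda>i. w (Suc i))))" for w
  have K: "eplot (Suc ?m) (Rn (Suc ?m)) K" unfolding K_def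
  proof (rule eplot_reweight[OF Etail])
    have "smooth_fun (Suc ?m) (Rn (Suc ?m)) (\<lambda>w. tJ (\<lambda>i. w (Suc i)) j)" for j
      by (rule smooth_fun_compose[OF openin_Rn openin_Rn tail smooth_fun_coordinate[OF openin_Rn] tJ_smooth])
    then show "smooth_fun (Suc ?m) (Rn (Suc ?m)) (\<lambda>w. \<theta> w j)" for j
      unfolding \<theta>_def
      by (intro smooth_fun_add smooth_fun_mult smooth_fun_diff smooth_fun_smash smooth_fun_const
          smooth_fun_coordinate eplot_smooth_weight[OF Etail] openin_Rn)
    show "weights (\<theta> w)" if "w \<in> Rn (Suc ?m)" for w
      unfolding \<theta>_def by (rule weights_convex[OF wE[OF tail[OF that]] tJ[OF tail[OF that]] smash_nonneg smash_le_1])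
    show "fst (E (\<lambda>i. w (Suc i))) j \<noteq> 0" if "\<theta> w j \<noteq> 0" for w j
      using that tJ_supp[of "\<lambda>i. w (Suc i)" j] by (auto simp: \<theta>_def)
  qed
  have "htpy ?m (milnor_B G X) (orbit x0) (\<lambda>w. orbit (E w)) (\<lambda>w. orbit (F' w))"
  proof (rule htpy_orbitI[OF x0 K])
    fix w i assume w: "w \<in> Rn (Suc ?m)" "i < ?m" "w (Suc i) = 0 \<or> w (Suc i) = 1"
    have orb: "orbit (E (\<lambda>i. w (Suc i))) = orbit x0"
      by (rule disk_orbit_boundary[OF x0 dE tail[OF w(1)] w(2)]) (rule w(3))
    obtain h where "same (act h (E (\<lambda>i. w (Suc i)))) x0"
      using orbit_eqD[OF eplot_S[OF E tail[OF w(1)]] x0 orb] by blast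
    \<comment> \<open>The action does not touch the weights, so over the base point they are those
      of \<open>x0\<close>, and there the deformation is constant.\<close>
    then have "fst (E (\<lambda>i. w (Suc i))) = fst x0" by (simp add: same_def fst_act)
    from tJ_base[OF this] have "\<theta> w = fst (E (\<lambda>i. w (Suc i)))" by (simp add: \<theta>_def fun_eq_iff algebra_simps)
    then show "orbit (K w) = orbit x0" using orb by (simp add: K_def)
  next
    fix v :: "nat \<Rightarrow> real"
    have "\<theta> (case_nat 0 v) = fst (E v)" "\<theta> (case_nat 1 v) = tJ v" by (simp_all add: \<theta>_def fun_eq_iff)
    then show "orbit (K (case_nat 0 v)) = orbit (E v)" "orbit (K (case_nat 1 v)) = orbit (F' v)"
      by (simp_all add: K_def F'_def)
  qed
  then have h: "htpy ?m (milnor_B G X) (orbit x0) (\<lambda>w. orbit (F w)) (\<lambda>w. orbit (F' w))"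
    using B.htpy_trans[OF B.htpy_smash[OF disk_cubes[OF x0 F]]] by (simp add: E_def)
  have "flat_disk x0 N k a F'" if N: "N \<notin> J" for N
    unfolding flat_disk_def[OF x0]
  proof (intro conjI ballI impI F')
    fix w :: "nat \<Rightarrow> real"
    show "fst (F' w) N = 0" using N by (simp add: F'_def tJ_def)
    show "same (F' w) x0" if "w k \<le> 1/4 \<or> (\<exists>i<k. w i \<le> 1/4 \<or> 3/4 \<le> w i)"
    proof (rule F'_base)
      from that consider "w k \<le> 1/4" | i where "i < k" "w i \<le> 1/4 \<or> 3/4 \<le> w i" by blast
      then show "same (E w) x0" unfolding E_def
      proof cases
        case 1 then show "same (F (smash_cube ?m w)) x0"
          by (intro FD(3) smash_cube_Rn) (simp add: smash_cube_def smash_eq_0)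
      next
        case 2 then show "same (F (smash_cube ?m w)) x0"
          by (intro FD(4)[of _ i] smash_cube_Rn) (auto simp: smash_cube_def smash_eq_0 smash_eq_1)
      qed
    qed simp
    show "same (F' w) (act (a (smash_cube k w)) x0)" if "3/4 \<le> w k"
    proof (rule F'_base)
      have "smash_cube ?m w k = 1" using that by (simp add: smash_cube_def smash_eq_1)
      then show "same (E w) (act (a (smash_cube k w)) x0)"
        using FD(5)[OF smash_cube_Rn, of w] by (simp add: E_def trunc_smash_cube)
    qed (simp add: fst_act)
  qed
  then show ?thesis using J x0J h by blast
qed

text \<open>Two homotopies in succession. The first raises the interior of the disk to the vertex
  \<open>N\<close>. Once the middle level \<open>w k = 1/2\<close> is at the vertex, except in the
  side collars, the halves can be deformed independently: the lower one is pushed to the face where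
  \<open>F\<close> is \<open>x0\<close>, the upper one to the face where \<open>F\<close> is the
  translate of \<open>x0\<close> by \<open>a\<close>.\<close>

lemma flat_disk_htpy_cone:
  assumes F: "flat_disk x0 N k a F" and a: "a \<in> cubes k X \<one>"
  shows "htpy (Suc k) (milnor_B G X) (orbit x0) (\<lambda>w. orbit (F w)) (\<lambda>w. orbit (cone_disk x0 N k a w))"
proof -
  interpret B: diffeology "milnor_B G X" by (rule diffeology_milnor_B)
  let ?m = "Suc k"
  note FD = flat_diskD[OF x0 F]
  have FS: "F w \<in> S" if "w \<in> Rn ?m" for w by (rule eplot_S[OF FD(1) that])
  have ac: "a (smash_cube k w) \<in> carrier G" for w by (rule cubes_carrier[OF a smash_cube_Rn])
  have boundary: "orbit (F w) = orbit x0" if w: "w \<in> Rn ?m" "i < ?m" "w i = 0 \<or> w i = 1" for w i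
  proof -
    consider "i < k" | "w k = 0" | "w k = 1" using w by (cases "i = k") auto
    then show ?thesis
    proof cases
      case 1 then show ?thesis using FD(4)[OF w(1), of i] w(3) by (intro orbit_base[OF x0] FS w(1)) auto
    next
      case 2 then show ?thesis using FD(3)[OF w(1)] by (intro orbit_base[OF x0] FS w(1)) auto
    next
      case 3 then show ?thesis using FD(5)[OF w(1)] by (intro orbit_act_base[OF x0 _ FS[OF w(1)] ac]) auto
    qed
  qed
  have tail: "(\<lambda>i. w (Suc i)) \<in> Rn ?m" if "w \<in> Rn (Suc ?m)" for w using that by (rule tail_Rn)
  let ?\<mu> = "\<lambda>w. \<Prod>i<?m. bump (w i)"
  have \<mu>: "0 \<le> (\<Prod>i<?m. bump (w i))" "(\<Prod>i<?m. bump (w i)) \<le> 1" for w by (rule bump_prod_bounds)+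
  note B.htpy_trans[trans]
  have "htpy ?m (milnor_B G X) (orbit x0) (\<lambda>w. orbit (F w)) (\<lambda>w. orbit (join_vertex N (?\<mu> w) (F w)))"
  \<comment> \<open>The time takes all real values; \<open>smash (w 0)\<close> keeps the join
    parameter in [0,1].\<close>
  proof (rule htpy_orbitI[OF x0, where K="\<lambda>w. join_vertex N (smash (w 0) * ?\<mu> (\<lambda>i. w (Suc i))) (F (\<lambda>i. w (Suc i)))"])
    have "smooth_fun (Suc ?m) (Rn (Suc ?m)) (\<lambda>w. smash (w 0) * ?\<mu> (\<lambda>i. w (Suc i)))"
      by (intro smooth_fun_mult smooth_fun_smash smooth_fun_prod smooth_fun_bump smooth_fun_coordinate openin_Rn)
    moreover have "eplot (Suc ?m) (Rn (Suc ?m)) (\<lambda>w. F (\<lambda>i. w (Suc i)))"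
      by (rule eplot_subst[OF FD(1) openin_Rn tail smooth_fun_coordinate[OF openin_Rn]])
    ultimately show "eplot (Suc ?m) (Rn (Suc ?m)) (\<lambda>w. join_vertex N (smash (w 0) * ?\<mu> (\<lambda>i. w (Suc i))) (F (\<lambda>i. w (Suc i))))"
      by (intro eplot_join FD(2) tail mult_nonneg_nonneg mult_le_one smash_nonneg smash_le_1 \<mu>)
  next
    fix w i assume w: "w \<in> Rn (Suc ?m)" "i < ?m" "w (Suc i) = 0 \<or> w (Suc i) = 1"
    show "orbit (join_vertex N (smash (w 0) * ?\<mu> (\<lambda>i. w (Suc i))) (F (\<lambda>i. w (Suc i)))) = orbit x0"
      unfolding prod_bump_eq_0[OF w(2), of "\<lambda>i. w (Suc i)", OF w(3)] mult_zero_right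
        orbit_join_0[OF x0 FS[OF tail[OF w(1)]] FD(2)[OF tail[OF w(1)]]]
      by (rule boundary[OF tail[OF w(1)] w(2,3)])
  next
    fix v assume v: "v \<in> Rn ?m"
    show "orbit (join_vertex N (smash (case_nat 0 v 0) * ?\<mu> (\<lambda>i. case_nat 0 v (Suc i))) (F (\<lambda>i. case_nat 0 v (Suc i)))) = orbit (F v)"
      using orbit_join_0[OF x0 FS[OF v] FD(2)[OF v]] by simp
  qed simp
  also have "htpy ?m (milnor_B G X) (orbit x0) \<dots> (\<lambda>w. orbit (cone_disk x0 N k a w))"
  proof -
    \<comment> \<open>As time goes from 0 to 1, \<open>p\<close> contracts the last coordinate to 0
      and \<open>q\<close> contracts it to 1. The face 0 is fixed by \<open>p\<close> and the face 1
      by \<open>q\<close>, so the boundary stays over the base point.\<close>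
    define p where "p w = (\<lambda>i. w (Suc i))(k := (1 - smash (w 0)) * w (Suc k))" for w :: "nat \<Rightarrow> real"
    define q where "q w = (\<lambda>i. w (Suc i))(k := 1 - (1 - smash (w 0)) * (1 - w (Suc k)))" for w :: "nat \<Rightarrow> real"
    have pq: "p w \<in> Rn ?m" "q w \<in> Rn ?m" if "w \<in> Rn (Suc ?m)" for w
      using tail[OF that] by (auto simp: p_def q_def Rn_iff)
    have s: "smooth_fun (Suc ?m) (Rn (Suc ?m)) (\<lambda>w. p w j)" "smooth_fun (Suc ?m) (Rn (Suc ?m)) (\<lambda>w. q w j)" for j
      by (cases "j = k";
          simp add: p_def q_def smooth_fun_coordinate;
          intro smooth_fun_mult smooth_fun_diff smooth_fun_smash smooth_fun_const smooth_fun_coordinate openin_Rn)+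
    define K where "K w = join_vertex N (\<Prod>i\<in>insert (Suc k) (Suc ` {..<k}). bump (w i))
       (if w (Suc k) < 1/2 then F (p w) else F (q w))" for w
    have pq_flat: "same (F (p w)) x0" "same (F (q w)) x0"
      if w: "w \<in> Rn (Suc ?m)" and i: "i < k" "w (Suc i) \<le> 1/4 \<or> 3/4 \<le> w (Suc i)" for w i
      using FD(4)[OF pq(1)[OF w] i(1)] FD(4)[OF pq(2)[OF w] i(1)] i by (auto simp: p_def q_def)
    show ?thesis
    proof (rule htpy_orbitI[OF x0])
      show "eplot (Suc ?m) (Rn (Suc ?m)) K" unfolding K_def
      proof (rule eplot_join_halves)
        show "eplot (Suc ?m) (Rn (Suc ?m)) (\<lambda>w. F (p w))" "eplot (Suc ?m) (Rn (Suc ?m)) (\<lambda>w. F (q w))"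
          by (rule eplot_subst[OF FD(1) openin_Rn pq(1) s(1)] eplot_subst[OF FD(1) openin_Rn pq(2) s(2)]; assumption)+
        fix w assume w: "w \<in> Rn (Suc ?m)"
        show "fst (F (p w)) N = 0" "fst (F (q w)) N = 0" using FD(2) pq w by auto
        fix i assume i: "i \<in> Suc ` {..<k}" "w i < 1/4 \<or> 3/4 < w i"
        from i(1) obtain i' where i': "i = Suc i'" "i' < k" by blast
        have "w (Suc i') \<le> 1/4 \<or> 3/4 \<le> w (Suc i')" using i(2) i'(1) by auto
        from pq_flat[OF w i'(2) this] show "same (F (p w)) (F (q w))" using same_trans same_sym by blast
      qed simp
      fix w i assume w: "w \<in> Rn (Suc ?m)" "i < ?m" "w (Suc i) = 0 \<or> w (Suc i) = 1"
      let ?u = "if w (Suc k) < 1/2 then p w else q w"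
      have u: "?u \<in> Rn ?m" using pq[OF w(1)] by simp
      have "K w = join_vertex N 0 (F ?u)"
        unfolding K_def prod_bump_Suc prod_bump_eq_0[OF w(2), of "\<lambda>i. w (Suc i)", OF w(3)] by simp
      then have "orbit (K w) = orbit (F ?u)" using orbit_join_0[OF x0 FS[OF u] FD(2)[OF u]] by simp
      also have "\<dots> = orbit x0"
      proof (rule boundary[OF u w(2)])
        show "?u i = 0 \<or> ?u i = 1" using w by (cases "i = k") (auto simp: p_def q_def)
      qed
      finally show "orbit (K w) = orbit x0" .
    next
      fix v assume v: "v \<in> Rn ?m"
      have "p (case_nat 0 v) = v" "q (case_nat 0 v) = v" by (auto simp: p_def q_def fun_eq_iff)
      then show "orbit (K (case_nat 0 v)) = orbit (join_vertex N (?\<mu> v) (F v))"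
        unfolding K_def prod_bump_Suc by simp
      have v01: "v(k := 0) \<in> Rn ?m" "v(k := 1) \<in> Rn ?m" using v by (auto simp: Rn_iff)
      have "p (case_nat 1 v) = v(k := 0)" "q (case_nat 1 v) = v(k := 1)" by (auto simp: p_def q_def fun_eq_iff)
      moreover have "same (F (v(k := 0))) x0" "same (F (v(k := 1))) (act (a (smash_cube k v)) x0)"
        using FD(3)[OF v01(1)] FD(5)[OF v01(2)] by (simp_all add: smash_cube_upd)
      ultimately have "same (K (case_nat 1 v)) (cone_disk x0 N k a v)"
        unfolding K_def prod_bump_Suc cone_disk_def[OF x0] by (auto intro: same_join)
      moreover have "K (case_nat 1 v) \<in> S" "cone_disk x0 N k a v \<in> S"
        unfolding K_def cone_disk_def[OF x0] using FS pq[OF case_nat_Rn[OF v]] x0 act_S[OF x0 ac]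
        by (intro join_S bump_prod_bounds; simp)+
      ultimately show "orbit (K (case_nat 1 v)) = orbit (cone_disk x0 N k a v)" by (rule orbit_same[rotated 2])
    qed
  qed
  finally show ?thesis .
qed

text \<open>Injectivity of the connecting map. Each disk excludes only finitely many vertices, so
  both can be deformed to cones with one common vertex \<open>N\<close>, and cones over homotopic
  cubes are homotopic.\<close>

lemma htpy_imp_disk_htpy:
  assumes F: "disk x0 k a F" and F': "disk x0 k a' F'" and h: "htpy k X \<one> a a'"
  shows "htpy (Suc k) (milnor_B G X) (orbit x0) (\<lambda>w. orbit (F w)) (\<lambda>w. orbit (F' w))"
proof -
  interpret B: diffeology "milnor_B G X" by (rule diffeology_milnor_B)
  obtain J where J: "finite J" "\<And>N. N \<notin> J \<Longrightarrow> fst x0 N = 0 \<and> (\<exists>F1. flat_disk x0 N k a F1 \<and>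
    htpy (Suc k) (milnor_B G X) (orbit x0) (\<lambda>w. orbit (F w)) (\<lambda>w. orbit (F1 w)))"
    using flat_disk_exists[OF F] by blast
  obtain J' where J': "finite J'" "\<And>N. N \<notin> J' \<Longrightarrow> fst x0 N = 0 \<and> (\<exists>F1. flat_disk x0 N k a' F1 \<and>
    htpy (Suc k) (milnor_B G X) (orbit x0) (\<lambda>w. orbit (F' w)) (\<lambda>w. orbit (F1 w)))"
    using flat_disk_exists[OF F'] by blast
  obtain N where N: "N \<notin> J" "N \<notin> J'" using ex_new_if_finite[of "J \<union> J'"] J(1) J'(1) by auto
  obtain F1 where F1: "flat_disk x0 N k a F1" "htpy (Suc k) (milnor_B G X) (orbit x0) (\<lambda>w. orbit (F w)) (\<lambda>w. orbit (F1 w))"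
    using J(2)[OF N(1)] by blast
  obtain F1' where F1': "flat_disk x0 N k a' F1'" "htpy (Suc k) (milnor_B G X) (orbit x0) (\<lambda>w. orbit (F' w)) (\<lambda>w. orbit (F1' w))"
    using J'(2)[OF N(2)] by blast
  have x0N: "fst x0 N = 0" using J(2)[OF N(1)] by blast
  note 1 = B.htpy_trans[OF F1(2) flat_disk_htpy_cone[OF F1(1) diskD(1)[OF x0 F]]]
  note 2 = B.htpy_trans[OF F1'(2) flat_disk_htpy_cone[OF F1'(1) diskD(1)[OF x0 F']]]
  show ?thesis
    by (rule B.htpy_trans[OF 1 B.htpy_trans[OF cone_disk_htpy[OF x0 h x0N] B.htpy_sym[OF 2]]])
qed

text \<open>Concatenation takes place in coordinate 0 and the free face belongs to the last
  coordinate \<open>Suc k\<close>. The two are different here, so concatenating the disks also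
  concatenates the last faces.\<close>

lemma disk_cat:
  assumes F: "disk x0 (Suc k) a F" and F': "disk x0 (Suc k) a' F'"
  shows "disk x0 (Suc k) (cat 0 a a') (cat 0 F F')"
proof (rule diskI[OF x0])
  note D = diskD[OF x0 F] and D' = diskD[OF x0 F']
  let ?m = "Suc (Suc k)"
  show "cat 0 a a' \<in> cubes (Suc k) X \<one>" by (rule cat_cubes[OF D(1) D'(1)]) simp
  have up: "w(0 := s) \<in> Rn ?m" if "w \<in> Rn ?m" for w s using that by (rule Rn_upd) simp
  show "eplot ?m (Rn ?m) (cat 0 F F')"
  proof (rule eplot_cat[OF D(2) D'(2)])
    fix w assume w: "w \<in> Rn ?m"
    have "same (F (w(0 := 1))) x0" "same (F' (w(0 := 0))) x0"
      using D(4)[OF up[OF w, of 1], of 0] D'(4)[OF up[OF w, of 0], of 0] by simp_all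
    then show "same (F (w(0 := 1))) (F' (w(0 := 0)))" using same_trans same_sym by blast
  qed simp
  fix w assume w: "w \<in> Rn ?m"
  show "w (Suc k) = 0 \<Longrightarrow> same (cat 0 F F' w) x0"
    using D(3)[OF up[OF w]] D'(3)[OF up[OF w]] by (simp add: cat_def)
  show "same (cat 0 F F' w) x0" if i: "i < Suc k" "w i = 0 \<or> w i = 1" for i
  proof (cases "w 0 \<le> 1/2")
    case True
    then have "(w(0 := smash (2 * w 0))) i = 0 \<or> (w(0 := smash (2 * w 0))) i = 1" using i by auto
    then show ?thesis using True D(4)[OF up[OF w] i(1)] by (simp add: cat_def)
  next
    case False
    then have "(w(0 := smash (2 * w 0 - 1))) i = 0 \<or> (w(0 := smash (2 * w 0 - 1))) i = 1" using i by auto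
    then show ?thesis using False D'(4)[OF up[OF w] i(1)] by (simp add: cat_def)
  qed
  have "trunc (Suc k) (w(0 := s)) = (trunc (Suc k) w)(0 := s)" for s by (auto simp: trunc_def fun_eq_iff)
  then show "w (Suc k) = 1 \<Longrightarrow> same (cat 0 F F' w) (act (cat 0 a a' (trunc (Suc k) w)) x0)"
    using D(5)[OF up[OF w]] D'(5)[OF up[OF w]] by (simp add: cat_def trunc_def[of _ w])
qed

text \<open>A loop has only one coordinate, so the second lift must start where the first one ends
  and is translated by the value of \<open>a\<close>. Its own end is then translated by the product,
  which is how concatenation in BG becomes multiplication in the group.\<close>

lemma disk_mult:
  assumes F: "disk x0 0 a F" and F': "disk x0 0 a' F'"
  shows "disk x0 0 (\<lambda>v. a v \<otimes> a' v) (cat 0 F (\<lambda>w. act (a (\<lambda>_. 0)) (F' w)))"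
proof (rule diskI[OF x0])
  note D = diskD[OF x0 F] and D' = diskD[OF x0 F']
  let ?g = "a (\<lambda>_. 0)"
  have R0: "(\<lambda>_. 0) \<in> Rn 0" by (simp add: Rn_iff)
  have g: "?g \<in> carrier G" "a' (\<lambda>_. 0) \<in> carrier G" using cubes_carrier[OF D(1) R0] cubes_carrier[OF D'(1) R0] by auto
  have tr: "trunc 0 w = (\<lambda>_. 0)" for w by (simp add: trunc_def)
  have up: "w(0 := s) \<in> Rn (Suc 0)" if "w \<in> Rn (Suc 0)" for w s using that by (rule Rn_upd) simp
  show "(\<lambda>v. a v \<otimes> a' v) \<in> cubes 0 X \<one>"
    using plot_mult[OF cubes_plot[OF D(1)] cubes_plot[OF D'(1)]] by (simp add: cubes_def)
  have bottom': "same (act ?g (F' w)) (act ?g x0)" if "w \<in> Rn (Suc 0)" "w 0 = 0" for w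
    by (rule same_act[OF D'(3)[OF that]])
  show "eplot (Suc 0) (Rn (Suc 0)) (cat 0 F (\<lambda>w. act ?g (F' w)))"
  proof (rule eplot_cat[OF D(2) eplot_act[OF D'(2) plot_const[OF openin_Rn]]])
    show "?g \<in> points X" using g(1) points_eq_carrier by simp
    fix w assume w: "w \<in> Rn (Suc 0)"
    have "same (F (w(0 := 1))) (act ?g x0)" using D(5)[OF up[OF w, of 1]] by (simp add: tr)
    then show "same (F (w(0 := 1))) (act ?g (F' (w(0 := 0))))"
      using bottom'[OF up[OF w, of 0]] same_trans same_sym by (metis fun_upd_same)
  qed simp
  fix w assume w: "w \<in> Rn (Suc 0)"
  show "w 0 = 0 \<Longrightarrow> same (cat 0 F (\<lambda>w. act ?g (F' w)) w) x0"
    using D(3)[OF up[OF w, of 0]] by (simp add: cat_def)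
  have "same (act ?g (F' (w(0 := 1)))) (act ?g (act (a' (\<lambda>_. 0)) x0))"
    using same_act[OF D'(5)[OF up[OF w, of 1]]] by (simp add: tr)
  then show "w 0 = 1 \<Longrightarrow> same (cat 0 F (\<lambda>w. act ?g (F' w)) w) (act (a (trunc 0 w) \<otimes> a' (trunc 0 w)) x0)"
    using act_act[OF x0 g] by (simp add: cat_def tr)
qed simp

text \<open>As in \<open>homotopy_group_mult\<close>, but representatives may be changed because
  homotopies are multiplied pointwise.\<close>

lemma pi0_group_mult:
  assumes f: "f \<in> cubes 0 X \<one>" and g: "g \<in> cubes 0 X \<one>"
  shows "mult (pi0_group G X) (cube_class 0 \<one> f) (cube_class 0 \<one> g) = cube_class 0 \<one> (\<lambda>v. f v \<otimes> g v)"
proof -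
  have prod_cubes: "(\<lambda>v. f v \<otimes> g v) \<in> cubes 0 X \<one>" if "f \<in> cubes 0 X \<one>" "g \<in> cubes 0 X \<one>" for f g
    using plot_mult[OF cubes_plot[OF that(1)] cubes_plot[OF that(2)]] by (simp add: cubes_def)
  have htpy_mult: "htpy 0 X \<one> (\<lambda>v. f v \<otimes> g v) (\<lambda>v. f' v \<otimes> g' v)" if h: "htpy 0 X \<one> f f'" "htpy 0 X \<one> g g'" for f g f' g'
  proof -
    obtain H where H: "plot X (Suc 0) (Rn (Suc 0)) H" "\<And>v. v \<in> Rn 0 \<Longrightarrow> H (case_nat 0 v) = f v" "\<And>v. v \<in> Rn 0 \<Longrightarrow> H (case_nat 1 v) = f' v"
      using h(1) unfolding htpy_def by blast
    obtain K where K: "plot X (Suc 0) (Rn (Suc 0)) K" "\<And>v. v \<in> Rn 0 \<Longrightarrow> K (case_nat 0 v) = g v" "\<And>v. v \<in> Rn 0 \<Longrightarrow> K (case_nat 1 v) = g' v"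
      using h(2) unfolding htpy_def by blast
    show ?thesis
      by (rule htpyI[where H="\<lambda>w. H w \<otimes> K w"]) (use H K plot_mult in auto)
  qed
  have eq: "path_rel (image_dspace Point X) `` {Point (x \<otimes> y)} = cube_class 0 \<one> (\<lambda>v. f v \<otimes> g v)"
    if xy: "Point x \<in> cube_class 0 \<one> f" "Point y \<in> cube_class 0 \<one> g" for x y
  proof -
    obtain f' where f': "f' \<in> cubes 0 X \<one>" "htpy 0 X \<one> f f'" "Point x = cube_loop 0 f'"
      using cube_class_memD[OF one_point xy(1) f] by metis
    obtain g' where g': "g' \<in> cubes 0 X \<one>" "htpy 0 X \<one> g g'" "Point y = cube_loop 0 g'"
      using cube_class_memD[OF one_point xy(2) g] by metis
    have "cube_class 0 \<one> (\<lambda>v. f v \<otimes> g v) = cube_class 0 \<one> (\<lambda>v. f' v \<otimes> g' v)"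
      using htpy_mult[OF f'(2) g'(2)] cube_class_eq_iff[OF one_point prod_cubes[OF f g] prod_cubes[OF f'(1) g'(1)]] by blast
    then show ?thesis using f'(3) g'(3) by (simp add: cube_class_def)
  qed
  have mem: "Point (f (\<lambda>_. 0)) \<in> cube_class 0 \<one> f" "Point (g (\<lambda>_. 0)) \<in> cube_class 0 \<one> g"
    using cube_loop_in_class[OF one_point f] cube_loop_in_class[OF one_point g] by simp_all
  have "{path_rel (image_dspace Point X) `` {Point (x \<otimes> y)} | x y. Point x \<in> cube_class 0 \<one> f \<and> Point y \<in> cube_class 0 \<one> g}
    = {cube_class 0 \<one> (\<lambda>v. f v \<otimes> g v)}" (is "?S = {?C}")
  proof
    show "?S \<subseteq> {?C}" using eq by blast
    have "?C \<in> ?S" using eq[OF mem, symmetric] mem unfolding mem_Collect_eq by blast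
    then show "{?C} \<subseteq> ?S" by (simp only: insert_subset empty_subsetI)
  qed
  then show ?thesis by (simp only: pi0_group_def monoid.simps) simp
qed

lemma dgroup_homotopy_carrier:
  "carrier (homotopy_group_of_dgroup k G X) = cube_class k \<one> ` cubes k X \<one>"
  using homotopy_group_carrier[OF one_point, of k] pi0_iterated_loop[OF one_point, of 0]
  by (simp add: homotopy_group_of_dgroup_def pi0_group_def)

text \<open>Disks form a correspondence between the two sets of classes. Every class on either side
  occurs, and by \<open>class_iff\<close> two disks give equal classes on one side iff they do on
  the other. The isomorphism is the map with this graph.\<close>

lemma connecting_iso: "homotopy_group (Suc k) (milnor_B G X) (orbit x0) \<cong> homotopy_group_of_dgroup k G X"
proof -
  interpret B: diffeology "milnor_B G X" by (rule diffeology_milnor_B)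
  let ?B = "homotopy_group (Suc k) (milnor_B G X) (orbit x0)" and ?G = "homotopy_group_of_dgroup k G X"
  have b: "orbit x0 \<in> points (milnor_B G X)"
    using B.plot_point[OF eplot_imp_plot_B[OF eplot_const[OF openin_Rn[of 0] x0]], of "\<lambda>_. 0"] by (simp add: Rn_iff)
  define cl where "cl F = B.cube_class (Suc k) (orbit x0) (\<lambda>w. orbit (F w))" for F
  have cl_iff: "cl F = cl F' \<longleftrightarrow> htpy (Suc k) (milnor_B G X) (orbit x0) (\<lambda>w. orbit (F w)) (\<lambda>w. orbit (F' w))"
    if "disk x0 k a F" "disk x0 k a' F'" for F F' a a'
    unfolding cl_def by (rule B.cube_class_eq_iff[OF b disk_cubes[OF x0 that(1)] disk_cubes[OF x0 that(2)]])
  have class_iff: "cl F = cl F' \<longleftrightarrow> cube_class k \<one> a = cube_class k \<one> a'"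
    if "disk x0 k a F" "disk x0 k a' F'" for F F' a a'
    unfolding cl_iff[OF that] cube_class_eq_iff[OF one_point diskD(1)[OF x0 that(1)] diskD(1)[OF x0 that(2)]]
    using disk_htpy_imp[OF x0 that] htpy_imp_disk_htpy[OF that] by blast
  have B_carrier: "A \<in> carrier ?B \<longleftrightarrow> (\<exists>a F. disk x0 k a F \<and> A = cl F)" for A
  proof
    assume "A \<in> carrier ?B"
    then obtain f where f: "f \<in> cubes (Suc k) (milnor_B G X) (orbit x0)" "A = B.cube_class (Suc k) (orbit x0) f"
      unfolding B.homotopy_group_carrier[OF b] by blast
    obtain a F where F: "disk x0 k a F" "htpy (Suc k) (milnor_B G X) (orbit x0) f (\<lambda>w. orbit (F w))"
      using disk_exists[OF x0 f(1)] by blast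
    then have "A = cl F" unfolding cl_def f(2) by (simp add: B.cube_class_eq_iff[OF b f(1) disk_cubes[OF x0 F(1)]])
    with F(1) show "\<exists>a F. disk x0 k a F \<and> A = cl F" by blast
  next
    assume "\<exists>a F. disk x0 k a F \<and> A = cl F"
    then show "A \<in> carrier ?B" unfolding B.homotopy_group_carrier[OF b] cl_def using disk_cubes[OF x0] by blast
  qed
  have G_carrier: "C \<in> carrier ?G \<longleftrightarrow> (\<exists>a F. disk x0 k a F \<and> C = cube_class k \<one> a)" for C
  proof
    assume "C \<in> carrier ?G"
    then obtain a where a: "a \<in> cubes k X \<one>" "C = cube_class k \<one> a" unfolding dgroup_homotopy_carrier by blast
    have "finite {j. fst x0 j \<noteq> 0}" using x0 by (simp add: milnor_S_iff weights_def)
    then obtain N where "fst x0 N = 0" using ex_new_if_finite[of "{j. fst x0 j \<noteq> 0}"] by auto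
    from cone_disk[OF x0 a(1) this] have "disk x0 k (\<lambda>v. a (smash_cube k v)) (cone_disk x0 N k a)" .
    moreover have "C = cube_class k \<one> (\<lambda>v. a (smash_cube k v))"
      unfolding a(2) cube_class_eq_iff[OF one_point a(1) smash_cubes[OF a(1)]] by (rule htpy_smash[OF a(1)])
    ultimately show "\<exists>a F. disk x0 k a F \<and> C = cube_class k \<one> a" by blast
  next
    assume "\<exists>a F. disk x0 k a F \<and> C = cube_class k \<one> a"
    then show "C \<in> carrier ?G" unfolding dgroup_homotopy_carrier using diskD(1)[OF x0] by blast
  qed
  \<comment> \<open>Any disk over the class may be chosen; \<open>class_iff\<close> makes the value
    independent of it.\<close>
  define h where "h A = (SOME C. \<exists>a F. disk x0 k a F \<and> A = cl F \<and> C = cube_class k \<one> a)" for A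
  have h: "h (cl F) = cube_class k \<one> a" if F: "disk x0 k a F" for a F
  proof -
    have "\<exists>C a' F'. disk x0 k a' F' \<and> cl F = cl F' \<and> C = cube_class k \<one> a'" using F by blast
    from someI_ex[OF this] obtain a' F' where "disk x0 k a' F'" "cl F = cl F'" "h (cl F) = cube_class k \<one> a'"
      unfolding h_def by blast
    then show ?thesis using class_iff[OF F] by metis
  qed
  have mult: "h (A \<otimes>\<^bsub>?B\<^esub> A') = h A \<otimes>\<^bsub>?G\<^esub> h A'" if A: "A \<in> carrier ?B" "A' \<in> carrier ?B" for A A'
  proof -
    obtain a F where F: "disk x0 k a F" "A = cl F" using A(1) unfolding B_carrier by blast
    obtain a' F' where F': "disk x0 k a' F'" "A' = cl F'" using A(2) unfolding B_carrier by blast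
    have BB: "A \<otimes>\<^bsub>?B\<^esub> A' = B.cube_class (Suc k) (orbit x0) (cat 0 (\<lambda>w. orbit (F w)) (\<lambda>w. orbit (F' w)))"
      unfolding F(2) F'(2) cl_def
      by (rule B.homotopy_group_mult[OF b disk_cubes[OF x0 F(1)] disk_cubes[OF x0 F'(1)]])
    show ?thesis
    proof (cases k)
      case 0
      let ?F = "cat 0 F (\<lambda>w. act (a (\<lambda>_. 0)) (F' w))"
      have d: "disk x0 k (\<lambda>v. a v \<otimes> a' v) ?F" using disk_mult F(1) F'(1) 0 by simp
      have R0: "(\<lambda>_. 0) \<in> Rn 0" by (simp add: Rn_iff)
      \<comment> \<open>Translating the second half leaves its orbits unchanged, so the product disk
        still projects to the concatenation.\<close>
      have eq: "\<forall>w\<in>Rn (Suc k). cat 0 (\<lambda>w. orbit (F w)) (\<lambda>w. orbit (F' w)) w = orbit (?F w)"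
      proof
        fix w assume w: "w \<in> Rn (Suc k)"
        have "orbit (act (a (\<lambda>_. 0)) (F' (w(0 := s)))) = orbit (F' (w(0 := s)))" for s
        proof (rule orbit_act)
          show "F' (w(0 := s)) \<in> S" by (rule eplot_S[OF diskD(2)[OF x0 F'(1)] Rn_upd[OF w]]) simp
          show "a (\<lambda>_. 0) \<in> carrier G" using cubes_carrier[OF diskD(1)[OF x0 F(1)]] R0 0 by simp
        qed
        then show "cat 0 (\<lambda>w. orbit (F w)) (\<lambda>w. orbit (F' w)) w = orbit (?F w)" by (simp add: cat_def)
      qed
      have "A \<otimes>\<^bsub>?B\<^esub> A' = cl ?F"
        unfolding BB cl_def B.cube_class_def cube_loop_eq_iff[THEN iffD2, OF eq] ..
      then have "h (A \<otimes>\<^bsub>?B\<^esub> A') = cube_class k \<one> (\<lambda>v. a v \<otimes> a' v)" using h[OF d] by simp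
      also have "\<dots> = cube_class k \<one> a \<otimes>\<^bsub>?G\<^esub> cube_class k \<one> a'"
        using pi0_group_mult[of a a'] diskD(1)[OF x0 F(1)] diskD(1)[OF x0 F'(1)] 0
        by (simp add: homotopy_group_of_dgroup_def)
      finally show ?thesis using h F F' by simp
    next
      case (Suc k')
      have d: "disk x0 k (cat 0 a a') (cat 0 F F')" using disk_cat F(1) F'(1) Suc by simp
      have "A \<otimes>\<^bsub>?B\<^esub> A' = cl (cat 0 F F')"
        unfolding BB cl_def by (rule arg_cong[where f="B.cube_class (Suc k) (orbit x0)"]) (auto simp: cat_def fun_eq_iff)
      then have "h (A \<otimes>\<^bsub>?B\<^esub> A') = cube_class k \<one> (cat 0 a a')" using h[OF d] by simp
      also have "\<dots> = cube_class k \<one> a \<otimes>\<^bsub>?G\<^esub> cube_class k \<one> a'"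
        using homotopy_group_mult[OF one_point, of a k' a'] diskD(1)[OF x0 F(1)] diskD(1)[OF x0 F'(1)] Suc
        by (simp add: homotopy_group_of_dgroup_def)
      finally show ?thesis using h F F' by simp
    qed
  qed
  have "h \<in> iso ?B ?G"
  proof (rule isoI)
    show "h \<in> hom ?B ?G"
    proof (rule homI)
      show "h A \<in> carrier ?G" if "A \<in> carrier ?B" for A
        using that h unfolding B_carrier G_carrier by blast
    qed (rule mult)
    show "bij_betw h (carrier ?B) (carrier ?G)"
    proof (rule bij_betw_imageI)
      show "inj_on h (carrier ?B)"
      proof (rule inj_onI)
        fix A A' assume "A \<in> carrier ?B" "A' \<in> carrier ?B" "h A = h A'"
        then obtain a F a' F' where F: "disk x0 k a F" "A = cl F" "disk x0 k a' F'" "A' = cl F'" "h A = h A'"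
          unfolding B_carrier by blast
        then have "cube_class k \<one> a = cube_class k \<one> a'" using h[OF F(1)] h[OF F(3)] by simp
        then show "A = A'" unfolding F(2,4) class_iff[OF F(1,3)] .
      qed
      show "h ` carrier ?B = carrier ?G"
      proof (rule equalityI; rule subsetI)
        fix C assume "C \<in> h ` carrier ?B"
        then obtain A where "A \<in> carrier ?B" "C = h A" by blast
        then show "C \<in> carrier ?G" unfolding B_carrier G_carrier using h by blast
      next
        fix C assume "C \<in> carrier ?G"
        then obtain a F where F: "disk x0 k a F" "C = cube_class k \<one> a" unfolding G_carrier by blast
        then have "cl F \<in> carrier ?B" unfolding B_carrier by blast
        then show "C \<in> h ` carrier ?B" using h[OF F(1)] F(2) by (metis image_eqI)
      qed
    qed
  qed
  then show ?thesis unfolding is_iso_def by blast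
qed

end

lemma milnor_E_pointE:
  assumes "e \<in> points (milnor_E X)"
  obtains x0 where "x0 \<in> S" "orbit_rel G X `` {e} = orbit x0"
  using assms unfolding milnor_E_points orbit_def by blast

end

theorem proposition5p2:
  fixes G :: "('a, 'b) monoid_scheme" and X :: "'a dspace"
    and e :: "'a milnor_seq set" and k :: nat
  assumes "diffeological_group G X"
    and "e \<in> points (milnor_E X)"
    and "k > 0"
  shows "homotopy_group k (milnor_B G X) (orbit_rel G X `` {e})
           \<cong> homotopy_group_of_dgroup (k - 1) G X"
proof -
  interpret diffeological_group G X by fact
  obtain x0 where x0: "x0 \<in> points (milnor_S X)" "orbit_rel G X `` {e} = orbit x0"
    using assms(2) by (rule milnor_E_pointE)
  have "k = Suc (k - 1)" using assms(3) by simp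
  then show ?thesis using connecting_iso[OF x0(1), of "k - 1"] x0(2) by simp
qed

end
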